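(* Let $f\in\mathcal{H}$, and let $R_+$, $T_+$, $u^f$, $k_+^f$ be as defined in the context. Then: 1. The map $R_+$ extends to a continuous map from $\mathcal{H}$ to $L^2(S^1\times\Omega,\,d\theta\times d\nu)$. 2. The map $T_+$ is an isometry between $\mathcal{H}$ and $L^2(S^1\times\Omega,\,d\theta\times d\nu)$. 3. We have $$u^f(v,t)=\int_\Omega q^{\frac{h_\omega(v)}{2}}\,k_+^f\big(h_\omega(v)-t,\omega\big)\,d\nu(\omega).$$ 4. We have the relation $$T_+=\frac{q^{is}-q^{-1}q^{-is}}{1+q^{-1}}\cdot R_+ .$$
   Context: Let $\mathcal{T}$ be the $(q+1)$-regular tree with path metric $d$ and a fixed base vertex $o$. Functions on $\mathcal{T}$ are functions on its vertices. $A$ is the adjacency operator, $[Af](v)=\sum_{w\sim v}f(w)$. Boundary: $\Omega$ is the set of infinite non-backtracking paths modulo the equivalence $\gamma_1\sim\gamma_2$ iff $\lim_n d(\gamma_1(n),\gamma_2(n))<\infty$. For $\omega\in\Omega$, $\gamma_{o,\omega}$ is the unique non-backtracking path starting at $o$ in the class $\omega$. $\Omega(v)$ is the set of $\omega$ such that $\gamma_{o,\omega}$ passes through $v$; these sets form a basis of the topology of $\Omega$. $\nu$ is the probability measure on $\Omega$ with $\nu(\Omega(v))=\frac{1}{(q+1)q^{d(o,v)-1}}$ for $v\ne o$. The Busemann function is $h_\omega(v)=\lim_{n\to\infty}\big(n-d(\gamma_{o,\omega}(n),v)\big)$. $\mathcal{K}(\Omega)$ is the space of continuous functions on $\Omega$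 taking only finitely many values, and $\mathcal{K}'(\Omega)$ is its dual (finitely additive measures); a function $g$ on $\Omega$ is identified with $g\,d\nu$. $S^1\subset\mathbb{C}$ is the unit circle, whose points are written $q^{is}=e^{i\theta}$, with arclength measure $d\theta$ (total mass $2\pi$). The Poisson transform of $m\in\mathcal{K}'(\Omega)$ with spectral parameter $q^{is}$ is $\mathcal{P}_{q^{is}}(m)(v)=\int_\Omega q^{(\frac12+is)h_\omega(v)}\,dm(\omega)$. For $q^{is}\ne\pm\frac1{\sqrt q}$, every function $F$ on $\mathcal{T}$ with $\frac{A}{2\sqrt q}F=\frac{q^{is}+q^{-is}}{2}F$ is $\mathcal{P}_{q^{is}}(m)$ for a unique $m\in\mathcal{K}'(\Omega)$. The $c$-function is $c(\xi)=\frac{\xi-q^{-1}\xi^{-1}}{\xi-\xi^{-1}}$. The Helgason transform of a finitely supported $f$ is $[\mathrm{Hel}(f)](q^{is},\omega)=\sum_{x\in\mathcal{T}}f(x)\,q^{(\frac12+is)h_\omega(x)}$. Wave equation: $u:\mathcal{T}\times\mathbb{Z}\to\mathbb{C}$ with $\frac{A_v}{2\sqrt q}u(v,t)=\frac{u(v,t+1)+u(v,t-1)}{2}$, where $A_v$ is $A$ applied in the variable $v$. $\mathcal{H}$ is the Hilbert space completion of the space of pairs of compactly supported functions on $\mathcal{T}$ with respect to the energy form $[(g_1,g_2),(f_1,f_2)]=\big\langle(1-\tfrac{A^2}{4q})g_1,f_1\big\rangle+\langle g_2,f_2\rangle$. For $f=(f_1,f_2)$, $u^f$ is the solution with initial conditions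 $u(v,0)=f_1(v)$ and $\frac{u(v,1)-u(v,-1)}{2}=f_2(v)$; for fixed $(v,t)$ the value $u^f(v,t)$ depends continuously on $f\in\mathcal{H}$. The map $T_+$ is defined by $$(f_1,0)\mapsto[\mathrm{Hel}(f_1)](q^{-is},\omega)\cdot c(q^{-is})^{-1}\cdot\Big(\frac{q^{is}-q^{-is}}{2}\Big),\qquad (0,f_2)\mapsto-[\mathrm{Hel}(f_2)](q^{-is},\omega)\cdot c(q^{-is})^{-1},$$ extended linearly (and to $\mathcal{H}$ by continuity). Put $\hat u^f(v,q^{is})=\sum_{t=-\infty}^\infty u^f(v,t)(q^{is})^t$; it satisfies $\frac{A_v}{2\sqrt q}\hat u^f(v,q^{is})=\frac{q^{is}+q^{-is}}{2}\hat u^f(v,q^{is})$. The map $R_+$ is defined by $[R_+f](q^{is},\omega)=\mathcal{P}_{q^{is}}^{-1}\big(\hat u^f(\cdot,q^{is})\big)(\omega)$. A priori the series might not converge and the preimage under the Poisson transform is only a finitely additive measure; that this procedure is well-defined, giving a function on $\Omega$, is part of the content of the theorem. Finally $k_+^f(t,\omega)=\frac1{2\pi}\int_{S^1}[R_+f](q^{is},\omega)\cdot(q^{is})^t\,d\theta$.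
   Formalization: T₊ is shown to be onto L² and isometric up to a scalar: inner products are multiplied by 4πq/(q+1), since with arclength of total mass 2π the literal isometry fails, e.g. for (0,δ_o); q ≥ 2 is assumed, as for q = 1 the context's continuity of f ↦ u^f(v,t) fails. *)

theory Defs
  imports "HOL-Analysis.Analysis" "HOL-Library.Function_Algebras"
begin

definition has_graph_cycle :: "('v \<Rightarrow> 'v \<Rightarrow> bool) \<Rightarrow> bool" where
  "has_graph_cycle adj \<longleftrightarrow>
     (\<exists>xs. length xs \<ge> 3 \<and> distinct xs \<and> successively adj xs \<and> adj (last xs) (hd xs))"

text \<open>The vertex set of the tree is the whole type \<open>'v\<close>.  The case \<open>q = 1\<close> is excluded: there the
  notation \<open>q\<^sup>i\<^sup>s\<close> for points of the unit circle is meaningless, and point evaluations of solutions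
  are not continuous in the energy norm.\<close>

locale regular_tree =
  fixes q :: nat and adj :: "'v \<Rightarrow> 'v \<Rightarrow> bool" and x0 :: 'v
  assumes q_ge_2: "q \<ge> 2"
    and adj_sym: "adj v w \<Longrightarrow> adj w v"
    and adj_irrefl: "\<not> adj v v"
    and connected: "adj\<^sup>*\<^sup>* v w"
    and acyclic: "\<not> has_graph_cycle adj"
    and regular: "card {w. adj v w} = q + 1"
begin

definition tdist :: "'v \<Rightarrow> 'v \<Rightarrow> nat" where
  "tdist v w = (LEAST n. (adj ^^ n) v w)"

definition adjop :: "('v \<Rightarrow> complex) \<Rightarrow> 'v \<Rightarrow> complex" where
  "adjop f v = (\<Sum>w | adj v w. f w)"


subsection \<open>The boundary\<close>

definition rays :: "(nat \<Rightarrow> 'v) set" where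
  "rays = {\<gamma>. \<forall>n. adj (\<gamma> n) (\<gamma> (Suc n)) \<and> \<gamma> (Suc (Suc n)) \<noteq> \<gamma> n}"

definition same_end :: "((nat \<Rightarrow> 'v) \<times> (nat \<Rightarrow> 'v)) set" where
  "same_end = {(\<gamma>1, \<gamma>2). \<gamma>1 \<in> rays \<and> \<gamma>2 \<in> rays \<and>
                 (\<exists>L. (\<lambda>n. real (tdist (\<gamma>1 n) (\<gamma>2 n))) \<longlonglongrightarrow> L)}"

definition boundary :: "(nat \<Rightarrow> 'v) set set" where
  "boundary = rays // same_end"

definition geod :: "(nat \<Rightarrow> 'v) set \<Rightarrow> nat \<Rightarrow> 'v" where
  "geod \<omega> = (THE \<gamma>. \<gamma> \<in> \<omega> \<and> \<gamma> 0 = x0)"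

definition shadow :: "'v \<Rightarrow> (nat \<Rightarrow> 'v) set set" where
  "shadow v = {\<omega> \<in> boundary. \<exists>n. geod \<omega> n = v}"

definition boundary_top :: "(nat \<Rightarrow> 'v) set topology" where
  "boundary_top = topology_generated_by (range shadow)"

definition busemann :: "(nat \<Rightarrow> 'v) set \<Rightarrow> 'v \<Rightarrow> int" where
  "busemann \<omega> v = lim (\<lambda>n. int n - int (tdist (geod \<omega> n) v))"

text \<open>For \<open>\<xi> = q\<^sup>i\<^sup>s\<close> this is \<open>q\<close> to the power \<open>(1/2 + is) h\<^sub>\<omega>(v)\<close>.\<close>

definition horo :: "complex \<Rightarrow> 'v \<Rightarrow> (nat \<Rightarrow> 'v) set \<Rightarrow> complex" where
  "horo \<xi> v \<omega> = of_real (real q powr (of_int (busemann \<omega> v) / 2)) * \<xi> powi busemann \<omega> v"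


subsection \<open>Finitely additive measures on the boundary and the Poisson transform\<close>

text \<open>Functions on the boundary are \<open>extensional\<close>, and so are the functionals on them, so that
  elements of the dual space are equal iff they agree on all test functions.\<close>

definition test_functions :: "((nat \<Rightarrow> 'v) set \<Rightarrow> complex) set" where
  "test_functions = {\<phi> \<in> extensional boundary.
     continuous_map boundary_top euclidean \<phi> \<and> finite (\<phi> ` boundary)}"

definition fin_add_measures :: "(((nat \<Rightarrow> 'v) set \<Rightarrow> complex) \<Rightarrow> complex) set" where
  "fin_add_measures = {m \<in> extensional test_functions.
     (\<forall>\<phi>\<in>test_functions. \<forall>\<psi>\<in>test_functions. m (\<lambda>\<omega>\<in>boundary. \<phi> \<omega> + \<psi> \<omega>) = m \<phi> + m \<psi>) \<and>
     (\<forall>a. \<forall>\<phi>\<in>test_functions. m (\<lambda>\<omega>\<in>boundary. a * \<phi> \<omega>) = a * m \<phi>)}"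

definition poisson :: "complex \<Rightarrow> (((nat \<Rightarrow> 'v) set \<Rightarrow> complex) \<Rightarrow> complex) \<Rightarrow> 'v \<Rightarrow> complex" where
  "poisson \<xi> m v = m (\<lambda>\<omega>\<in>boundary. horo \<xi> v \<omega>)"


subsection \<open>The wave equation\<close>

definition fin_pairs :: "(('v \<Rightarrow> complex) \<times> ('v \<Rightarrow> complex)) set" where
  "fin_pairs = {f. finite {v. fst f v \<noteq> 0} \<and> finite {v. snd f v \<noteq> 0}}"

definition wave_eq :: "('v \<Rightarrow> int \<Rightarrow> complex) \<Rightarrow> bool" where
  "wave_eq u \<longleftrightarrow> (\<forall>v t. adjop (\<lambda>w. u w t) v / (2 * of_real (sqrt (real q)))
                          = (u v (t + 1) + u v (t - 1)) / 2)"

definition wave_fin :: "('v \<Rightarrow> complex) \<times> ('v \<Rightarrow> complex) \<Rightarrow> 'v \<Rightarrow> int \<Rightarrow> complex" where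
  "wave_fin f = (THE u. wave_eq u \<and> (\<forall>v. u v 0 = fst f v) \<and>
                        (\<forall>v. (u v 1 - u v (-1)) / 2 = snd f v))"


subsection \<open>The energy space\<close>

definition l2_inner :: "('v \<Rightarrow> complex) \<Rightarrow> ('v \<Rightarrow> complex) \<Rightarrow> complex" where
  "l2_inner a b = (\<Sum>\<^sub>\<infinity>v. a v * cnj (b v))"

definition energy :: "('v \<Rightarrow> complex) \<times> ('v \<Rightarrow> complex) \<Rightarrow> ('v \<Rightarrow> complex) \<times> ('v \<Rightarrow> complex) \<Rightarrow> complex"
  where "energy g f =
     l2_inner (\<lambda>v. fst g v - adjop (adjop (fst g)) v / (4 * of_nat q)) (fst f) + l2_inner (snd g) (snd f)"

definition energy_norm :: "('v \<Rightarrow> complex) \<times> ('v \<Rightarrow> complex) \<Rightarrow> real" where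
  "energy_norm f = sqrt (Re (energy f f))"

text \<open>The completion \<open>energy_space\<close> consists of the equivalence classes of energy-Cauchy sequences.\<close>

definition energy_Cauchy :: "(nat \<Rightarrow> ('v \<Rightarrow> complex) \<times> ('v \<Rightarrow> complex)) set" where
  "energy_Cauchy = {X. (\<forall>n. X n \<in> fin_pairs) \<and>
     (\<forall>e>0. \<exists>N. \<forall>m\<ge>N. \<forall>n\<ge>N. energy_norm (X m - X n) < e)}"

definition energy_equiv :: "((nat \<Rightarrow> ('v \<Rightarrow> complex) \<times> ('v \<Rightarrow> complex)) \<times>
                             (nat \<Rightarrow> ('v \<Rightarrow> complex) \<times> ('v \<Rightarrow> complex))) set" where
  "energy_equiv = {(X, Y). X \<in> energy_Cauchy \<and> Y \<in> energy_Cauchy \<and>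
                           (\<lambda>n. energy_norm (X n - Y n)) \<longlonglongrightarrow> 0}"

definition energy_space :: "(nat \<Rightarrow> ('v \<Rightarrow> complex) \<times> ('v \<Rightarrow> complex)) set set" where
  "energy_space = energy_Cauchy // energy_equiv"

definition energy_embed ::
    "('v \<Rightarrow> complex) \<times> ('v \<Rightarrow> complex) \<Rightarrow> (nat \<Rightarrow> ('v \<Rightarrow> complex) \<times> ('v \<Rightarrow> complex)) set" where
  "energy_embed f = energy_equiv `` {\<lambda>_. f}"

text \<open>Extensions by continuity to the completion: the common value of the limit along all
  representatives.\<close>

definition energy_inner ::
    "(nat \<Rightarrow> ('v \<Rightarrow> complex) \<times> ('v \<Rightarrow> complex)) set \<Rightarrow>
     (nat \<Rightarrow> ('v \<Rightarrow> complex) \<times> ('v \<Rightarrow> complex)) set \<Rightarrow> complex" where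
  "energy_inner F G = (THE c. \<forall>X\<in>F. \<forall>Y\<in>G. (\<lambda>n. energy (X n) (Y n)) \<longlonglongrightarrow> c)"

definition energy_dist ::
    "(nat \<Rightarrow> ('v \<Rightarrow> complex) \<times> ('v \<Rightarrow> complex)) set \<Rightarrow>
     (nat \<Rightarrow> ('v \<Rightarrow> complex) \<times> ('v \<Rightarrow> complex)) set \<Rightarrow> real" where
  "energy_dist F G = (THE r. \<forall>X\<in>F. \<forall>Y\<in>G. (\<lambda>n. energy_norm (X n - Y n)) \<longlonglongrightarrow> r)"

definition wave :: "(nat \<Rightarrow> ('v \<Rightarrow> complex) \<times> ('v \<Rightarrow> complex)) set \<Rightarrow> 'v \<Rightarrow> int \<Rightarrow> complex" where
  "wave F v t = (THE c. \<forall>X\<in>F. (\<lambda>n. wave_fin (X n) v t) \<longlonglongrightarrow> c)"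


subsection \<open>The Helgason transform\<close>

definition helgason :: "('v \<Rightarrow> complex) \<Rightarrow> complex \<Rightarrow> (nat \<Rightarrow> 'v) set \<Rightarrow> complex" where
  "helgason f \<xi> \<omega> = (\<Sum>\<^sub>\<infinity>x. f x * horo \<xi> x \<omega>)"

text \<open>At the poles \<open>\<xi> = 1\<close> and \<open>\<xi> = -1\<close> of the \<open>c\<close>-function the convention \<open>z / 0 = 0\<close> makes
  \<open>inverse (c_fun \<xi>)\<close> equal to 0, which is the correct value of its continuous extension.\<close>

definition c_fun :: "complex \<Rightarrow> complex" where
  "c_fun \<xi> = (\<xi> - inverse (of_nat q) * inverse \<xi>) / (\<xi> - inverse \<xi>)"

text \<open>With arclength measure (total mass \<open>2\<pi>\<close>) on the circle, \<open>T\<^sub>+\<close> in this normalization is an isometry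
  only up to a scalar: the image of \<open>(0, \<delta>\<^bsub>x0\<^esub>)\<close> is \<open>- inverse (c_fun (inverse \<xi>))\<close>, whose squared
  \<open>L\<^sup>2\<close> norm is \<open>4\<pi>q / (q + 1)\<close>, while the energy of \<open>(0, \<delta>\<^bsub>x0\<^esub>)\<close> is \<open>1\<close>.\<close>

definition T_plus_fin ::
    "('v \<Rightarrow> complex) \<times> ('v \<Rightarrow> complex) \<Rightarrow> complex \<times> (nat \<Rightarrow> 'v) set \<Rightarrow> complex" where
  "T_plus_fin f = (\<lambda>(\<xi>, \<omega>).
      helgason (fst f) (inverse \<xi>) \<omega> * inverse (c_fun (inverse \<xi>)) * ((\<xi> - inverse \<xi>) / 2)
    - helgason (snd f) (inverse \<xi>) \<omega> * inverse (c_fun (inverse \<xi>)))"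

definition wave_hat :: "('v \<Rightarrow> complex) \<times> ('v \<Rightarrow> complex) \<Rightarrow> complex \<Rightarrow> 'v \<Rightarrow> complex" where
  "wave_hat f \<xi> v = (\<Sum>\<^sub>\<infinity>t::int. wave_fin f v t * \<xi> powi t)"

end


subsection \<open>Square integrable functions on the circle times the boundary\<close>

definition circle_measure :: "complex measure" where
  "circle_measure =
     distr (restrict_space lborel {0..<2 * pi}) (restrict_space borel (sphere 0 1)) cis"

text \<open>Elements of \<open>L\<^sup>2\<close> are represented by functions; equality in \<open>L\<^sup>2\<close> is equality almost
  everywhere.\<close>

definition L2 :: "'a measure \<Rightarrow> ('a \<Rightarrow> complex) set" where
  "L2 M = {F \<in> borel_measurable M. integrable M (\<lambda>x. (cmod (F x))\<^sup>2)}"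

definition L2_inner :: "'a measure \<Rightarrow> ('a \<Rightarrow> complex) \<Rightarrow> ('a \<Rightarrow> complex) \<Rightarrow> complex" where
  "L2_inner M F G = (\<integral>x. F x * cnj (G x) \<partial>M)"

definition L2_dist :: "'a measure \<Rightarrow> ('a \<Rightarrow> complex) \<Rightarrow> ('a \<Rightarrow> complex) \<Rightarrow> real" where
  "L2_dist M F G = sqrt (\<integral>x. (cmod (F x - G x))\<^sup>2 \<partial>M)"


locale regular_tree_measure = regular_tree q adj x0
  for q :: nat and adj :: "'v \<Rightarrow> 'v \<Rightarrow> bool" and x0 :: 'v +
  fixes \<nu> :: "(nat \<Rightarrow> 'v) set measure"
  assumes prob_nu: "emeasure \<nu> (space \<nu>) = 1"
    and space_nu: "space \<nu> = boundary"
    and sets_nu: "sets \<nu> = sigma_sets boundary {U. openin boundary_top U}"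
    and nu_shadow: "v \<noteq> x0 \<Longrightarrow>
          measure \<nu> (shadow v) = 1 / ((real q + 1) * real q ^ (tdist x0 v - 1))"
begin

abbreviation target :: "(complex \<times> (nat \<Rightarrow> 'v) set) measure" where
  "target \<equiv> circle_measure \<Otimes>\<^sub>M \<nu>"

text \<open>The functional \<open>g d\<nu>\<close> identified with a function \<open>g\<close> on the boundary.\<close>

definition density_functional ::
    "((nat \<Rightarrow> 'v) set \<Rightarrow> complex) \<Rightarrow> ((nat \<Rightarrow> 'v) set \<Rightarrow> complex) \<Rightarrow> complex" where
  "density_functional g = (\<lambda>\<phi>\<in>test_functions. \<integral>\<omega>. \<phi> \<omega> * g \<omega> \<partial>\<nu>)"

text \<open>\<open>is_R_plus_fin f G\<close>: for the finitely supported pair \<open>f\<close>, the procedure defining \<open>R\<^sub>+\<close> is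
  well-defined and yields the function \<open>G\<close>, i.e. at every \<open>\<xi>\<close> on the circle the Fourier series of
  the solution converges, its sum is a Poisson transform, and the inverse Poisson transform is
  \<open>G(\<xi>, \<cdot>) d\<nu>\<close>.\<close>

definition is_R_plus_fin ::
    "('v \<Rightarrow> complex) \<times> ('v \<Rightarrow> complex) \<Rightarrow> (complex \<times> (nat \<Rightarrow> 'v) set \<Rightarrow> complex) \<Rightarrow> bool" where
  "is_R_plus_fin f G \<longleftrightarrow> (\<forall>\<xi>\<in>sphere 0 1.
      (\<forall>v. (\<lambda>t::int. wave_fin f v t * \<xi> powi t) summable_on UNIV) \<and>
      inj_on (poisson \<xi>) fin_add_measures \<and>
      wave_hat f \<xi> \<in> poisson \<xi> ` fin_add_measures \<and>
      integrable \<nu> (\<lambda>\<omega>. G (\<xi>, \<omega>)) \<and>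
      the_inv_into fin_add_measures (poisson \<xi>) (wave_hat f \<xi>)
        = density_functional (\<lambda>\<omega>. G (\<xi>, \<omega>)))"

definition continuous_into_L2 ::
    "((nat \<Rightarrow> ('v \<Rightarrow> complex) \<times> ('v \<Rightarrow> complex)) set \<Rightarrow>
      complex \<times> (nat \<Rightarrow> 'v) set \<Rightarrow> complex) \<Rightarrow> bool" where
  "continuous_into_L2 S \<longleftrightarrow> (\<forall>f\<in>energy_space. S f \<in> L2 target) \<and>
     (\<forall>f\<in>energy_space. \<forall>e>0. \<exists>d>0. \<forall>g\<in>energy_space.
        energy_dist g f < d \<longrightarrow> L2_dist target (S g) (S f) < e)"

text \<open>Finitely supported pairs are dense in \<open>energy_space\<close>, so the following two predicates determine
  \<open>R f\<close> and \<open>T f\<close> almost everywhere.\<close>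

definition is_R_plus ::
    "((nat \<Rightarrow> ('v \<Rightarrow> complex) \<times> ('v \<Rightarrow> complex)) set \<Rightarrow>
      complex \<times> (nat \<Rightarrow> 'v) set \<Rightarrow> complex) \<Rightarrow> bool" where
  "is_R_plus R \<longleftrightarrow> continuous_into_L2 R \<and>
     (\<forall>f\<in>fin_pairs. \<exists>G. is_R_plus_fin f G \<and> (AE x in target. R (energy_embed f) x = G x))"

definition is_T_plus ::
    "((nat \<Rightarrow> ('v \<Rightarrow> complex) \<times> ('v \<Rightarrow> complex)) set \<Rightarrow>
      complex \<times> (nat \<Rightarrow> 'v) set \<Rightarrow> complex) \<Rightarrow> bool" where
  "is_T_plus T \<longleftrightarrow> continuous_into_L2 T \<and>
     (\<forall>f\<in>fin_pairs. AE x in target. T (energy_embed f) x = T_plus_fin f x)"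

end

definition k_plus ::
    "(complex \<times> 'w \<Rightarrow> complex) \<Rightarrow> int \<Rightarrow> 'w \<Rightarrow> complex" where
  "k_plus Rf t \<omega> = (\<integral>\<xi>. Rf (\<xi>, \<omega>) * \<xi> powi t \<partial>circle_measure) / of_real (2 * pi)"

end

theory Submission
  imports Defs
begin

text \<open>
  Everything rests on the functions \<open>horo \<xi> v\<close>. Fix an end \<open>\<omega>\<close> and write \<open>h\<close> for its Busemann
  function and \<open>\<alpha> = \<surd>q \<xi>\<close>, so that \<open>horo \<xi> v \<omega> = \<alpha>\<^sup>h\<close>. Each vertex has exactly one neighbour with
  \<open>h\<close> larger by one and \<open>q\<close> neighbours with \<open>h\<close> smaller by one, so \<open>horo \<xi> \<cdot> \<omega>\<close> is an
  eigenfunction of the adjacency operator (\<open>horo_eigenfunction\<close>). Moreover, for a vertex \<open>v\<close> with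
  parent \<open>p\<close> (towards the base vertex) the combination \<open>horo \<xi> v - horo \<xi> p / \<alpha>\<close> is a nonzero
  multiple of the indicator function of the shadow of \<open>v\<close> (\<open>shadow_ind_horo\<close>). A finitely additive
  measure is determined by its values on shadows, so the Poisson transform is injective
  (\<open>poisson_inj\<close>). This identity returns once more below, in the proof of surjectivity.

  Computing \<open>R\<^sub>+\<close> on finitely supported data means to find a function on the boundary whose
  Poisson transform is the Fourier series of the solution. By linearity, and because central
  differences in time turn data \<open>(0, f\<^sub>1)\<close> into \<open>(f\<^sub>1, 0)\<close>, only the solution with data \<open>(0, \<delta>\<^sub>x)\<close>
  matters. It depends on the distance \<open>d\<close> from \<open>x\<close> alone: at a time \<open>t > d\<close> with \<open>t - 1 - d\<close> even
  it equals \<open>q\<close> to the power \<open>-(t - 1)/2\<close>, it vanishes at the other times \<open>t \<ge> 0\<close>, and it is odd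
  in \<open>t\<close>. Its Fourier series is a sum of geometric series. On the other side, the spherical
  function \<open>\<integral> horo \<xi>\<^sup>-\<^sup>1 x \<cdot> horo \<xi> v d\<nu>\<close> satisfies a first order recurrence in the distance of
  \<open>x\<close> and \<open>v\<close> (\<open>spherical_step\<close>), and the two agree up to the factor \<open>kappa \<xi>\<close>
  (\<open>kappa_spherical\<close>). Hence \<open>R\<^sub>+ f\<close> is \<open>kappa\<close> times \<open>wave_transform f\<close>, the Helgason transform
  of the data at \<open>\<xi>\<^sup>-\<^sup>1\<close> in which \<open>f\<^sub>1\<close> carries the factor \<open>-(\<xi> - \<xi>\<^sup>-\<^sup>1)/2\<close>, whereas \<open>T\<^sub>+ f\<close> is
  \<open>tau\<close> times the same function. The quotient of \<open>tau\<close> and \<open>kappa\<close> is the factor of the last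
  claim.

  For the isometry the product \<open>T\<^sub>+ f \<cdot> cnj (T\<^sub>+ g)\<close> is integrated over the boundary first. Since
  \<open>|tau|\<^sup>2\<close> is a multiple of \<open>(\<xi>\<^sup>-\<^sup>1 - \<xi>) kappa\<close>, the result is a combination of the values of the
  Fourier series of the solution \<open>u\<close> with data \<open>f\<close> at the support of \<open>g\<close>. Integration over the
  circle then reads off \<open>u(y,1) - u(y,-1)\<close> and \<open>u(y,2) - 2 u(y,0) + u(y,-2)\<close>, which are \<open>2 f\<^sub>2(y)\<close>
  and, by the wave equation, \<open>-4 (1 - A\<^sup>2/4q) f\<^sub>1(y)\<close>: this is the energy form
  (\<open>T_plus_fin_isometry\<close>).

  For surjectivity it suffices that the image of the finitely supported pairs is dense. The image
  is a module over the polynomials in \<open>\<xi>\<close> and \<open>\<xi>\<^sup>-\<^sup>1\<close>, because multiplication by \<open>(\<xi> + \<xi>\<^sup>-\<^sup>1)/2\<close>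
  and by \<open>(\<xi> - \<xi>\<^sup>-\<^sup>1)/2\<close> corresponds to explicit operations on the data. By the identity for
  shadows it contains \<open>(\<xi> - \<xi>\<^sup>-\<^sup>1)\<close> times the indicator function of every shadow. The
  Stone-Weierstrass theorem and a monotone class argument turn this into density (\<open>image_dense\<close>).

  Finally \<open>L\<^sup>2\<close> is complete, so \<open>T\<^sub>+\<close> and \<open>R\<^sub>+\<close> extend to the energy space, and the inversion
  formula extends because both sides are continuous in the data.
\<close>

section \<open>The metric of the tree\<close>

context regular_tree begin

lemma finite_nbrs: "finite {w. adj v w}"
  using regular[of v] by (metis Suc_eq_plus1 card.infinite nat.distinct(1))

lemma relpowp_tdist: "(adj ^^ tdist v w) v w"
  unfolding tdist_def using connected[of v w] by (metis LeastI_ex rtranclp_imp_relpowp)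

lemma tdist_le: "(adj ^^ n) v w \<Longrightarrow> tdist v w \<le> n"
  unfolding tdist_def by (rule Least_le)

lemma tdist_refl [simp]: "tdist v v = 0"
  using tdist_le[of 0 v v] by simp

lemma tdist_eq_0_iff [simp]: "tdist v w = 0 \<longleftrightarrow> v = w"
  using relpowp_tdist[of v w] by auto

lemma tdist_triangle: "tdist v x \<le> tdist v w + tdist w x"
  using relpowp_trans[OF relpowp_tdist[of v w] relpowp_tdist[of w x]] by (rule tdist_le)

lemma relpowp_adj_sym: "(adj ^^ n) v w \<Longrightarrow> (adj ^^ n) w v"
proof (induction n arbitrary: w)
  case (Suc n)
  then obtain x where "(adj ^^ n) v x" "adj x w" by auto
  with Suc.IH have "(adj ^^ n) x v" "adj w x" using adj_sym by auto
  then show ?case by (meson relpowp_Suc_I2)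
qed simp

lemma tdist_sym: "tdist v w = tdist w v"
  using tdist_le relpowp_adj_sym relpowp_tdist by (metis antisym)

lemma tdist_adj: "adj v w \<Longrightarrow> tdist v w = 1"
  using tdist_le[of 1 v w] tdist_eq_0_iff[of v w] adj_irrefl by (cases "tdist v w") force+

lemma tdist_adj_le: "adj v w \<Longrightarrow> tdist y w \<le> Suc (tdist y v)"
  using tdist_triangle[of y w v] tdist_adj[of v w] by simp

lemma exists_closer_nbr:
  assumes "v \<noteq> y" obtains w where "adj v w" "tdist y v = Suc (tdist y w)"
proof -
  obtain m where m: "tdist y v = Suc m" using assms by (metis not0_implies_Suc tdist_eq_0_iff)
  with relpowp_tdist[of y v] obtain w where w: "(adj ^^ m) y w" "adj w v" by auto
  have "tdist y w \<le> m" using w tdist_le by blast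
  moreover have "tdist y v \<le> Suc (tdist y w)" using w tdist_adj_le by blast
  ultimately show ?thesis using that[of w] w m adj_sym by simp
qed

text \<open>
  This is the one place where acyclicity is used. A simple path between two vertices of the same
  sphere around \<open>y\<close> whose interior is farther from \<open>y\<close> would extend inwards: prepend and append
  neighbours of its ends that are closer to \<open>y\<close>. Either these coincide and close a cycle, or the
  longer path is again of the same kind, on a smaller sphere. At radius zero the two ends are both
  \<open>y\<close>.
\<close>

lemma no_detour:
  assumes "distinct (a # zs @ [b])" "successively adj (a # zs @ [b])"
    "tdist y a = n" "tdist y b = n" "\<And>z. z \<in> set zs \<Longrightarrow> tdist y z > n"
  shows False
  using assms
proof (induction n arbitrary: a zs b)
  case 0
  from 0(3,4) have "a = y" "b = y" by simp_all
  with 0(1) show ?case by simp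
next
  case (Suc n)
  obtain a' where a': "adj a a'" "tdist y a' = n"
    by (rule exists_closer_nbr[of a y]) (use Suc.prems(3) in auto)
  obtain b' where b': "adj b b'" "tdist y b' = n"
    by (rule exists_closer_nbr[of b y]) (use Suc.prems(4) in auto)
  let ?l = "a # zs @ [b]"
  have far: "tdist y z > n" if "z \<in> set ?l" for z
    using that Suc.prems(3,4) Suc.prems(5)[of z] by auto
  have nin: "a' \<notin> set ?l" "b' \<notin> set ?l" using far[of a'] far[of b'] a' b' by auto
  have path: "successively adj (a' # ?l)" using Suc.prems(2) a' adj_sym by simp
  show ?case
  proof (cases "a' = b'")
    case True
    have "has_graph_cycle adj" unfolding has_graph_cycle_def
      by (rule exI[of _ "a' # ?l"]) (use True Suc.prems nin path b' in auto)
    then show False using acyclic by simp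
  next
    case False
    have "successively adj ((a' # ?l) @ [b'])"
      by (subst successively_append_iff) (use path b' in simp)
    then have s: "successively adj (a' # ?l @ [b'])" by simp
    have d: "distinct (a' # ?l @ [b'])" using False nin Suc.prems(1) by auto
    show False
      by (rule Suc.IH[OF d s a'(2) b'(2) far])
  qed
qed

lemma tdist_adj_cases:
  assumes "adj v w"
  obtains "tdist y w = Suc (tdist y v)" | "tdist y v = Suc (tdist y w)"
proof -
  have "v \<noteq> w" using assms adj_irrefl by metis
  then have "tdist y v \<noteq> tdist y w"
    using no_detour[of v "[]" w y "tdist y v"] assms by (metis append_Nil distinct_length_2_or_more
        distinct_singleton empty_iff list.set(1) successively.simps(3) successively.simps(2))
  moreover have "tdist y w \<le> Suc (tdist y v)" "tdist y v \<le> Suc (tdist y w)"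
    using assms adj_sym tdist_adj_le by blast+
  ultimately show ?thesis using that by linarith
qed

lemma closer_nbr_unique:
  assumes "adj v a" "adj v b" "tdist y v = Suc (tdist y a)" "tdist y v = Suc (tdist y b)"
  shows "a = b"
proof (rule ccontr)
  assume "a \<noteq> b"
  moreover have "v \<noteq> a" "v \<noteq> b" "adj a v" using assms adj_sym adj_irrefl by metis+
  ultimately show False using no_detour[of a "[v]" b y "tdist y a"] assms by simp
qed

text \<open>
  Seen from any vertex \<open>y\<close>, a vertex other than \<open>y\<close> has a single neighbour towards \<open>y\<close>. Most later
  arguments about the tree are made from this fact and its analogue for the Busemann function,
  instead of from paths.
\<close>

lemma nbr_farther:
  assumes "adj v a" "adj v b" "tdist y v = Suc (tdist y a)" "b \<noteq> a"
  shows "tdist y b = Suc (tdist y v)"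
  using assms closer_nbr_unique[of v a b y] tdist_adj_cases[of v b y] by metis

lemma sum_nbrs_split:
  fixes F :: "'v \<Rightarrow> 'b::comm_semiring_1"
  assumes "adj v w0" "\<And>w. adj v w \<Longrightarrow> w \<noteq> w0 \<Longrightarrow> F w = c"
  shows "(\<Sum>w | adj v w. F w) = F w0 + of_nat q * c"
proof -
  have "(\<Sum>w | adj v w. F w) = F w0 + (\<Sum>w \<in> {w. adj v w} - {w0}. F w)"
    using assms finite_nbrs by (intro sum.remove) auto
  also have "(\<Sum>w \<in> {w. adj v w} - {w0}. F w) = (\<Sum>w \<in> {w. adj v w} - {w0}. c)"
    using assms by (intro sum.cong) auto
  also have "\<dots> = of_nat q * c" using assms finite_nbrs[of v] regular[of v] by simp
  finally show ?thesis .
qed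

section \<open>Rays\<close>

text \<open>
  Once a path without backtracking takes a step away from \<open>y\<close>, the neighbour towards \<open>y\<close> is always
  the one that it just left, so it moves away from \<open>y\<close> forever.
\<close>

lemma tdist_ray_linear:
  assumes "\<gamma> \<in> rays" "tdist y (\<gamma> (Suc k)) = Suc (tdist y (\<gamma> k))"
  shows "tdist y (\<gamma> (k + j)) = tdist y (\<gamma> k) + j"
proof -
  have "tdist y (\<gamma> (Suc (k + j))) = Suc (tdist y (\<gamma> (k + j))) \<and> tdist y (\<gamma> (k + j)) = tdist y (\<gamma> k) + j"
  proof (induction j)
    case (Suc j)
    have "adj (\<gamma> (Suc (k+j))) (\<gamma> (k+j))" "adj (\<gamma> (Suc (k+j))) (\<gamma> (Suc (Suc (k+j))))"
      "\<gamma> (Suc (Suc (k+j))) \<noteq> \<gamma> (k+j)"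
      using assms(1) adj_sym by (auto simp: rays_def)
    from nbr_farther[OF this(1,2) _ this(3)] Suc show ?case by simp
  qed (use assms in simp)
  then show ?thesis by simp
qed

lemma tdist_ray: assumes "\<gamma> \<in> rays" shows "tdist (\<gamma> k) (\<gamma> (k + j)) = j"
  using tdist_ray_linear[OF assms, of "\<gamma> k" k j] assms tdist_adj[of "\<gamma> k" "\<gamma> (Suc k)"]
  by (auto simp: rays_def)

text \<open>
  After the first vertex where two rays differ they run in opposite directions, so their distance
  grows by two in each step.
\<close>

lemma ray_from_root_unique:
  assumes r: "\<gamma>1 \<in> rays" "\<gamma>2 \<in> rays" "\<gamma>1 0 = \<gamma>2 0" and B: "\<And>n. tdist (\<gamma>1 n) (\<gamma>2 n) \<le> B"
  shows "\<gamma>1 = \<gamma>2"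
proof (rule ccontr)
  assume "\<gamma>1 \<noteq> \<gamma>2"
  then obtain m0 where "\<gamma>1 m0 \<noteq> \<gamma>2 m0" by auto
  define m where "m = (LEAST m. \<gamma>1 m \<noteq> \<gamma>2 m)"
  have m: "\<gamma>1 m \<noteq> \<gamma>2 m" "\<And>i. i < m \<Longrightarrow> \<gamma>1 i = \<gamma>2 i"
    unfolding m_def using \<open>\<gamma>1 m0 \<noteq> \<gamma>2 m0\<close> LeastI not_less_Least by (metis (mono_tags, lifting))+
  then obtain k where k: "m = Suc k" using r by (cases m) auto
  \<comment> \<open>At this time the two rays have been separate for \<open>B\<close> steps, and their distance exceeds \<open>B\<close>.\<close>
  define n where "n = m + B"
  let ?y = "\<gamma>1 n"
  have d1: "tdist ?y (\<gamma>1 k) = Suc B" "tdist ?y (\<gamma>1 m) = B"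
    using tdist_ray[OF r(1), of k "Suc B"] tdist_ray[OF r(1), of m B] by (simp_all add: tdist_sym n_def k)
  have "tdist ?y (\<gamma>2 m) = Suc (tdist ?y (\<gamma>1 k))"
  proof (rule nbr_farther[of "\<gamma>1 k" "\<gamma>1 m" "\<gamma>2 m" ?y])
    show "adj (\<gamma>1 k) (\<gamma>1 m)" using r k by (auto simp: rays_def)
    show "adj (\<gamma>1 k) (\<gamma>2 m)" using r k m(2)[of k] by (auto simp: rays_def)
  qed (use d1 m in auto)
  then have "tdist ?y (\<gamma>2 (Suc k)) = Suc (tdist ?y (\<gamma>2 k))" using k m(2)[of k] by simp
  from tdist_ray_linear[OF r(2) this, of "Suc B"] have "tdist ?y (\<gamma>2 n) = Suc B + Suc B"
    using k m(2)[of k] d1 by (simp add: n_def)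
  then show False using B[of n] by simp
qed

lemma geodesic_exists:
  "\<exists>g. g 0 = y \<and> g (tdist y v) = v \<and> (\<forall>i < tdist y v. adj (g i) (g (Suc i))) \<and> (\<forall>i
      \<le> tdist y v. tdist y (g i) = i)"
proof (induction n \<equiv> "tdist y v" arbitrary: v)
  case 0
  then have "v = y" by (metis tdist_eq_0_iff)
  then show ?case by (intro exI[of _ "\<lambda>_. y"]) simp
next
  case (Suc n)
  note n1 = Suc(2)[symmetric]
  then have "v \<noteq> y" by auto
  then obtain w where w: "adj v w" "tdist y v = Suc (tdist y w)" using exists_closer_nbr by blast
  with n1 have n: "tdist y w = n" by simp
  then obtain g where g: "g 0 = y" "g n = w" "\<And>i. i < n \<Longrightarrow> adj (g i) (g (Suc i))"
     "\<And>i. i \<le> n \<Longrightarrow> tdist y (g i) = i"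
    using Suc(1)[OF n[symmetric]] unfolding n by blast
  show ?case unfolding n1
  proof (intro exI[of _ "\<lambda>i. if i = Suc n then v else g i"] conjI allI impI)
    fix i assume "i < Suc n"
    then consider "i < n" | "i = n" by linarith
    then show "adj (if i = Suc n then v else g i) (if Suc i = Suc n then v else g (Suc i))"
      by cases (use g w adj_sym in simp_all)
  next
    fix i assume "i \<le> Suc n"
    then consider "i \<le> n" | "i = Suc n" by linarith
    then show "tdist y (if i = Suc n then v else g i) = i"
      by cases (use g n1 in simp_all)
  qed (use g in simp_all)
qed

text \<open>
  The ray is followed from its point \<open>\<gamma> k\<close> closest to \<open>y\<close>, where it starts to move away from \<open>y\<close>,
  and a geodesic from \<open>y\<close> to that point is put in front. The result is a shift of \<open>\<gamma>\<close> from some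
  time on, hence it stays at a constant distance from \<open>\<gamma>\<close>.
\<close>

lemma ray_from_root_exists:
  assumes "\<gamma> \<in> rays"
  obtains \<gamma>' where "\<gamma>' \<in> rays" "\<gamma>' 0 = y" "(\<gamma>, \<gamma>') \<in> same_end"
proof -
  define k where "k = arg_min (\<lambda>n. tdist y (\<gamma> n)) (\<lambda>_. True)"
  have kmin: "tdist y (\<gamma> k) \<le> tdist y (\<gamma> n)" for n
    unfolding k_def by (rule arg_min_nat_le) simp
  have adjk: "adj (\<gamma> k) (\<gamma> (Suc k))" using assms by (auto simp: rays_def)
  have "tdist y (\<gamma> (Suc k)) = Suc (tdist y (\<gamma> k))"
    by (rule tdist_adj_cases[OF adjk, of y]) (use kmin[of "Suc k"] in auto)
  note lin = tdist_ray_linear[OF assms this]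
  define L where "L = tdist y (\<gamma> k)"
  obtain g where g: "g 0 = y" "g L = \<gamma> k" "\<And>i. i < L \<Longrightarrow> adj (g i) (g (Suc i))"
     "\<And>i. i \<le> L \<Longrightarrow> tdist y (g i) = i"
    unfolding L_def using geodesic_exists[of y "\<gamma> k"] by auto
  define \<gamma>' where "\<gamma>' = (\<lambda>n. if n < L then g n else \<gamma> (k + (n - L)))"
  have lev: "tdist y (\<gamma>' n) = n" for n
    using lin[of "n - L"] g(4)[of n] by (auto simp: \<gamma>'_def L_def)
  have "adj (\<gamma>' n) (\<gamma>' (Suc n))" for n
  proof (cases "n < L")
    case True
    then have "\<gamma>' (Suc n) = g (Suc n)" using g(2) by (cases "Suc n = L") (auto simp: \<gamma>'_def)
    then show ?thesis using True g(3)[of n] by (simp add: \<gamma>'_def)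
  next
    case False
    then show ?thesis using assms by (simp add: \<gamma>'_def rays_def Suc_diff_le)
  qed
  moreover have "\<gamma>' (Suc (Suc n)) \<noteq> \<gamma>' n" for n
    using lev[of n] lev[of "Suc (Suc n)"] by auto
  ultimately have ray: "\<gamma>' \<in> rays" by (auto simp: rays_def)
  have "\<forall>n \<ge> k + L. real (tdist (\<gamma> n) (\<gamma>' n)) = \<bar>real L - real k\<bar>"
  proof (intro allI impI)
    fix n assume n: "n \<ge> k + L"
    then have e: "\<gamma>' n = \<gamma> (n + k - L)" by (simp add: \<gamma>'_def add.commute)
    show "real (tdist (\<gamma> n) (\<gamma>' n)) = \<bar>real L - real k\<bar>"
    proof (cases "k \<ge> L")
      case True
      then show ?thesis using tdist_ray[OF assms, of n "k - L"] e by simp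
    next
      case False
      then show ?thesis using tdist_ray[OF assms, of "n + k - L" "L - k"] e n by (simp add: tdist_sym)
    qed
  qed
  then have "(\<lambda>n. real (tdist (\<gamma> n) (\<gamma>' n))) \<longlonglongrightarrow> \<bar>real L - real k\<bar>"
    by (intro tendsto_eventually) (auto simp: eventually_sequentially)
  then have "(\<gamma>, \<gamma>') \<in> same_end" using assms ray by (auto simp: same_end_def)
  moreover have "\<gamma>' 0 = y" using lev[of 0] by simp
  ultimately show ?thesis using that ray by blast
qed

lemma same_end_bounded:
  assumes "(\<gamma>1, \<gamma>2) \<in> same_end"
  obtains B where "\<And>n. tdist (\<gamma>1 n) (\<gamma>2 n) \<le> B"
proof -
  obtain L where "(\<lambda>n. real (tdist (\<gamma>1 n) (\<gamma>2 n))) \<longlonglongrightarrow> L" using assms by (auto simp: same_end_def)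
  then have "Bseq (\<lambda>n. real (tdist (\<gamma>1 n) (\<gamma>2 n)))" by (meson convergentI convergent_imp_Bseq)
  then obtain K where "\<And>n. norm (real (tdist (\<gamma>1 n) (\<gamma>2 n))) \<le> K" by (auto simp: Bseq_def)
  then have "tdist (\<gamma>1 n) (\<gamma>2 n) \<le> nat \<lceil>K\<rceil>" for n by (simp add: le_nat_iff le_ceiling_iff) (smt (verit)
      real_nat_ceiling_ge of_nat_le_iff)
  then show ?thesis using that by blast
qed

lemma geod_ex1:
  assumes "\<omega> \<in> boundary" shows "\<exists>!\<gamma>. \<gamma> \<in> \<omega> \<and> \<gamma> 0 = x0"
proof -
  obtain \<gamma> where \<gamma>: "\<gamma> \<in> rays" "\<omega> = same_end `` {\<gamma>}"
    using assms by (auto simp: boundary_def quotient_def)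
  obtain \<gamma>' where g: "\<gamma>' \<in> rays" "\<gamma>' 0 = x0" "(\<gamma>, \<gamma>') \<in> same_end"
    using ray_from_root_exists[OF \<gamma>(1)] by blast
  show ?thesis
  proof (rule ex1I[of _ \<gamma>'])
    fix \<gamma>'' assume a: "\<gamma>'' \<in> \<omega> \<and> \<gamma>'' 0 = x0"
    then have e: "(\<gamma>, \<gamma>'') \<in> same_end" using \<gamma> by simp
    obtain B1 B2 where "\<And>n. tdist (\<gamma> n) (\<gamma>' n) \<le> B1" "\<And>n. tdist (\<gamma> n) (\<gamma>'' n) \<le> B2"
      using same_end_bounded[OF e] same_end_bounded[OF g(3)] by metis
    then have "tdist (\<gamma>'' n) (\<gamma>' n) \<le> B2 + B1" for n
      using tdist_triangle[of "\<gamma>'' n" "\<gamma>' n" "\<gamma> n"] tdist_sym[of "\<gamma>'' n" "\<gamma> n"]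
      by (metis add_mono order_trans)
    moreover have "\<gamma>'' \<in> rays" using e by (auto simp: same_end_def)
    ultimately show "\<gamma>'' = \<gamma>'" using ray_from_root_unique[of \<gamma>'' \<gamma>'] a g by auto
  qed (use g \<gamma> in simp)
qed

lemma geod:
  assumes "\<omega> \<in> boundary" shows "geod \<omega> \<in> rays" "geod \<omega> 0 = x0" "geod \<omega> \<in> \<omega>"
proof -
  have g: "geod \<omega> \<in> \<omega> \<and> geod \<omega> 0 = x0" unfolding geod_def by (rule theI'[OF geod_ex1[OF assms]])
  then show "geod \<omega> 0 = x0" "geod \<omega> \<in> \<omega>" by blast+
  obtain \<gamma> where "\<omega> = same_end `` {\<gamma>}"
    using assms unfolding boundary_def quotient_def by blast
  with g have "(\<gamma>, geod \<omega>) \<in> same_end" by blast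
  then show "geod \<omega> \<in> rays" unfolding same_end_def by blast
qed

text \<open>
  Ends can be prescribed by rays; the compactness argument for test functions below produces an
  end from the ray that it constructs.
\<close>

lemma geod_surj:
  assumes "\<gamma> \<in> rays" "\<gamma> 0 = x0" obtains \<omega> where "\<omega> \<in> boundary" "geod \<omega> = \<gamma>"
proof -
  have "(\<lambda>n. real (tdist (\<gamma> n) (\<gamma> n))) \<longlonglongrightarrow> 0" by simp
  then have "(\<gamma>, \<gamma>) \<in> same_end" using assms by (auto simp: same_end_def)
  then have g: "\<gamma> \<in> same_end `` {\<gamma>}" by blast
  have b: "same_end `` {\<gamma>} \<in> boundary"
    using assms unfolding boundary_def by (intro quotientI)
  have "geod (same_end `` {\<gamma>}) = \<gamma>"
    unfolding geod_def by (rule the1_equality[OF geod_ex1[OF b]]) (use g assms in blast)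
  with b show ?thesis using that by blast
qed

lemma tdist_geod: assumes "\<omega> \<in> boundary" shows "tdist x0 (geod \<omega> n) = n"
  using tdist_ray[OF geod(1)[OF assms], of 0 n] geod(2)[OF assms] by simp

lemma geod_adj: assumes "\<omega> \<in> boundary" shows "adj (geod \<omega> n) (geod \<omega> (Suc n))"
  using geod(1)[OF assms] by (simp add: rays_def)

section \<open>The Busemann function\<close>

text \<open>
  The sequence that defines the Busemann function consists of integers, is nondecreasing and
  bounded by the distance of \<open>v\<close> from the base vertex, so it is eventually equal to its limit.
  Finitely many values of the Busemann function can therefore be read off from one far away point
  of the ray.
\<close>

lemma busemann_eventually:
  assumes "\<omega> \<in> boundary"
  shows "\<forall>\<^sub>F n in sequentially. busemann \<omega> v = int n - int (tdist (geod \<omega> n) v)"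
proof -
  define a where "a = (\<lambda>n. int n - int (tdist (geod \<omega> n) v))"
  have mono: "a n \<le> a (Suc n)" for n
    using tdist_adj_le[OF geod_adj[OF assms], of v n] by (simp add: a_def tdist_sym)
  then have inc: "incseq a" by (rule incseq_SucI)
  have bdd: "a n \<le> int (tdist x0 v)" for n
    using tdist_triangle[of x0 "geod \<omega> n" v] tdist_geod[OF assms, of n]
    by (simp add: a_def tdist_sym)
  obtain N where N: "\<And>n. a n \<le> a N"
  proof -
    have fin: "finite (range a)"
      by (rule finite_subset[of _ "{a 0..int (tdist x0 v)}"])
         (use bdd inc in \<open>auto simp: incseq_def\<close>)
    then have "Max (range a) \<in> range a" by (intro Max_in) auto
    then obtain N where "Max (range a) = a N" by auto
    then have "a n \<le> a N" for n using Max_ge[OF fin, of "a n"] by simp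
    then show ?thesis using that by blast
  qed
  have ev: "a n = a N" if "n \<ge> N" for n
    using that N[of n] inc by (simp add: incseq_def antisym)
  have "a \<longlonglongrightarrow> a N" by (rule tendsto_eventually, rule eventually_sequentiallyI, rule ev)
  then have "busemann \<omega> v = a N" unfolding busemann_def a_def[symmetric] by (rule limI)
  then have "busemann \<omega> v = a n" if "n \<ge> N" for n using ev[OF that] by (rule trans[OF _ sym])
  then show ?thesis unfolding a_def by (rule eventually_sequentiallyI[of N])
qed

lemma busemann_bounds:
  assumes "\<omega> \<in> boundary" shows "\<bar>busemann \<omega> v\<bar> \<le> int (tdist x0 v)"
proof -
  obtain n where "busemann \<omega> v = int n - int (tdist (geod \<omega> n) v)"
    using busemann_eventually[OF assms] by (auto simp: eventually_sequentially)
  then show ?thesis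
    using tdist_triangle[of x0 "geod \<omega> n" v] tdist_geod[OF assms, of n]
      tdist_triangle[of "geod \<omega> n" v x0] by (simp add: tdist_sym)
qed

lemma busemann_root [simp]: "\<omega> \<in> boundary \<Longrightarrow> busemann \<omega> x0 = 0"
  using busemann_bounds[of \<omega> x0] by simp

text \<open>
  The horospherical analogue of the fact that exactly one neighbour is closer to a given vertex:
  replace the end by a far away point of its ray.
\<close>

lemma busemann_nbrs:
  assumes "\<omega> \<in> boundary"
  obtains w0 where "adj v w0" "busemann \<omega> w0 = busemann \<omega> v + 1"
    "\<And>w. adj v w \<Longrightarrow> w \<noteq> w0 \<Longrightarrow> busemann \<omega> w = busemann \<omega> v - 1"
proof -
  have "\<forall>\<^sub>F n in sequentially. \<forall>w\<in>insert v {w. adj v w}. busemann \<omega> w = int n - int (tdist (geod \<omega> n) w)"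
    using busemann_eventually[OF assms] finite_nbrs by (intro eventually_ball_finite) auto
  moreover have "\<forall>\<^sub>F n in sequentially. geod \<omega> n \<noteq> v"
    using eventually_gt_at_top[of "tdist x0 v"] by eventually_elim (use tdist_geod[OF assms] in auto)
  ultimately have "\<forall>\<^sub>F n in sequentially. (\<forall>w\<in>insert v {w. adj v w}. busemann \<omega> w
      = int n - int (tdist (geod \<omega> n) w)) \<and> geod \<omega> n \<noteq> v"
    by eventually_elim simp
  then obtain n where n: "\<And>w. w \<in> insert v {w. adj v w} \<Longrightarrow> busemann \<omega> w = int n - int (tdist (geod \<omega> n) w)"
    "geod \<omega> n \<noteq> v" by (auto simp: eventually_sequentially)
  obtain w0 where w0: "adj v w0" "tdist (geod \<omega> n) v = Suc (tdist (geod \<omega> n) w0)"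
    using exists_closer_nbr n(2) by metis
  show ?thesis
    by (rule that[of w0]) (use w0 n(1) nbr_farther[of v w0 _ "geod \<omega> n"] in auto)
qed

lemma busemann_adj_cases:
  assumes "\<omega> \<in> boundary" "adj v w"
  obtains "busemann \<omega> w = busemann \<omega> v + 1" | "busemann \<omega> w = busemann \<omega> v - 1"
  using busemann_nbrs[OF assms(1), of v] assms(2) by metis

text \<open>
  If the edge from \<open>v\<close> to \<open>v'\<close> points both away from \<open>x\<close> and towards the end \<open>\<omega>\<close>, then the
  geodesic from \<open>x\<close> to \<open>v'\<close> continues to \<open>\<omega>\<close>, and the Busemann function grows by one along each of
  its edges.
\<close>

lemma busemann_along_path:
  assumes "\<omega> \<in> boundary" "adj v v'" "tdist x v' = Suc (tdist x v)" "busemann \<omega> v' = busemann \<omega> v + 1"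
  shows "busemann \<omega> x = busemann \<omega> v' - int (tdist x v')"
  using assms(2-)
proof (induction n \<equiv> "tdist x v" arbitrary: v v')
  case (Suc n)
  have "v \<noteq> x" using Suc(2) by (metis nat.distinct(1) tdist_refl)
  then obtain z where z: "adj v z" "tdist x v = Suc (tdist x z)" using exists_closer_nbr by blast
  then have zv: "z \<noteq> v'" using Suc by auto
  obtain w0 where w0: "adj v w0" "busemann \<omega> w0 = busemann \<omega> v + 1"
    "\<And>w. adj v w \<Longrightarrow> w \<noteq> w0 \<Longrightarrow> busemann \<omega> w = busemann \<omega> v - 1"
    using busemann_nbrs[OF assms(1), of v] by blast
  have "v' = w0" using w0(3)[of v'] Suc.prems by auto
  then have bz: "busemann \<omega> z = busemann \<omega> v - 1" using w0(3)[of z] z zv by simp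
  have "n = tdist x z" using Suc.hyps(2) z(2) by linarith
  then have "busemann \<omega> x = busemann \<omega> v - int (tdist x v)"
    using Suc.hyps(1)[of z v] z bz adj_sym by simp
  then show ?case using Suc.prems by simp
next
  case 0
  then have "x = v" by (metis tdist_eq_0_iff)
  then show ?case using 0 by simp
qed

text \<open>
  Going back along the ray from \<open>geod \<omega> n\<close>, each step is the one towards the base vertex and also
  the one towards \<open>v\<close>, as long as \<open>v\<close> is not reached.
\<close>

lemma geod_passes:
  assumes "\<omega> \<in> boundary" "int n - int (tdist (geod \<omega> n) v) = int (tdist x0 v)"
  shows "\<exists>m. geod \<omega> m = v"
  using assms(2)
proof (induction k \<equiv> "tdist (geod \<omega> n) v" arbitrary: n)
  case (Suc k)
  note k = Suc(2)[symmetric]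
  have "n \<noteq> 0" using Suc.prems k by auto
  then obtain m where m: "n = Suc m" by (cases n) auto
  have ne: "geod \<omega> n \<noteq> v" using k by auto
  then obtain w where w: "adj (geod \<omega> n) w" "tdist v (geod \<omega> n) = Suc (tdist v w)" using exists_closer_nbr
      by metis
  have "tdist x0 w \<le> tdist x0 v + tdist v w" by (rule tdist_triangle)
  then have "tdist x0 w \<le> m" using Suc w m by (simp add: tdist_sym)
  then have "tdist x0 (geod \<omega> n) = Suc (tdist x0 w)"
    using tdist_adj_le[of w "geod \<omega> n" x0] w adj_sym tdist_geod[OF assms(1), of n] m by fastforce
  moreover have "tdist x0 (geod \<omega> n) = Suc (tdist x0 (geod \<omega> m))" "adj (geod \<omega> n) (geod \<omega> m)"
    using tdist_geod[OF assms(1)] geod_adj[OF assms(1)] adj_sym m by auto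
  ultimately have "w = geod \<omega> m" using closer_nbr_unique w by blast
  then show ?case using Suc.hyps(1)[of m] k Suc.prems w m by (simp add: tdist_sym)
next
  case 0
  then show ?case by (metis tdist_eq_0_iff)
qed

lemma busemann_shadow_on:
  assumes "\<omega> \<in> shadow v" shows "busemann \<omega> v = int (tdist x0 v)"
proof -
  have \<omega>: "\<omega> \<in> boundary" using assms by (simp add: shadow_def)
  obtain n where n: "geod \<omega> n = v" using assms by (auto simp: shadow_def)
  then have nd: "n = tdist x0 v" using tdist_geod[OF \<omega>] by auto
  obtain N where "\<And>m. m \<ge> N \<Longrightarrow> busemann \<omega> v = int m - int (tdist (geod \<omega> m) v)"
    using busemann_eventually[OF \<omega>] by (auto simp: eventually_sequentially)
  from this[of "n + N"] show ?thesis
    using tdist_ray[OF geod(1)[OF \<omega>], of n N] n nd by (simp add: tdist_sym)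
qed

lemma shadow_iff_busemann:
  assumes "\<omega> \<in> boundary" shows "\<omega> \<in> shadow v \<longleftrightarrow> busemann \<omega> v = int (tdist x0 v)"
proof
  assume a: "busemann \<omega> v = int (tdist x0 v)"
  obtain n where "busemann \<omega> v = int n - int (tdist (geod \<omega> n) v)"
    using busemann_eventually[OF assms] by (auto simp: eventually_sequentially)
  then show "\<omega> \<in> shadow v" using geod_passes[OF assms, of n v] a assms by (simp add: shadow_def)
qed (rule busemann_shadow_on)

lemma shadow_root: "shadow x0 = boundary"
  using shadow_iff_busemann[of _ x0] by (auto simp: shadow_def)

text \<open>
  This recursion in the distance from the base vertex describes the Busemann function by shadows
  alone. Continuity, measurability and all integrals below come from it.
\<close>

lemma busemann_parent:
  assumes "\<omega> \<in> boundary" "adj p v" "tdist x0 v = Suc (tdist x0 p)"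
  shows "busemann \<omega> v = (if \<omega> \<in> shadow v then busemann \<omega> p + 1 else busemann \<omega> p - 1)"
proof (cases "busemann \<omega> v = busemann \<omega> p + 1")
  case True
  then have "busemann \<omega> v = int (tdist x0 v)"
    using busemann_along_path[OF assms(1,2,3)] assms(1) by simp
  then show ?thesis using True shadow_iff_busemann assms by simp
next
  case False
  then have "busemann \<omega> v = busemann \<omega> p - 1" using busemann_adj_cases assms by metis
  moreover have "\<omega> \<notin> shadow v"
    using calculation busemann_shadow_on[of \<omega> v] busemann_bounds[OF assms(1), of p] assms(3) by auto
  ultimately show ?thesis by simp
qed

lemma shadow_subset_parent:
  assumes "adj p v" "tdist x0 v = Suc (tdist x0 p)" shows "shadow v \<subseteq> shadow p"
proof
  fix \<omega> assume a: "\<omega> \<in> shadow v"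
  then have \<omega>: "\<omega> \<in> boundary" by (simp add: shadow_def)
  show "\<omega> \<in> shadow p"
    using busemann_parent[OF \<omega> assms] busemann_shadow_on[OF a] shadow_iff_busemann[OF \<omega>, of p] a assms by simp
qed

end

context regular_tree begin

section \<open>Spheres and shadows\<close>

lemma finite_tdist_sphere: "finite {v. tdist y v = n}"
proof (induction n)
  case (Suc n)
  have "{v. tdist y v = Suc n} \<subseteq> (\<Union>w\<in>{w. tdist y w = n}. {v. adj w v})"
  proof
    fix v assume "v \<in> {v. tdist y v = Suc n}"
    then have v: "tdist y v = Suc n" by simp
    then have "v \<noteq> y" by auto
    then obtain w where "adj v w" "tdist y v = Suc (tdist y w)" using exists_closer_nbr by blast
    then show "v \<in> (\<Union>w\<in>{w. tdist y w = n}. {v. adj w v})" using v adj_sym by auto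
  qed
  then show ?case using Suc finite_nbrs by (meson finite_UN_I finite_subset)
qed simp

lemma countable_vertices: "countable (UNIV :: 'v set)"
proof -
  have "(UNIV :: 'v set) = (\<Union>n. {v. tdist x0 v = n})" by auto
  moreover have "countable (\<Union>n. {v. tdist x0 v = n})"
    by (rule countable_UN) (use finite_tdist_sphere countable_finite in auto)
  ultimately show ?thesis by metis
qed

lemma parent_exists:
  assumes "v \<noteq> x0" obtains p where "adj p v" "tdist x0 v = Suc (tdist x0 p)"
  using exists_closer_nbr[OF assms] adj_sym by metis

lemma shadow_iff_geod: "\<omega> \<in> shadow v \<longleftrightarrow> \<omega> \<in> boundary \<and> geod \<omega> (tdist x0 v) = v"
  using tdist_geod by (auto simp: shadow_def)

lemma in_shadow_geod: "\<omega> \<in> boundary \<Longrightarrow> \<omega> \<in> shadow (geod \<omega> n)"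
  by (auto simp: shadow_def)

lemma geod_eq_below:
  assumes "\<omega> \<in> boundary" "\<omega>' \<in> boundary" "geod \<omega> N = geod \<omega>' N" "m \<le> N"
  shows "geod \<omega> m = geod \<omega>' m"
  using assms(4,3)
proof (induction rule: inc_induct)
  case (step n)
  then have e: "geod \<omega> (Suc n) = geod \<omega>' (Suc n)" by simp
  show ?case
    by (rule closer_nbr_unique[of "geod \<omega> (Suc n)" _ _ x0])
       (use geod_adj assms(1,2) adj_sym tdist_geod e in \<open>metis\<close>)+
qed simp

lemma shadow_decreasing:
  assumes "\<omega> \<in> boundary" "m \<le> n" shows "shadow (geod \<omega> n) \<subseteq> shadow (geod \<omega> m)"
proof
  fix \<omega>' assume "\<omega>' \<in> shadow (geod \<omega> n)"
  then have "\<omega>' \<in> boundary" "geod \<omega>' n = geod \<omega> n"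
    using tdist_geod[OF assms(1), of n] by (simp_all add: shadow_iff_geod)
  then show "\<omega>' \<in> shadow (geod \<omega> m)"
    using geod_eq_below[of \<omega>' \<omega> n m] assms tdist_geod[OF assms(1), of m] by (simp add: shadow_iff_geod)
qed

section \<open>Locally constant functions on the boundary\<close>

text \<open>
  Local constancy with an explicit radius \<open>N\<close>. The radius makes it evident that such functions
  take finitely many values and are stable under pointwise operations; by compactness they are
  exactly the test functions.
\<close>

definition level_const :: "nat \<Rightarrow> ((nat \<Rightarrow> 'v) set \<Rightarrow> 'b) \<Rightarrow> bool" where
  "level_const N F \<longleftrightarrow> (\<forall>\<omega>\<in>boundary. \<forall>\<omega>'\<in>boundary. geod \<omega> N = geod \<omega>' N \<longrightarrow> F \<omega> = F \<omega>')"

lemma level_const_mono: "level_const N F \<Longrightarrow> N \<le> M \<Longrightarrow> level_const M F"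
  unfolding level_const_def using geod_eq_below by blast

lemma level_const_map: "level_const N F \<Longrightarrow> level_const N (\<lambda>\<omega>. g (F \<omega>))"
  unfolding level_const_def by metis

lemma level_const_const: "level_const N (\<lambda>\<omega>. c)"
  by (simp add: level_const_def)

lemma level_const_map2:
  assumes "level_const N F" "level_const M G" shows "level_const (max N M) (\<lambda>\<omega>. g (F \<omega>) (G \<omega>))"
proof -
  have "level_const (max N M) F" "level_const (max N M) G"
    using assms level_const_mono by (metis max.cobounded1, metis max.cobounded2)
  then show ?thesis unfolding level_const_def by metis
qed

lemma level_const_shadow: "level_const (tdist x0 v) (\<lambda>\<omega>. \<omega> \<in> shadow v)"
  by (auto simp: level_const_def shadow_iff_geod)

lemma level_const_busemann: "level_const (tdist x0 v) (\<lambda>\<omega>. busemann \<omega> v)"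
proof (induction n \<equiv> "tdist x0 v" arbitrary: v)
  case 0
  then have "v = x0" by (metis tdist_eq_0_iff)
  then show ?case by (simp add: level_const_def)
next
  case (Suc n)
  have "v \<noteq> x0" using Suc(2) by (metis nat.distinct(1) tdist_refl)
  then obtain p where p: "adj p v" "tdist x0 v = Suc (tdist x0 p)" using parent_exists by blast
  have "level_const (tdist x0 v) (\<lambda>\<omega>. busemann \<omega> p)"
    by (rule level_const_mono[OF Suc(1)[of p]]) (use Suc(2) p(2) in linarith)+
  with level_const_shadow[of v] show ?case
    unfolding level_const_def using busemann_parent[OF _ p] by metis
qed

lemma level_const_horo: "level_const (tdist x0 v) (horo \<xi> v)"
  unfolding horo_def
  by (rule level_const_map[OF level_const_busemann, where g
      = "\<lambda>k. of_real (real q powr (of_int k / 2)) * \<xi> powi k"])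

lemma level_const_Collect:
  assumes "level_const N F"
  shows "{\<omega> \<in> boundary. F \<omega> \<in> A} = (\<Union>v\<in>{v. tdist x0 v = N \<and> (\<exists>\<omega>\<in>shadow v. F \<omega> \<in> A)}. shadow v)"
    (is "_ = ?R")
proof
  show "{\<omega> \<in> boundary. F \<omega> \<in> A} \<subseteq> ?R"
  proof
    fix \<omega> assume "\<omega> \<in> {\<omega> \<in> boundary. F \<omega> \<in> A}"
    then have "\<omega> \<in> boundary" "F \<omega> \<in> A" by auto
    then show "\<omega> \<in> ?R" using in_shadow_geod[of \<omega> N] tdist_geod[of \<omega> N] by blast
  qed
  show "?R \<subseteq> {\<omega> \<in> boundary. F \<omega> \<in> A}"
  proof
    fix \<omega> assume "\<omega> \<in> ?R"
    then obtain v \<omega>' where v: "tdist x0 v = N" "\<omega>' \<in> shadow v" "F \<omega>' \<in> A" "\<omega> \<in> shadow v" by blast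
    then have "F \<omega> = F \<omega>'" using assms unfolding level_const_def shadow_iff_geod by metis
    then show "\<omega> \<in> {\<omega> \<in> boundary. F \<omega> \<in> A}" using v by (simp add: shadow_def)
  qed
qed

lemma level_const_finite_image:
  assumes "level_const N F" shows "finite (F ` boundary)"
proof -
  define c where "c = (\<lambda>v. F (SOME \<omega>. \<omega> \<in> boundary \<and> geod \<omega> N = v))"
  have "F \<omega> = c (geod \<omega> N)" if "\<omega> \<in> boundary" for \<omega>
  proof -
    have "(SOME \<omega>'. \<omega>' \<in> boundary \<and> geod \<omega>' N = geod \<omega> N) \<in> boundary \<and>
       geod (SOME \<omega>'. \<omega>' \<in> boundary \<and> geod \<omega>' N = geod \<omega> N) N = geod \<omega> N"
      by (rule someI[of _ \<omega>]) (use that in simp)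
    then show ?thesis unfolding c_def using assms that unfolding level_const_def by metis
  qed
  then have "F ` boundary \<subseteq> c ` {v. tdist x0 v = N}" using tdist_geod by fastforce
  then show ?thesis using finite_tdist_sphere by (meson finite_imageI finite_subset)
qed

lemma topspace_boundary_top: "topspace boundary_top = boundary"
proof -
  have "topspace boundary_top = (\<Union>v. shadow v)" by (simp add: boundary_top_def)
  also have "\<dots> = boundary" using shadow_root by (auto simp: shadow_def)
  finally show ?thesis .
qed

lemma openin_shadow: "openin boundary_top (shadow v)"
  unfolding boundary_top_def by (rule topology_generated_by_Basis) simp

lemma openin_level_const:
  assumes "level_const N F" shows "openin boundary_top {\<omega> \<in> boundary. F \<omega> \<in> A}"
  unfolding level_const_Collect[OF assms] by (intro openin_Union) (auto simp: openin_shadow)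

lemma openin_contains_shadow:
  assumes "openin boundary_top U" "\<omega> \<in> U" shows "\<exists>n. shadow (geod \<omega> n) \<subseteq> U"
proof -
  have "U \<subseteq> boundary" using assms(1) openin_subset topspace_boundary_top by metis
  then have \<omega>: "\<omega> \<in> boundary" using assms by auto
  have "generate_topology_on (range shadow) U"
    using assms(1) by (simp add: boundary_top_def openin_topology_generated_by_iff)
  then show ?thesis using assms(2)
  proof induction
    case (Int a b)
    then obtain n m where "shadow (geod \<omega> n) \<subseteq> a" "shadow (geod \<omega> m) \<subseteq> b" by blast
    then have "shadow (geod \<omega> (max n m)) \<subseteq> a \<inter> b"
      using shadow_decreasing[OF \<omega>, of n "max n m"] shadow_decreasing[OF \<omega>, of m "max n m"] by auto
    then show ?case ..
  next
    case (UN K)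
    then show ?case by blast
  next
    case (Basis s)
    then obtain v where "s = shadow v" "geod \<omega> (tdist x0 v) = v" using shadow_iff_geod by blast
    then show ?case by (intro exI[of _ "tdist x0 v"]) simp
  qed simp
qed

text \<open>
  One step of the compactness argument: if the function is locally constant of some level on the
  shadow of every child of \<open>v\<close>, then the maximum of these finitely many levels works on the shadow
  of \<open>v\<close>.
\<close>

lemma level_const_of_children:
  assumes "\<And>w. adj v w \<Longrightarrow> tdist x0 w = Suc (tdist x0 v) \<Longrightarrow>
     \<exists>N. \<forall>\<omega>\<in>shadow w. \<forall>\<omega>'\<in>shadow w. geod \<omega> N = geod \<omega>' N \<longrightarrow> F \<omega> = F \<omega>'"
  shows "\<exists>N. \<forall>\<omega>\<in>shadow v. \<forall>\<omega>'\<in>shadow v. geod \<omega> N = geod \<omega>' N \<longrightarrow> F \<omega> = F \<omega>'"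
proof -
  let ?C = "{w. adj v w \<and> tdist x0 w = Suc (tdist x0 v)}"
  have "finite ?C" using finite_nbrs[of v] by simp
  have "\<forall>w\<in>?C. \<exists>N. \<forall>\<omega>\<in>shadow w. \<forall>\<omega>'\<in>shadow w. geod \<omega> N = geod \<omega>' N \<longrightarrow> F \<omega> = F \<omega>'"
    using assms by blast
  from bchoice[OF this] obtain N where
    N: "\<And>w. w \<in> ?C \<Longrightarrow> \<forall>\<omega>\<in>shadow w. \<forall>\<omega>'\<in>shadow w. geod \<omega> (N w) = geod \<omega>' (N w) \<longrightarrow> F \<omega> = F \<omega>'"
    by blast
  define M where "M = Max (insert (Suc (tdist x0 v)) (N ` ?C))"
  have M: "Suc (tdist x0 v) \<le> M" "\<And>w. w \<in> ?C \<Longrightarrow> N w \<le> M"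
    unfolding M_def by (rule Max_ge; use \<open>finite ?C\<close> in simp)+
  show ?thesis
  proof (intro exI[of _ M] ballI impI)
    fix \<omega> \<omega>' assume a: "\<omega> \<in> shadow v" "\<omega>' \<in> shadow v" "geod \<omega> M = geod \<omega>' M"
    then have b: "\<omega> \<in> boundary" "\<omega>' \<in> boundary" "geod \<omega> (tdist x0 v) = v" by (auto simp: shadow_iff_geod)
    define w where "w = geod \<omega> (Suc (tdist x0 v))"
    have w: "w \<in> ?C" using geod_adj[OF b(1), of "tdist x0 v"] tdist_geod[OF b(1)] b(3) by (simp add: w_def)
    have "geod \<omega>' (Suc (tdist x0 v)) = w" using geod_eq_below[OF b(1,2) a(3) M(1)] by (simp add: w_def)
    then have "\<omega> \<in> shadow w" "\<omega>' \<in> shadow w" using b in_shadow_geod w_def by metis+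
    moreover have "geod \<omega> (N w) = geod \<omega>' (N w)" using geod_eq_below[OF b(1,2) a(3) M(2)[OF w]] .
    ultimately show "F \<omega> = F \<omega>'" using N[OF w] by blast
  qed
qed

text \<open>
  By Koenig's lemma: if no level worked, there would be a ray all of whose shadows are bad, but
  the end of this ray has a neighbourhood on which a continuous function with finitely many values
  is constant.
\<close>

lemma test_function_level_const:
  assumes "\<phi> \<in> test_functions" shows "\<exists>N. level_const N \<phi>"
proof (rule ccontr)
  assume no: "\<nexists>N. level_const N \<phi>"
  define bad where "bad = (\<lambda>v. \<not> (\<exists>N. \<forall>\<omega>\<in>shadow v. \<forall>\<omega>'\<in>shadow v. geod \<omega> N = geod \<omega>' N \<longrightarrow> \<phi> \<omega> = \<phi> \<omega>'))"
  have "bad x0" using no by (simp add: bad_def level_const_def shadow_root)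
  moreover have "\<exists>w. adj v w \<and> tdist x0 w = Suc (tdist x0 v) \<and> bad w" if "bad v" for v
    using level_const_of_children[of v \<phi>] that unfolding bad_def by blast
  ultimately obtain \<gamma> where \<gamma>: "\<gamma> 0 = x0" "\<And>n. bad (\<gamma> n)"
    "\<And>n. adj (\<gamma> n) (\<gamma> (Suc n)) \<and> tdist x0 (\<gamma> (Suc n)) = Suc (tdist x0 (\<gamma> n)) \<and> bad (\<gamma> (Suc n))"
    using dependent_nat_choice[of "\<lambda>n v. bad v \<and> (n = 0 \<longrightarrow> v = x0)"
       "\<lambda>n v w. adj v w \<and> tdist x0 w = Suc (tdist x0 v) \<and> bad w"] by (metis nat.distinct(1))
  have "tdist x0 (\<gamma> (Suc (Suc n))) \<noteq> tdist x0 (\<gamma> n)" for n using \<gamma>(3)[of n] \<gamma>(3)[of "Suc n"] by linarith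
  then have "\<gamma> (Suc (Suc n)) \<noteq> \<gamma> n" for n by metis
  then have "\<gamma> \<in> rays" using \<gamma>(3) by (simp add: rays_def)
  then obtain \<omega> where \<omega>: "\<omega> \<in> boundary" "geod \<omega> = \<gamma>" using geod_surj \<gamma>(1) by blast
  have c: "continuous_map boundary_top euclidean \<phi>" "finite (\<phi> ` boundary)"
    using assms by (auto simp: test_functions_def)
  \<comment> \<open>\<open>W\<close> is an open set that contains \<open>\<phi> \<omega>\<close> and no other value of \<open>\<phi>\<close>.\<close>
  define W where "W = - (\<phi> ` boundary - {\<phi> \<omega>})"
  have "open W" unfolding W_def using c(2) by (intro open_Compl finite_imp_closed) simp
  then have "openin boundary_top {\<omega>' \<in> topspace boundary_top. \<phi> \<omega>' \<in> W}"
    using c(1) by (simp add: continuous_map_def)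
  moreover have "\<omega> \<in> {\<omega>' \<in> topspace boundary_top. \<phi> \<omega>' \<in> W}" using \<omega> by (simp add: topspace_boundary_top W_def)
  ultimately obtain n where "shadow (\<gamma> n) \<subseteq> {\<omega>' \<in> topspace boundary_top. \<phi> \<omega>' \<in> W}"
    using openin_contains_shadow \<omega> by blast
  then have "\<phi> \<omega>' = \<phi> \<omega>" if "\<omega>' \<in> shadow (\<gamma> n)" for \<omega>'
    using that by (auto simp: W_def topspace_boundary_top)
  then have "\<not> bad (\<gamma> n)" unfolding bad_def by metis
  with \<gamma>(2) show False by blast
qed

lemma test_functionI:
  assumes "level_const N F" shows "(\<lambda>\<omega>\<in>boundary. F \<omega>) \<in> test_functions"
proof -
  have l: "level_const N (\<lambda>\<omega>\<in>boundary. F \<omega>)"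
    using assms unfolding level_const_def by (metis restrict_apply')
  have "continuous_map boundary_top euclidean (\<lambda>\<omega>\<in>boundary. F \<omega>)"
    unfolding continuous_map_def topspace_boundary_top topspace_euclidean
    by (intro conjI allI impI openin_level_const[OF l]) blast
  moreover have "finite ((\<lambda>\<omega>\<in>boundary. F \<omega>) ` boundary)" using level_const_finite_image[OF l] .
  ultimately show ?thesis by (simp add: test_functions_def)
qed

section \<open>Injectivity of the Poisson transform\<close>

abbreviation shadow_ind :: "'v \<Rightarrow> (nat \<Rightarrow> 'v) set \<Rightarrow> complex" where
  "shadow_ind v \<omega> \<equiv> (if \<omega> \<in> shadow v then 1 else 0)"

lemma level_const_shadow_ind: "level_const (tdist x0 v) (shadow_ind v)"
  using level_const_shadow by (rule level_const_map)

lemma level_const_expansion: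
  assumes "level_const N F"
  obtains c :: "'v \<Rightarrow> complex" where "\<And>\<omega>. \<omega> \<in> boundary \<Longrightarrow> F \<omega> = (\<Sum>v | tdist x0 v = N. c v * shadow_ind v \<omega>)"
proof -
  define c where "c = (\<lambda>v. F (SOME \<omega>. \<omega> \<in> shadow v))"
  have "F \<omega> = (\<Sum>v | tdist x0 v = N. c v * shadow_ind v \<omega>)" if \<omega>: "\<omega> \<in> boundary" for \<omega>
  proof -
    have "(SOME \<omega>'. \<omega>' \<in> shadow (geod \<omega> N)) \<in> shadow (geod \<omega> N)"
      by (rule someI, rule in_shadow_geod[OF \<omega>])
    then have "F \<omega> = c (geod \<omega> N)"
      using assms \<omega> tdist_geod[OF \<omega>] unfolding level_const_def c_def shadow_iff_geod by metis
    also have "\<dots> = (\<Sum>v | tdist x0 v = N. if v = geod \<omega> N then c v else 0)"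
      using finite_tdist_sphere[of x0 N] tdist_geod[OF \<omega>, of N] by simp
    also have "\<dots> = (\<Sum>v | tdist x0 v = N. c v * shadow_ind v \<omega>)"
      using \<omega> by (intro sum.cong) (auto simp: shadow_iff_geod)
    finally show ?thesis .
  qed
  then show ?thesis using that by blast
qed

lemma fin_add_measure_add:
  assumes "m \<in> fin_add_measures" "\<phi> \<in> test_functions" "\<psi> \<in> test_functions"
  shows "m (\<lambda>\<omega>\<in>boundary. \<phi> \<omega> + \<psi> \<omega>) = m \<phi> + m \<psi>"
  using assms unfolding fin_add_measures_def mem_Collect_eq by (elim conjE) (drule (1) bspec, drule (1) bspec)

lemma fin_add_measure_scale:
  assumes "m \<in> fin_add_measures" "\<phi> \<in> test_functions"
  shows "m (\<lambda>\<omega>\<in>boundary. a * \<phi> \<omega>) = a * m \<phi>"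
  using assms unfolding fin_add_measures_def mem_Collect_eq by (elim conjE allE) (drule (1) bspec)

lemma fin_add_measure_sum:
  assumes "m \<in> fin_add_measures" "finite A" "\<And>v. v \<in> A \<Longrightarrow> tdist x0 v \<le> N"
  shows "m (\<lambda>\<omega>\<in>boundary. \<Sum>v\<in>A. c v * shadow_ind v \<omega>) = (\<Sum>v\<in>A. c v * m (\<lambda>\<omega>\<in>boundary. shadow_ind v \<omega>))"
  using assms(2,3)
proof (induction)
  case empty
  have t: "(\<lambda>\<omega>\<in>boundary. 0) \<in> test_functions" by (rule test_functionI[of 0]) (rule level_const_const)
  have "m (\<lambda>\<omega>\<in>boundary. 0 * (\<lambda>\<omega>\<in>boundary. 0) \<omega>) = 0 * m (\<lambda>\<omega>\<in>boundary. 0)"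
    by (rule fin_add_measure_scale[OF assms(1) t])
  moreover have "(\<lambda>\<omega>\<in>boundary. 0 * (\<lambda>\<omega>\<in>boundary. 0) \<omega>) = (\<lambda>\<omega>\<in>boundary. 0 :: complex)"
    by (intro restrict_ext) simp
  ultimately have "m (\<lambda>\<omega>\<in>boundary. 0) = 0" by (simp only: mult_zero_left)
  then show ?case by (simp only: sum.empty)
next
  case (insert v A)
  have lA: "level_const N (\<lambda>\<omega>. \<Sum>v\<in>B. c v * shadow_ind v \<omega>)" if "finite B" "\<And>v. v \<in> B \<Longrightarrow> tdist x0 v \<le> N" for B
    unfolding level_const_def
  proof (intro ballI impI sum.cong refl)
    fix \<omega> \<omega>' w assume a: "\<omega> \<in> boundary" "\<omega>' \<in> boundary" "geod \<omega> N = geod \<omega>' N" "w \<in> B"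
    have "level_const N (shadow_ind w)" using that a level_const_mono level_const_shadow_ind by blast
    then have "shadow_ind w \<omega> = shadow_ind w \<omega>'" using a unfolding level_const_def by blast
    then show "c w * shadow_ind w \<omega> = c w * shadow_ind w \<omega>'" by simp
  qed
  let ?s = "\<lambda>\<omega>\<in>boundary. \<Sum>v\<in>A. c v * shadow_ind v \<omega>" and ?i = "\<lambda>\<omega>\<in>boundary. shadow_ind v \<omega>"
  let ?ci = "\<lambda>\<omega>\<in>boundary. c v * ?i \<omega>"
  have t: "?s \<in> test_functions" "?i \<in> test_functions"
    using insert lA[of A] level_const_shadow_ind by (auto intro!: test_functionI)
  have lci: "level_const (tdist x0 v) (\<lambda>\<omega>. c v * shadow_ind v \<omega>)"
    using level_const_map[OF level_const_shadow_ind[of v], where g = "\<lambda>z. c v * z"] .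
  have "?ci = (\<lambda>\<omega>\<in>boundary. c v * shadow_ind v \<omega>)" by (intro restrict_ext) simp
  then have tc: "?ci \<in> test_functions" using test_functionI[OF lci] by simp
  have split: "(\<lambda>\<omega>\<in>boundary. \<Sum>v\<in>insert v A. c v * shadow_ind v \<omega>) = (\<lambda>\<omega>\<in>boundary. ?ci \<omega> + ?s \<omega>)"
    using insert by (intro restrict_ext) simp
  have add: "m (\<lambda>\<omega>\<in>boundary. ?ci \<omega> + ?s \<omega>) = m ?ci + m ?s"
    by (rule fin_add_measure_add[OF assms(1) tc t(1)])
  have scale: "m ?ci = c v * m ?i" by (rule fin_add_measure_scale[OF assms(1) t(2)])
  have IH: "m ?s = (\<Sum>v\<in>A. c v * m (\<lambda>\<omega>\<in>boundary. shadow_ind v \<omega>))"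
    by (rule insert.IH) (use insert.prems in blast)
  show ?case unfolding split add unfolding scale IH by (rule sum.insert[OF insert.hyps, symmetric])
qed

text \<open>
  Test functions are linear combinations of indicator functions of shadows.
\<close>

lemma fin_add_measure_eqI:
  assumes "m \<in> fin_add_measures" "m' \<in> fin_add_measures"
    "\<And>v. m (\<lambda>\<omega>\<in>boundary. shadow_ind v \<omega>) = m' (\<lambda>\<omega>\<in>boundary. shadow_ind v \<omega>)"
  shows "m = m'"
proof (rule extensionalityI[of _ test_functions])
  show "m \<in> extensional test_functions" "m' \<in> extensional test_functions"
    using assms by (auto simp: fin_add_measures_def)
  fix \<phi> assume \<phi>: "\<phi> \<in> test_functions"
  then obtain N where N: "level_const N \<phi>" using test_function_level_const by blast
  obtain c where c: "\<And>\<omega>. \<omega> \<in> boundary \<Longrightarrow> \<phi> \<omega> = (\<Sum>v | tdist x0 v = N. c v * shadow_ind v \<omega>)"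
    using level_const_expansion[OF N] by blast
  have "\<phi> = (\<lambda>\<omega>\<in>boundary. \<Sum>v | tdist x0 v = N. c v * shadow_ind v \<omega>)"
    using \<phi> c by (intro extensionalityI[of _ boundary]) (auto simp: test_functions_def)
  then have "l \<phi> = (\<Sum>v | tdist x0 v = N. c v * l (\<lambda>\<omega>\<in>boundary. shadow_ind v \<omega>))"
    if "l \<in> fin_add_measures" for l
    using fin_add_measure_sum[OF that finite_tdist_sphere, of x0 N N c] by simp
  from this[OF assms(1)] this[OF assms(2)] show "m \<phi> = m' \<phi>" by (simp only: assms(3))
qed

abbreviation sqrt_q :: complex where
  "sqrt_q \<equiv> of_real (sqrt (real q))"

text \<open>
  With \<open>\<alpha> = \<surd>q \<xi>\<close> the function \<open>horo\<close> is an integer power of \<open>\<alpha>\<close>; this form is used for all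
  computations.
\<close>

lemma horo_powi: "horo \<xi> v \<omega> = (sqrt_q * \<xi>) powi busemann \<omega> v"
proof -
  have "real q powr (of_int k / 2) = sqrt (real q) powi k" for k
  proof -
    have "real q powr (of_int k / 2) = (real q powr (1/2)) powr of_int k" by (simp add: powr_powr)
    also have "\<dots> = sqrt (real q) powi k" using q_ge_2 by (simp add: powr_half_sqrt powr_real_of_int')
    finally show ?thesis .
  qed
  then show ?thesis by (simp add: horo_def power_int_mult_distrib)
qed

lemma horo_root: "\<omega> \<in> boundary \<Longrightarrow> horo \<xi> x0 \<omega> = 1"
  using q_ge_2 by (simp add: horo_def)

lemma sqrt_q_mult_ne:
  fixes \<xi> :: complex assumes "cmod \<xi> = 1"
  shows "sqrt_q * \<xi> \<noteq> 0"
    "sqrt_q * \<xi> - inverse (sqrt_q * \<xi>) \<noteq> 0"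
proof -
  let ?a = "sqrt_q * \<xi>"
  have n: "cmod ?a = sqrt (real q)" using assms by (simp add: norm_mult)
  show z: "?a \<noteq> 0" using q_ge_2 assms by auto
  show "?a - inverse ?a \<noteq> 0"
  proof
    assume "?a - inverse ?a = 0"
    then have "?a * ?a = 1" using z by (simp add: field_simps)
    then have "cmod ?a * cmod ?a = 1" by (metis norm_mult norm_one)
    then show False using n q_ge_2 by simp
  qed
qed

text \<open>
  Passing from the parent \<open>p\<close> to \<open>v\<close> multiplies \<open>horo\<close> by \<open>\<alpha>\<close> on the shadow of \<open>v\<close> and by \<open>\<alpha>\<^sup>-\<^sup>1\<close>
  off it, so the contributions off the shadow cancel. On the shadow the Busemann function of \<open>p\<close>
  is the distance of \<open>p\<close> from the base vertex.
\<close>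

lemma shadow_ind_horo:
  assumes "\<omega> \<in> boundary" "adj p v" "tdist x0 v = Suc (tdist x0 p)" "\<xi> \<noteq> 0"
  defines "\<alpha> \<equiv> sqrt_q * \<xi>"
  shows "horo \<xi> v \<omega> - inverse \<alpha> * horo \<xi> p \<omega> = (\<alpha> - inverse \<alpha>) * \<alpha> ^ tdist x0 p * shadow_ind v \<omega>"
proof -
  have \<alpha>: "\<alpha> \<noteq> 0" using assms q_ge_2 by auto
  show ?thesis
  proof (cases "\<omega> \<in> shadow v")
    case True
    then have "\<omega> \<in> shadow p" using shadow_subset_parent assms by blast
    then have "busemann \<omega> p = int (tdist x0 p)" by (rule busemann_shadow_on)
    then have "horo \<xi> p \<omega> = \<alpha> ^ tdist x0 p"
      by (simp only: horo_powi \<alpha>_def[symmetric] power_int_of_nat)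
    moreover have "horo \<xi> v \<omega> = \<alpha> ^ Suc (tdist x0 p)"
      by (simp only: horo_powi \<alpha>_def[symmetric] power_int_of_nat busemann_shadow_on[OF True] assms(3))
    ultimately show ?thesis using True by (simp add: algebra_simps)
  next
    case False
    then have "busemann \<omega> v = busemann \<omega> p - 1" using busemann_parent assms by simp
    then have "horo \<xi> v \<omega> = \<alpha> powi (busemann \<omega> p - 1)" "horo \<xi> p \<omega> = \<alpha> powi busemann \<omega> p"
      by (simp_all only: horo_powi \<alpha>_def[symmetric])
    then show ?thesis using False \<alpha> by (simp add: power_int_diff divide_inverse)
  qed
qed

lemma test_function_horo: "(\<lambda>\<omega>\<in>boundary. horo \<xi> v \<omega>) \<in> test_functions"
  by (rule test_functionI[OF level_const_horo])

text \<open>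
  The values of the Poisson transform at \<open>v\<close> and at its parent determine the mass of the shadow of
  \<open>v\<close>; for this, \<open>\<alpha> \<noteq> \<alpha>\<^sup>-\<^sup>1\<close> is essential, and it holds because \<open>|\<alpha>| = \<surd>q > 1\<close>.
\<close>

lemma poisson_inj:
  assumes "cmod \<xi> = 1" shows "inj_on (poisson \<xi>) fin_add_measures"
proof (rule inj_onI)
  fix m m' assume m: "m \<in> fin_add_measures" "m' \<in> fin_add_measures" and e: "poisson \<xi> m = poisson \<xi> m'"
  define \<alpha> where "\<alpha> = sqrt_q * \<xi>"
  have \<alpha>: "\<alpha> \<noteq> 0" "\<alpha> - inverse \<alpha> \<noteq> 0" using sqrt_q_mult_ne[OF assms] by (simp_all add: \<alpha>_def)
  have \<xi>: "\<xi> \<noteq> 0" using assms by auto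
  have key: "m (\<lambda>\<omega>\<in>boundary. shadow_ind v \<omega>) = 
      inverse ((\<alpha> - inverse \<alpha>) * \<alpha> ^ tdist x0 p) * (poisson \<xi> m v + (- inverse \<alpha>) * poisson \<xi> m p)"
    if m: "m \<in> fin_add_measures" and p: "adj p v" "tdist x0 v = Suc (tdist x0 p)" for m p v
  proof -
    let ?k = "inverse ((\<alpha> - inverse \<alpha>) * \<alpha> ^ tdist x0 p)"
    let ?v = "\<lambda>\<omega>\<in>boundary. horo \<xi> v \<omega>" and ?p = "\<lambda>\<omega>\<in>boundary. horo \<xi> p \<omega>"
    let ?cp = "\<lambda>\<omega>\<in>boundary. (- inverse \<alpha>) * ?p \<omega>"
    let ?d = "\<lambda>\<omega>\<in>boundary. ?v \<omega> + ?cp \<omega>"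
    have "?cp = (\<lambda>\<omega>\<in>boundary. (- inverse \<alpha>) * horo \<xi> p \<omega>)" by (intro restrict_ext) simp
    then have tc: "?cp \<in> test_functions"
      using test_functionI[OF level_const_map[OF level_const_horo[of p \<xi>], where g
          = "\<lambda>z. (- inverse \<alpha>) * z"]] by simp
    have "?d = (\<lambda>\<omega>\<in>boundary. horo \<xi> v \<omega> + (- inverse \<alpha>) * horo \<xi> p \<omega>)" by (intro restrict_ext) simp
    then have td: "?d \<in> test_functions"
      using test_functionI[OF level_const_map2[OF level_const_horo[of v \<xi>] level_const_horo[of p \<xi>],
          where g = "\<lambda>z w. z + (- inverse \<alpha>) * w"]] by simp
    have m1: "m (\<lambda>\<omega>\<in>boundary. ?k * ?d \<omega>) = ?k * m ?d"
      by (rule fin_add_measure_scale[OF m td])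
    have m2: "m ?d = m ?v + m ?cp"
      by (rule fin_add_measure_add[OF m test_function_horo tc])
    have m3: "m ?cp = (- inverse \<alpha>) * m ?p"
      by (rule fin_add_measure_scale[OF m test_function_horo])
    have "(\<lambda>\<omega>\<in>boundary. ?k * ?d \<omega>) = (\<lambda>\<omega>\<in>boundary. shadow_ind v \<omega>)"
    proof (intro restrict_ext)
      fix \<omega> assume \<omega>: "\<omega> \<in> boundary"
      have d: "?d \<omega> = (\<alpha> - inverse \<alpha>) * \<alpha> ^ tdist x0 p * shadow_ind v \<omega>"
        using shadow_ind_horo[OF \<omega> p \<xi>] \<omega> unfolding \<alpha>_def[symmetric] by simp
      have "inverse K * (K * s) = s" if "K \<noteq> 0" for K s :: complex using that by simp
      moreover have "(\<alpha> - inverse \<alpha>) * \<alpha> ^ tdist x0 p \<noteq> 0" using \<alpha> by simp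
      ultimately show "?k * ?d \<omega> = shadow_ind v \<omega>" unfolding d by blast
    qed
    from m1[unfolded this m2 m3] show ?thesis by (simp only: poisson_def)
  qed
  show "m = m'"
  proof (rule fin_add_measure_eqI[OF m])
    fix v
    show "m (\<lambda>\<omega>\<in>boundary. shadow_ind v \<omega>) = m' (\<lambda>\<omega>\<in>boundary. shadow_ind v \<omega>)"
    proof (cases "v = x0")
      case True
      have "(\<lambda>\<omega>\<in>boundary. shadow_ind x0 \<omega>) = (\<lambda>\<omega>\<in>boundary. horo \<xi> x0 \<omega>)"
        by (intro restrict_ext) (simp add: shadow_root horo_root)
      then show ?thesis using True fun_cong[OF e, of x0] by (simp only: poisson_def)
    next
      case False
      then obtain p where "adj p v" "tdist x0 v = Suc (tdist x0 p)" using parent_exists by blast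
      from key[OF m(1) this] key[OF m(2) this] show ?thesis using e by simp
    qed
  qed
qed

end

context regular_tree_measure begin

section \<open>Integration over the boundary\<close>

lemma finite_measure_nu: "finite_measure \<nu>"
  by (rule finite_measureI) (simp add: prob_nu)

lemma measure_nu_space: "measure \<nu> (space \<nu>) = 1"
  using prob_nu by (simp add: measure_def)

lemma sets_openin: "openin boundary_top U \<Longrightarrow> U \<in> sets \<nu>"
  by (simp add: sets_nu)

lemma sets_shadow [measurable]: "shadow v \<in> sets \<nu>"
  by (rule sets_openin[OF openin_shadow])

lemma measurable_level_const:
  assumes "level_const N F" "\<And>\<omega>. F \<omega> \<in> space M"
  shows "F \<in> measurable \<nu> M"
proof (rule measurableI)
  fix A assume "A \<in> sets M"
  have "F -` A \<inter> space \<nu> = {\<omega> \<in> boundary. F \<omega> \<in> A}" by (auto simp: space_nu)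
  then show "F -` A \<inter> space \<nu> \<in> sets \<nu>" using sets_openin[OF openin_level_const[OF assms(1)]] by metis
qed (use assms in simp)

lemma integrable_level_const:
  fixes F :: "_ \<Rightarrow> complex"
  assumes "level_const N F" shows "integrable \<nu> F"
proof -
  have "finite (F ` boundary)" by (rule level_const_finite_image[OF assms])
  then obtain B where "\<And>\<omega>. \<omega> \<in> boundary \<Longrightarrow> cmod (F \<omega>) \<le> B"
    using finite_imp_bounded[of "F ` boundary"] unfolding bounded_iff by blast
  then have "AE \<omega> in \<nu>. norm (F \<omega>) \<le> B" by (intro AE_I2) (simp add: space_nu)
  then show ?thesis
    using finite_measure.integrable_const_bound[OF finite_measure_nu] measurable_level_const[OF assms, of
        borel] by simp
qed

lemma measure_shadow_child:
  assumes "tdist x0 v = Suc (tdist x0 p)"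
  shows "measure \<nu> (shadow v) = 1 / ((real q + 1) * real q ^ tdist x0 p)"
proof -
  have "v \<noteq> x0" using assms by auto
  from nu_shadow[OF this] assms show ?thesis by simp
qed

lemma integral_shadow_ind: "(\<integral>\<omega>. c * shadow_ind v \<omega> \<partial>\<nu>) = c * of_real (measure \<nu> (shadow v))"
proof -
  have "(\<lambda>\<omega>. c * shadow_ind v \<omega>) = (\<lambda>\<omega>. c * of_real (indicator (shadow v) \<omega>))"
    by (auto simp: indicator_def)
  then have "(\<integral>\<omega>. c * shadow_ind v \<omega> \<partial>\<nu>) = c * of_real (\<integral>\<omega>. indicator (shadow v) \<omega> \<partial>\<nu>)"
    by (simp del: of_real_indicator)
  also have "\<dots> = c * of_real (measure \<nu> (shadow v))"
    using sets.sets_into_space[OF sets_shadow[of v]] by (simp add: Int_absorb2)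
  finally show ?thesis .
qed

lemma integrable_shadow_ind: "integrable \<nu> (\<lambda>\<omega>. c * shadow_ind v \<omega>)"
  by (rule integrable_level_const[OF level_const_map[OF level_const_shadow_ind, where g = "\<lambda>z. c * z"]])

lemma integral_boundary_cong:
  "(\<And>\<omega>. \<omega> \<in> boundary \<Longrightarrow> F \<omega> = G \<omega>) \<Longrightarrow> (\<integral>\<omega>. F \<omega> \<partial>\<nu>) = (\<integral>\<omega>. G \<omega> \<partial>\<nu>)" for G :: "_ \<Rightarrow> complex"
  by (intro Bochner_Integration.integral_cong) (simp_all add: space_nu)

lemma q_ne_complex: "(of_nat q :: complex) \<noteq> 0" "(of_nat q + 1 :: complex) \<noteq> 0"
proof -
  show "(of_nat q :: complex) \<noteq> 0" using q_ge_2 by simp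
  have "(of_nat (Suc q) :: complex) \<noteq> 0" by (rule of_nat_neq_0)
  then show "(of_nat q + 1 :: complex) \<noteq> 0" by (simp add: add.commute)
qed

text \<open>
  The density with respect to \<open>\<nu>\<close> of the harmonic measure seen from \<open>v\<close>.
\<close>

abbreviation qh :: "'v \<Rightarrow> (nat \<Rightarrow> 'v) set \<Rightarrow> complex" where
  "qh v \<omega> \<equiv> of_nat q powi busemann \<omega> v"

lemma integrable_qh: "integrable \<nu> (\<lambda>\<omega>. c * qh v \<omega>)"
  by (rule integrable_level_const[OF level_const_map[OF level_const_busemann, where g
      = "\<lambda>k. c * of_nat q powi k"]])

lemma integral_qh_shadow:
  "(\<integral>\<omega>. qh b \<omega> * shadow_ind v \<omega> \<partial>\<nu>) = of_nat q powi (int (tdist x0 v) + s) * of_real (measure \<nu> (shadow v))"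
  if "\<And>\<omega>. \<omega> \<in> shadow v \<Longrightarrow> busemann \<omega> b = busemann \<omega> v + s"
proof -
  have "(\<integral>\<omega>. qh b \<omega> * shadow_ind v \<omega> \<partial>\<nu>) = (\<integral>\<omega>. of_nat q powi (int (tdist x0 v) + s) * shadow_ind v \<omega> \<partial>\<nu>)"
    by (rule integral_boundary_cong) (use that busemann_shadow_on in auto)
  then show ?thesis by (simp only: integral_shadow_ind)
qed

text \<open>
  The harmonic measure stays a probability measure when one passes from the parent to \<open>v\<close>: its
  density is divided by \<open>q\<close> off the shadow of \<open>v\<close> and multiplied by \<open>q\<close> on it, and the two changes
  of mass cancel.
\<close>

lemma integral_qh: "(\<integral>\<omega>. qh v \<omega> \<partial>\<nu>) = 1"
proof (induction n \<equiv> "tdist x0 v" arbitrary: v)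
  case 0
  then have v: "v = x0" by (metis tdist_eq_0_iff)
  have "(\<integral>\<omega>. qh v \<omega> \<partial>\<nu>) = (\<integral>\<omega>. 1 \<partial>\<nu>)" by (rule integral_boundary_cong) (simp add: v)
  then show ?case by (simp add: measure_nu_space)
next
  case (Suc n)
  have "v \<noteq> x0" using Suc(2) by (metis nat.distinct(1) tdist_refl)
  then obtain p where p: "adj p v" "tdist x0 v = Suc (tdist x0 p)" using parent_exists by blast
  have IH: "(\<integral>\<omega>. qh p \<omega> \<partial>\<nu>) = 1" by (rule Suc(1)) (use Suc(2) p(2) in linarith)
  let ?Q = "of_nat q :: complex"
  \<comment> \<open>Off the shadow of \<open>v\<close> the density of \<open>v\<close> is that of \<open>p\<close> divided by \<open>q\<close>; the constant \<open>?c\<close> corrects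
      the value on the shadow.\<close>
  let ?c = "?Q ^ tdist x0 p * (?Q - inverse ?Q)"
  have "(\<integral>\<omega>. qh v \<omega> \<partial>\<nu>) = (\<integral>\<omega>. inverse ?Q * qh p \<omega> + ?c * shadow_ind v \<omega> \<partial>\<nu>)"
  proof (rule integral_boundary_cong)
    fix \<omega> assume \<omega>: "\<omega> \<in> boundary"
    show "qh v \<omega> = inverse ?Q * qh p \<omega> + ?c * shadow_ind v \<omega>"
    proof (cases "\<omega> \<in> shadow v")
      case True
      then have "\<omega> \<in> shadow p" using shadow_subset_parent p by blast
      then have "qh p \<omega> = ?Q ^ tdist x0 p"
        by (simp only: busemann_shadow_on power_int_of_nat)
      moreover have "qh v \<omega> = ?Q ^ Suc (tdist x0 p)"
        by (simp only: busemann_shadow_on[OF True] power_int_of_nat p(2))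
      ultimately show ?thesis using True by (simp add: algebra_simps)
    next
      case False
      then have "busemann \<omega> v = busemann \<omega> p - 1" using busemann_parent[OF \<omega> p] by simp
      then show ?thesis using False q_ne_complex by (simp add: power_int_diff divide_inverse)
    qed
  qed
  also have "\<dots> = (\<integral>\<omega>. inverse ?Q * qh p \<omega> \<partial>\<nu>) + (\<integral>\<omega>. ?c * shadow_ind v \<omega> \<partial>\<nu>)"
    by (rule Bochner_Integration.integral_add[OF integrable_qh integrable_shadow_ind])
  also have "(\<integral>\<omega>. inverse ?Q * qh p \<omega> \<partial>\<nu>) = inverse ?Q" using IH by simp
  also have "(\<integral>\<omega>. ?c * shadow_ind v \<omega> \<partial>\<nu>) = ?c * (1 / ((?Q + 1) * ?Q ^ tdist x0 p))"
    unfolding integral_shadow_ind measure_shadow_child[OF p(2)] by simp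
  also have "inverse ?Q + ?c * (1 / ((?Q + 1) * ?Q ^ tdist x0 p)) = 1"
    using q_ne_complex by (simp add: divide_simps) (simp add: algebra_simps)
  finally show ?case .
qed

text \<open>
  Seen from \<open>b\<close>, the ends that are not behind its neighbour \<open>a\<close> have measure \<open>q/(q + 1)\<close>, whatever
  the position of the base vertex. If \<open>a\<close> is the parent of \<open>b\<close>, they form the shadow of \<open>b\<close>,
  otherwise the complement of the shadow of \<open>a\<close>.
\<close>

lemma integral_qh_towards:
  assumes "adj a b"
  shows "(\<integral>\<omega>. (if busemann \<omega> b = busemann \<omega> a + 1 then qh b \<omega> else 0) \<partial>\<nu>) = of_nat q / (of_nat q + 1)"
proof (rule tdist_adj_cases[OF assms, of x0])
  let ?Q = "of_nat q :: complex"
  assume t: "tdist x0 b = Suc (tdist x0 a)"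
  have "(\<integral>\<omega>. (if busemann \<omega> b = busemann \<omega> a + 1 then qh b \<omega> else 0) \<partial>\<nu>) = (\<integral>\<omega>. qh b \<omega> * shadow_ind b \<omega> \<partial>\<nu>)"
    by (rule integral_boundary_cong) (simp add: busemann_parent[OF _ assms t])
  also have "\<dots> = ?Q powi (int (tdist x0 b) + 0) * of_real (measure \<nu> (shadow b))"
    by (rule integral_qh_shadow) simp
  also have "\<dots> = ?Q ^ Suc (tdist x0 a) * (1 / ((?Q + 1) * ?Q ^ tdist x0 a))"
    unfolding measure_shadow_child[OF t] add_0_right power_int_of_nat t by simp
  also have "\<dots> = ?Q / (?Q + 1)" using q_ne_complex by simp
  finally show ?thesis .
next
  let ?Q = "of_nat q :: complex"
  assume t: "tdist x0 a = Suc (tdist x0 b)"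
  have ba: "adj b a" using assms adj_sym by blast
  note bp = busemann_parent[OF _ ba t]
  have i: "integrable \<nu> (\<lambda>\<omega>. qh b \<omega> * shadow_ind a \<omega>)"
    by (rule integrable_level_const[OF level_const_map2[OF level_const_map[OF level_const_busemann]
        level_const_shadow_ind]])
  have "(\<integral>\<omega>. (if busemann \<omega> b = busemann \<omega> a + 1 then qh b \<omega> else 0) \<partial>\<nu>)
      = (\<integral>\<omega>. qh b \<omega> - qh b \<omega> * shadow_ind a \<omega> \<partial>\<nu>)"
    by (rule integral_boundary_cong) (use bp in auto)
  also have "\<dots> = (\<integral>\<omega>. qh b \<omega> \<partial>\<nu>) - (\<integral>\<omega>. qh b \<omega> * shadow_ind a \<omega> \<partial>\<nu>)"
    using integrable_qh[of 1 b] i by (intro Bochner_Integration.integral_diff) simp_all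
  also have "(\<integral>\<omega>. qh b \<omega> * shadow_ind a \<omega> \<partial>\<nu>) = ?Q powi (int (tdist x0 a) + (-1)) * of_real (measure \<nu>
      (shadow a))"
    by (rule integral_qh_shadow) (use bp in \<open>auto simp: shadow_def\<close>)
  also have "int (tdist x0 a) + (-1) = int (tdist x0 b)" using t by simp
  also have "?Q powi (int (tdist x0 b)) * of_real (measure \<nu> (shadow a))
      = ?Q ^ tdist x0 b * (1 / ((?Q + 1) * ?Q ^ tdist x0 b))"
    unfolding measure_shadow_child[OF t] power_int_of_nat by simp
  also have "\<dots> = 1 / (?Q + 1)" using q_ne_complex by simp
  also have "(\<integral>\<omega>. qh b \<omega> \<partial>\<nu>) - 1 / (?Q + 1) = ?Q / (?Q + 1)"
    using q_ne_complex by (simp add: integral_qh divide_simps)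
  finally show ?thesis .
qed

section \<open>The spherical functions\<close>

text \<open>
  The integral kernel of the Poisson transform applied to the Helgason transform of \<open>\<delta>\<^sub>x\<close> at
  \<open>\<xi>\<^sup>-\<^sup>1\<close>.
\<close>

definition spherical :: "complex \<Rightarrow> 'v \<Rightarrow> 'v \<Rightarrow> complex" where
  "spherical \<xi> x v = (\<integral>\<omega>. horo (inverse \<xi>) x \<omega> * horo \<xi> v \<omega> \<partial>\<nu>)"

lemma sqrt_q_mult_self: "sqrt_q * sqrt_q = (of_nat q :: complex)"
  by (simp flip: of_real_mult)

lemma sqrt_q_inverse_mult:
  assumes "\<xi> \<noteq> 0"
  shows "(sqrt_q * inverse \<xi>) * (sqrt_q * \<xi>) = (of_nat q :: complex)"
proof -
  have "(sqrt_q * inverse \<xi>) * (sqrt_q * \<xi>)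
      = (sqrt_q * sqrt_q) * (inverse \<xi> * \<xi>)" by (simp only: ac_simps)
  then show ?thesis using assms sqrt_q_mult_self by simp
qed

lemma horo_inverse_mult:
  assumes "\<xi> \<noteq> 0" shows "horo (inverse \<xi>) x \<omega> * horo \<xi> x \<omega> = qh x \<omega>"
proof -
  have "(sqrt_q * inverse \<xi>) * (sqrt_q * \<xi>) = of_nat q"
    using assms by (rule sqrt_q_inverse_mult)
  then show ?thesis unfolding horo_powi power_int_mult_distrib[symmetric] by simp
qed

lemma integrable_horo2: "integrable \<nu> (\<lambda>\<omega>. horo \<eta> x \<omega> * horo \<xi> v \<omega>)"
  by (rule integrable_level_const[OF level_const_map2[OF level_const_horo level_const_horo]])

lemma spherical_refl: "\<xi> \<noteq> 0 \<Longrightarrow> spherical \<xi> x x = 1"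
  unfolding spherical_def by (simp add: horo_inverse_mult integral_qh)

text \<open>
  Let \<open>w\<close> be farther from \<open>x\<close> than its neighbour \<open>v\<close>. For the ends that are not behind \<open>w\<close> the
  passage from \<open>v\<close> to \<open>w\<close> divides the integrand by \<open>\<alpha>\<close>. For the ends behind \<open>w\<close> it multiplies by
  \<open>\<alpha>\<close>, but for these the geodesic from \<open>x\<close> to \<open>w\<close> continues to the end, and the integrand is an
  explicit multiple of the harmonic density of \<open>w\<close>.
\<close>

lemma spherical_step:
  assumes "\<xi> \<noteq> 0" "adj v w" "tdist x w = Suc (tdist x v)"
  defines "\<alpha> \<equiv> sqrt_q * \<xi>" and "\<beta> \<equiv> sqrt_q * inverse \<xi>"
  shows "spherical \<xi> x w = spherical \<xi> x v / \<alpha> + (\<alpha> - inverse \<alpha>) / (\<beta> ^ tdist x v * (of_nat q + 1))"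
proof -
  let ?Q = "of_nat q :: complex"
  let ?E = "\<lambda>\<omega>. busemann \<omega> w = busemann \<omega> v + 1"
  let ?c = "(\<alpha> - inverse \<alpha>) / (?Q * \<beta> ^ tdist x v)"
  have ne: "\<alpha> \<noteq> 0" "\<beta> \<noteq> 0" using assms(1) q_ge_2 by (auto simp: \<alpha>_def \<beta>_def)
  have ab: "\<beta> * \<alpha> = ?Q" unfolding \<alpha>_def \<beta>_def by (rule sqrt_q_inverse_mult[OF assms(1)])
  have "spherical \<xi> x w = (\<integral>\<omega>. inverse \<alpha> * (horo (inverse \<xi>) x \<omega> * horo \<xi> v \<omega>) + ?c * (if ?E \<omega> then qh w \<omega>
      else 0) \<partial>\<nu>)"
    unfolding spherical_def
  proof (rule integral_boundary_cong)
    fix \<omega> assume \<omega>: "\<omega> \<in> boundary"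
    have hv: "horo \<xi> v \<omega> = \<alpha> powi busemann \<omega> v" and hw: "horo \<xi> w \<omega> = \<alpha> powi busemann \<omega> w"
      and hx: "horo (inverse \<xi>) x \<omega> = \<beta> powi busemann \<omega> x"
      by (simp_all only: horo_powi \<alpha>_def \<beta>_def)
    show "horo (inverse \<xi>) x \<omega> * horo \<xi> w \<omega> =
      inverse \<alpha> * (horo (inverse \<xi>) x \<omega> * horo \<xi> v \<omega>) + ?c * (if ?E \<omega> then qh w \<omega> else 0)"
    proof (cases "?E \<omega>")
      case True
      have bx: "busemann \<omega> x = busemann \<omega> v - int (tdist x v)"
        using busemann_along_path[OF \<omega> assms(2,3) True] True assms(3) by simp
      have hx': "horo (inverse \<xi>) x \<omega> = \<beta> powi busemann \<omega> v / \<beta> ^ tdist x v"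
        unfolding hx bx using ne by (simp add: power_int_diff power_int_of_nat)
      have hw': "horo \<xi> w \<omega> = \<alpha> * horo \<xi> v \<omega>"
        unfolding hw True hv using ne by (simp add: power_int_add)
      have qw: "qh w \<omega> = ?Q * (\<beta> powi busemann \<omega> v * \<alpha> powi busemann \<omega> v)"
        unfolding True power_int_mult_distrib[symmetric] ab using q_ne_complex by (simp add: power_int_add)
      have Qn: "?Q \<noteq> 0" using q_ne_complex by simp
      have "?c * qh w \<omega> = (\<alpha> - inverse \<alpha>) * (horo (inverse \<xi>) x \<omega> * horo \<xi> v \<omega>)"
        unfolding qw hx' hv using Qn by (simp add: divide_simps)
      then show ?thesis using True hw' by (simp add: algebra_simps)
    next
      case False
      then have b: "busemann \<omega> w = busemann \<omega> v - 1" using busemann_adj_cases[OF \<omega> assms(2)] by blast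
      have "horo \<xi> w \<omega> = inverse \<alpha> * horo \<xi> v \<omega>"
        unfolding hw b hv using ne by (simp add: power_int_diff divide_inverse)
      then show ?thesis using False by simp
    qed
  qed
  also have "\<dots> = inverse \<alpha> * spherical \<xi> x v + ?c * (?Q / (?Q + 1))"
  proof -
    have i2: "integrable \<nu> (\<lambda>\<omega>. if ?E \<omega> then qh w \<omega> else 0)"
      by (rule integrable_level_const[OF level_const_map2[OF level_const_busemann[of w]
          level_const_busemann[of v],
          where g = "\<lambda>i j. if i = j + 1 then ?Q powi i else 0"]])
    show ?thesis unfolding spherical_def integral_qh_towards[OF assms(2), symmetric]
      using integrable_horo2 i2 by (subst Bochner_Integration.integral_add) simp_all
  qed
  also have "?c * (?Q / (?Q + 1)) = (\<alpha> - inverse \<alpha>) / (\<beta> ^ tdist x v * (?Q + 1))"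
    using q_ne_complex ne by simp
  finally show ?thesis by (simp add: divide_inverse mult.commute)
qed

text \<open>
  The Poisson preimage of the Fourier series of the solution with initial data \<open>(0, \<delta>\<^sub>x)\<close> is
  \<open>kappa\<close> times \<open>horo \<xi>\<^sup>-\<^sup>1 x\<close>.
\<close>

definition kappa :: "complex \<Rightarrow> complex" where
  "kappa \<xi> = (1 + inverse (of_nat q)) * (\<xi> - inverse \<xi>) /
     ((\<xi> - inverse (of_nat q) * inverse \<xi>) * (inverse \<xi> - inverse (of_nat q) * \<xi>))"

text \<open>
  The Fourier series, at distance \<open>d\<close> from \<open>x\<close>, of the solution with initial data \<open>(0, \<delta>\<^sub>x)\<close>.
\<close>

definition wave_symbol :: "nat \<Rightarrow> complex \<Rightarrow> complex" where
  "wave_symbol d \<xi> = (\<xi> ^ Suc d / (1 - \<xi>\<^sup>2 / of_nat q) - inverse \<xi> ^ Suc d / (1 - (inverse \<xi>)\<^sup>2 / of_nat q))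
     / sqrt_q ^ d"

lemma one_minus_square_ne: "cmod \<xi> = 1 \<Longrightarrow> 1 - \<xi>\<^sup>2 / of_nat q \<noteq> 0"
proof
  assume "cmod \<xi> = 1" "1 - \<xi>\<^sup>2 / of_nat q = 0"
  then have "cmod (\<xi>\<^sup>2 / of_nat q) = 1" by simp
  then show False using \<open>cmod \<xi> = 1\<close> q_ge_2 by (simp add: norm_divide norm_power)
qed

text \<open>
  Both sides satisfy the recurrence of \<open>spherical_step\<close> in the distance. With the abbreviations
  \<open>A\<close> and \<open>B\<close> of the proof for the two denominators of \<open>wave_symbol\<close>, the denominator of \<open>kappa\<close>
  is \<open>A B\<close>.
\<close>

lemma kappa_spherical:
  assumes "cmod \<xi> = 1"
  shows "kappa \<xi> * spherical \<xi> x v = wave_symbol (tdist x v) \<xi>"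
proof -
  let ?Q = "of_nat q :: complex" and ?s = "sqrt_q"
  define A where "A = 1 - \<xi>\<^sup>2 / ?Q"
  define B where "B = 1 - (inverse \<xi>)\<^sup>2 / ?Q"
  have \<xi>: "\<xi> \<noteq> 0" using assms by auto
  have ci: "cmod (inverse \<xi>) = 1" using assms by (simp add: norm_inverse)
  have Q: "?Q \<noteq> 0" "?Q + 1 \<noteq> 0" using q_ne_complex by auto
  have s: "?s \<noteq> 0" "?s * ?s = ?Q" using q_ge_2 by (auto simp flip: of_real_mult)
  have AB: "A \<noteq> 0" "B \<noteq> 0" using one_minus_square_ne assms ci unfolding A_def B_def by blast+
  have f1: "\<xi> - inverse ?Q * inverse \<xi> = \<xi> * B" "inverse \<xi> - inverse ?Q * \<xi> = inverse \<xi> * A"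
    using \<xi> by (simp_all add: A_def B_def field_simps power2_eq_square)
  have kap: "kappa \<xi> = (1 + inverse ?Q) * (\<xi> - inverse \<xi>) / (A * B)"
    unfolding kappa_def f1 using \<xi> by simp
  have ws: "wave_symbol d \<xi> = (\<xi> ^ Suc d / A - inverse \<xi> ^ Suc d / B) / ?s ^ d" for d
    by (simp only: wave_symbol_def A_def B_def)
  show ?thesis
  proof (induction d \<equiv> "tdist x v" arbitrary: v)
    case 0
    then have v: "v = x" by (metis tdist_eq_0_iff)
    have "(1 + inverse ?Q) * (\<xi> - inverse \<xi>) / (A * B) = \<xi> / A - inverse \<xi> / B"
    proof -
      have "\<xi> * B - inverse \<xi> * A = (1 + inverse ?Q) * (\<xi> - inverse \<xi>)"
        using \<xi> Q by (simp add: A_def B_def field_simps power2_eq_square)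
      then show ?thesis using AB by (simp add: diff_divide_distrib flip: \<open>\<xi> * B - inverse \<xi> * A = _\<close>)
    qed
    then show ?case using spherical_refl[OF \<xi>, of x] v by (simp add: kap ws)
  next
    case (Suc d)
    have "v \<noteq> x" using Suc(2) by (metis nat.distinct(1) tdist_refl)
    then obtain p where p: "adj v p" "tdist x v = Suc (tdist x p)" using exists_closer_nbr by blast
    have d: "tdist x p = d" using Suc(2) p(2) by linarith
    have IH: "kappa \<xi> * spherical \<xi> x p = wave_symbol d \<xi>" using Suc(1)[OF d[symmetric]] d by simp
    have pv: "adj p v" using p adj_sym by blast
    let ?\<alpha> = "?s * \<xi>" and ?\<beta> = "?s * inverse \<xi>"
    have "kappa \<xi> * spherical \<xi> x v = kappa \<xi> * spherical \<xi> x p / ?\<alpha> + kappa \<xi> * ((?\<alpha> - inverse ?\<alpha>) / (?\<beta>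
        ^ d * (?Q + 1)))"
      unfolding spherical_step[OF \<xi> pv p(2)] d by (simp add: algebra_simps)
    also have "\<dots> = wave_symbol d \<xi> / ?\<alpha> + kappa \<xi> * ((?\<alpha> - inverse ?\<alpha>) / (?\<beta> ^ d * (?Q + 1)))"
      unfolding IH ..
    also have "?\<alpha> - inverse ?\<alpha> = ?s * \<xi> * B"
    proof -
      have "inverse ?\<alpha> = ?s * \<xi> * ((inverse \<xi>)\<^sup>2 / ?Q)" using \<xi> s Q
        by (simp add: field_simps power2_eq_square)
      then show ?thesis by (simp add: B_def algebra_simps)
    qed
    also have "kappa \<xi> * (?s * \<xi> * B / (?\<beta> ^ d * (?Q + 1))) = (\<xi>\<^sup>2 - 1) * \<xi> ^ d / (A * ?s ^ Suc d)"
    proof -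
      have "kappa \<xi> * (?s * \<xi> * B / (?\<beta> ^ d * (?Q + 1)))
          = ((1 + inverse ?Q) / (?Q + 1) * ?s) * (\<xi> * (\<xi> - inverse \<xi>)) / (A * ?\<beta> ^ d)"
      proof -
        have "X * D / (A * B) * (r * z * B / (b * Y)) = (X / Y * r) * (z * D) / (A * b)" for X D r z b Y
          using AB by (simp add: divide_simps)
        then show ?thesis unfolding kap .
      qed
      also have "\<xi> * (\<xi> - inverse \<xi>) = \<xi>\<^sup>2 - 1" using \<xi> by (simp add: field_simps power2_eq_square)
      also have "(1 + inverse ?Q) / (?Q + 1) * ?s = inverse ?s"
      proof -
        have "1 + inverse ?Q = (?Q + 1) / ?Q" using Q by (simp add: field_simps)
        then have "(1 + inverse ?Q) / (?Q + 1) = inverse ?Q" using Q by (simp add: divide_inverse)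
        then show ?thesis using s Q by (simp add: field_simps)
      qed
      also have "inverse ?s * (\<xi>\<^sup>2 - 1) / (A * ?\<beta> ^ d) = (\<xi>\<^sup>2 - 1) * \<xi> ^ d / (A * ?s ^ Suc d)"
        using s \<xi> AB by (simp add: power_mult_distrib power_inverse field_simps)
      finally show ?thesis .
    qed
    also have "wave_symbol d \<xi> / ?\<alpha> = (\<xi> ^ d / A - inverse \<xi> ^ Suc (Suc d) / B) / ?s ^ Suc d"
      unfolding ws using \<xi> s AB by (simp add: field_simps)
    also have "(\<xi> ^ d / A - inverse \<xi> ^ Suc (Suc d) / B) / ?s ^ Suc d + (\<xi>\<^sup>2 - 1) * \<xi> ^ d / (A * ?s ^ Suc
        d) = wave_symbol (Suc d) \<xi>"
    proof -
      have "(\<xi>\<^sup>2 - 1) * \<xi> ^ d / (A * ?s ^ Suc d) = (\<xi> ^ Suc (Suc d) / A - \<xi> ^ d / A) / ?s ^ Suc d"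
        by (simp add: power2_eq_square algebra_simps diff_divide_distrib)
      then show ?thesis unfolding ws by (simp only: add_divide_distrib[symmetric]) simp
    qed
    finally show ?case using p(2) d by simp
  qed
qed

end

section \<open>Square integrable functions on a finite measure space\<close>

text \<open>
  The square of the \<open>L\<^sup>2\<close> seminorm. Convergence is stated by means of squares, for which the
  estimate \<open>|a + b|\<^sup>2 \<le> 2 |a|\<^sup>2 + 2 |b|\<^sup>2\<close> serves as triangle inequality.
\<close>

definition l2sq :: "'a measure \<Rightarrow> ('a \<Rightarrow> complex) \<Rightarrow> real" where
  "l2sq M F = (\<integral>x. (cmod (F x))\<^sup>2 \<partial>M)"

abbreviation l2_dist_sq :: "'a measure \<Rightarrow> ('a \<Rightarrow> complex) \<Rightarrow> ('a \<Rightarrow> complex) \<Rightarrow> real" where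
  "l2_dist_sq M F G \<equiv> l2sq M (\<lambda>x. F x - G x)"

lemma L2_dist_l2sq: "L2_dist M F G = sqrt (l2_dist_sq M F G)"
  by (simp add: L2_dist_def l2sq_def)

lemma l2sq_nonneg: "l2sq M F \<ge> 0"
  by (simp add: l2sq_def)

lemma L2_measurable: "F \<in> L2 M \<Longrightarrow> F \<in> borel_measurable M"
  by (simp add: L2_def)

lemma L2_integrable_sq: "F \<in> L2 M \<Longrightarrow> integrable M (\<lambda>x. (cmod (F x))\<^sup>2)"
  by (simp add: L2_def)

lemma norm_mult_le_squares: "norm (a * b :: complex) \<le> (t * (cmod a)\<^sup>2 + (cmod b)\<^sup>2 / t) / 2" if "t > 0"
proof -
  have "0 \<le> (sqrt t * cmod a - cmod b / sqrt t)\<^sup>2" by simp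
  also have "\<dots> = t * (cmod a)\<^sup>2 + (cmod b)\<^sup>2 / t - 2 * (cmod a * cmod b)"
    using that by (simp add: power2_diff power_mult_distrib power_divide)
  finally show ?thesis by (simp add: norm_mult)
qed

lemma le_of_le_half: "(c::real) \<le> S / 2 \<Longrightarrow> 0 \<le> c \<Longrightarrow> c \<le> S"
  by simp

lemma L2_mult_integrable:
  assumes "F \<in> L2 M" "G \<in> L2 M" shows "integrable M (\<lambda>x. F x * G x)"
proof (rule Bochner_Integration.integrable_bound)
  show "integrable M (\<lambda>x. (cmod (F x))\<^sup>2 + (cmod (G x))\<^sup>2)" using assms by (simp add: L2_def)
  show "(\<lambda>x. F x * G x) \<in> borel_measurable M" using assms by (auto simp: L2_def)
  have "norm (F x * G x) \<le> norm ((cmod (F x))\<^sup>2 + (cmod (G x))\<^sup>2)" for x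
  proof -
    have "norm (F x * G x) \<le> ((cmod (F x))\<^sup>2 + (cmod (G x))\<^sup>2) / 2"
        using norm_mult_le_squares[of 1 "F x" "G x"] by simp
    from le_of_le_half[OF this norm_ge_zero] have "norm (F x * G x) \<le> (cmod (F x))\<^sup>2 + (cmod (G x))\<^sup>2" .
    then show ?thesis by simp
  qed
  then show "AE x in M. norm (F x * G x) \<le> norm ((cmod (F x))\<^sup>2 + (cmod (G x))\<^sup>2)" by simp
qed

lemma L2_cnj: "F \<in> L2 M \<Longrightarrow> (\<lambda>x. cnj (F x)) \<in> L2 M"
  by (auto simp: L2_def intro: borel_measurable_continuous_on[of cnj] continuous_intros)

lemma L2_bounded_mult:
  assumes "F \<in> L2 M" "h \<in> borel_measurable M" "\<And>x. x \<in> space M \<Longrightarrow> cmod (h x) \<le> B"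
  shows "(\<lambda>x. h x * F x) \<in> L2 M" "l2sq M (\<lambda>x. h x * F x) \<le> B\<^sup>2 * l2sq M F"
proof -
  have le: "(cmod (h x * F x))\<^sup>2 \<le> B\<^sup>2 * (cmod (F x))\<^sup>2" if "x \<in> space M" for x
    using assms(3)[OF that] by (simp add: norm_mult power_mult_distrib mult_right_mono power_mono)
  have i: "integrable M (\<lambda>x. B\<^sup>2 * (cmod (F x))\<^sup>2)" using assms(1) by (simp add: L2_def)
  have m: "(\<lambda>x. h x * F x) \<in> borel_measurable M" using assms by (auto simp: L2_def)
  have i2: "integrable M (\<lambda>x. (cmod (h x * F x))\<^sup>2)"
    by (rule Bochner_Integration.integrable_bound[OF i]) (use m le in \<open>auto intro!: AE_I2\<close>)
  then show "(\<lambda>x. h x * F x) \<in> L2 M" using m by (simp add: L2_def)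
  have "l2sq M (\<lambda>x. h x * F x) \<le> (\<integral>x. B\<^sup>2 * (cmod (F x))\<^sup>2 \<partial>M)"
    unfolding l2sq_def using i2 i le by (intro integral_mono) auto
  then show "l2sq M (\<lambda>x. h x * F x) \<le> B\<^sup>2 * l2sq M F" by (simp add: l2sq_def)
qed

lemma L2_scale: "F \<in> L2 M \<Longrightarrow> (\<lambda>x. c * F x) \<in> L2 M"
  by (rule L2_bounded_mult(1)[where B = "cmod c"]) auto

lemma l2sq_scale: "l2sq M (\<lambda>x. c * F x) = (cmod c)\<^sup>2 * l2sq M F"
  by (simp add: l2sq_def norm_mult power_mult_distrib)

lemma sq_add_le: "(cmod (a + b))\<^sup>2 \<le> 2 * (cmod a)\<^sup>2 + 2 * (cmod b)\<^sup>2"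
proof -
  have "(cmod (a + b))\<^sup>2 \<le> (cmod a + cmod b)\<^sup>2" by (intro power_mono norm_triangle_ineq) simp
  also have "\<dots> \<le> 2 * (cmod a)\<^sup>2 + 2 * (cmod b)\<^sup>2"
    using sum_squares_bound[of "cmod a" "cmod b"] by (simp add: power2_sum)
  finally show ?thesis .
qed

lemma L2_add:
  assumes "F \<in> L2 M" "G \<in> L2 M"
  shows "(\<lambda>x. F x + G x) \<in> L2 M" "l2sq M (\<lambda>x. F x + G x) \<le> 2 * l2sq M F + 2 * l2sq M G"
proof -
  have i: "integrable M (\<lambda>x. 2 * (cmod (F x))\<^sup>2 + 2 * (cmod (G x))\<^sup>2)" using assms by (simp add: L2_def)
  have m: "(\<lambda>x. F x + G x) \<in> borel_measurable M" using assms by (auto simp: L2_def)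
  have i2: "integrable M (\<lambda>x. (cmod (F x + G x))\<^sup>2)"
    by (rule Bochner_Integration.integrable_bound[OF i]) (use m sq_add_le in \<open>auto intro!: AE_I2\<close>)
  then show "(\<lambda>x. F x + G x) \<in> L2 M" using m by (simp add: L2_def)
  have "l2sq M (\<lambda>x. F x + G x) \<le> (\<integral>x. 2 * (cmod (F x))\<^sup>2 + 2 * (cmod (G x))\<^sup>2 \<partial>M)"
    unfolding l2sq_def by (rule integral_mono[OF i2 i]) (rule sq_add_le)
  also have "\<dots> = 2 * l2sq M F + 2 * l2sq M G" using assms by (simp add: L2_def l2sq_def)
  finally show "l2sq M (\<lambda>x. F x + G x) \<le> 2 * l2sq M F + 2 * l2sq M G" .
qed

lemma L2_diff: "F \<in> L2 M \<Longrightarrow> G \<in> L2 M \<Longrightarrow> (\<lambda>x. F x - G x) \<in> L2 M"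
  using L2_add(1)[of F M "\<lambda>x. -1 * G x"] L2_scale[of G M "-1"] by simp

lemma l2sq_triangle:
  assumes "F \<in> L2 M" "G \<in> L2 M" "H \<in> L2 M"
  shows "l2_dist_sq M F H \<le> 2 * l2_dist_sq M F G + 2 * l2_dist_sq M G H"
  using L2_add(2)[OF L2_diff[OF assms(1,2)] L2_diff[OF assms(2,3)]] by simp

lemma l2sq_minus_commute: "l2_dist_sq M F G = l2_dist_sq M G F"
  by (simp add: l2sq_def norm_minus_commute)

lemma l2sq_cong_AE:
  assumes "F \<in> borel_measurable M" "G \<in> borel_measurable M" "AE x in M. F x = G x"
  shows "l2sq M F = l2sq M G"
  unfolding l2sq_def by (rule integral_cong_AE) (use assms in auto)

lemma l2sq_zero_AE:
  assumes "F \<in> L2 M" "l2sq M F = 0" shows "AE x in M. F x = 0"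
proof -
  have "AE x in M. (cmod (F x))\<^sup>2 = 0"
    using assms integral_nonneg_eq_0_iff_AE[OF L2_integrable_sq[OF assms(1)]] by (simp add: l2sq_def)
  then show ?thesis by simp
qed

lemma L2_limit_unique:
  assumes "\<And>n. X n \<in> L2 M" "F \<in> L2 M" "G \<in> L2 M"
    "(\<lambda>n. l2_dist_sq M (X n) F) \<longlonglongrightarrow> 0" "(\<lambda>n. l2_dist_sq M (X n) G) \<longlonglongrightarrow> 0"
  shows "AE x in M. F x = G x"
proof -
  have "l2_dist_sq M F G \<le> 2 * l2_dist_sq M (X n) F + 2 * l2_dist_sq M (X n) G" for n
    using l2sq_triangle[OF assms(2) assms(1)[of n] assms(3)] by (simp add: l2sq_minus_commute[of M F])
  moreover have "(\<lambda>n. 2 * l2_dist_sq M (X n) F + 2 * l2_dist_sq M (X n) G) \<longlonglongrightarrow> 2 * 0 + 2 * 0"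
    by (intro tendsto_intros assms)
  ultimately have "l2_dist_sq M F G \<le> 0" by (intro LIMSEQ_le_const[of _ "0::real"]) auto
  then have "l2_dist_sq M F G = 0" using l2sq_nonneg[of M "\<lambda>x. F x - G x"] by simp
  from l2sq_zero_AE[OF L2_diff[OF assms(2,3)] this] show ?thesis by simp
qed

text \<open>
  The pointwise bound \<open>2 |F G| \<le> t |F|\<^sup>2 + |G|\<^sup>2/t\<close> is integrated and optimised over \<open>t > 0\<close>.
  Adding \<open>d > 0\<close> to both squared norms keeps the optimal \<open>t\<close> finite and positive.
\<close>

lemma L2_Cauchy_Schwarz:
  assumes "F \<in> L2 M" "G \<in> L2 M"
  shows "cmod (\<integral>x. F x * G x \<partial>M) \<le> sqrt (l2sq M F) * sqrt (l2sq M G)"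
proof -
  let ?c = "cmod (\<integral>x. F x * G x \<partial>M)" and ?a = "l2sq M F" and ?b = "l2sq M G"
  have b1: "?c \<le> (t * ?a + ?b / t) / 2" if "t > 0" for t
  proof -
    have i: "integrable M (\<lambda>x. (t * (cmod (F x))\<^sup>2 + (cmod (G x))\<^sup>2 / t) / 2)"
      using assms by (simp add: L2_def)
    have "?c \<le> (\<integral>x. norm (F x * G x) \<partial>M)" by simp
    also have "\<dots> \<le> (\<integral>x. (t * (cmod (F x))\<^sup>2 + (cmod (G x))\<^sup>2 / t) / 2 \<partial>M)"
      using L2_mult_integrable[OF assms] i norm_mult_le_squares[OF that] by (intro integral_mono) auto
    also have "\<dots> = (t * ?a + ?b / t) / 2" using assms by (simp add: L2_def l2sq_def)
    finally show ?thesis .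
  qed
  have b2: "?c \<le> sqrt (?a + d) * sqrt (?b + d)" if "d > 0" for d
  proof -
    have pos: "?a + d > 0" "?b + d > 0" using that l2sq_nonneg[of M] by (auto intro: add_nonneg_pos)
    define t where "t = sqrt (?b + d) / sqrt (?a + d)"
    have t: "t > 0" using pos by (simp add: t_def)
    have "t * ?a \<le> t * (?a + d)" using t that by simp
    also have "\<dots> = sqrt (?a + d) * sqrt (?b + d)"
    proof -
      have "?a + d = sqrt (?a + d) * sqrt (?a + d)" using pos by simp
      then show ?thesis unfolding t_def using pos by (metis (no_types, lifting) less_imp_le mult.commute
          nonzero_mult_div_cancel_left real_div_sqrt times_divide_eq_left times_divide_eq_right)
    qed
    finally have 1: "t * ?a \<le> sqrt (?a + d) * sqrt (?b + d)" .
    have "?b / t \<le> (?b + d) / t" using t that by (simp add: divide_right_mono)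
    also have "\<dots> = sqrt (?a + d) * sqrt (?b + d)"
    proof -
      have "(?b + d) / t = (?b + d) / sqrt (?b + d) * sqrt (?a + d)" by (simp add: t_def)
      also have "(?b + d) / sqrt (?b + d) = sqrt (?b + d)" using pos real_div_sqrt less_imp_le by blast
      finally show ?thesis by simp
    qed
    finally show ?thesis using 1 b1[OF t] by argo
  qed
  have "((\<lambda>d. sqrt (?a + d) * sqrt (?b + d)) \<longlongrightarrow> sqrt (?a + 0) * sqrt (?b + 0)) (at_right 0)"
    by (intro tendsto_intros)
  then have "?c \<le> sqrt (?a + 0) * sqrt (?b + 0)"
    by (rule tendsto_lowerbound) (auto simp: eventually_at_right_less b2 intro!: eventually_at_rightI[of 0 1])
  then show ?thesis by simp
qed

lemma L2_functional_tendsto: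
  assumes "\<And>n. X n \<in> L2 M" "F \<in> L2 M" "(\<lambda>n. l2_dist_sq M (X n) F) \<longlonglongrightarrow> 0" "H \<in> L2 M"
  shows "(\<lambda>n. \<integral>x. X n x * H x \<partial>M) \<longlonglongrightarrow> (\<integral>x. F x * H x \<partial>M)"
proof -
  have "(\<lambda>n. sqrt (l2_dist_sq M (X n) F) * sqrt (l2sq M H)) \<longlonglongrightarrow> sqrt 0 * sqrt (l2sq M H)"
    by (intro tendsto_intros assms)
  then have l: "(\<lambda>n. sqrt (l2_dist_sq M (X n) F) * sqrt (l2sq M H)) \<longlonglongrightarrow> 0" by simp
  have b: "norm ((\<integral>x. X n x * H x \<partial>M) - (\<integral>x. F x * H x \<partial>M))
      \<le> sqrt (l2_dist_sq M (X n) F) * sqrt (l2sq M H)" for n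
  proof -
    have "(\<integral>x. X n x * H x \<partial>M) - (\<integral>x. F x * H x \<partial>M) = (\<integral>x. X n x * H x - F x * H x \<partial>M)"
      using assms by (intro Bochner_Integration.integral_diff[symmetric] L2_mult_integrable)
    also have "\<dots> = (\<integral>x. (X n x - F x) * H x \<partial>M)" by (simp add: algebra_simps)
    finally show ?thesis using L2_Cauchy_Schwarz[OF L2_diff[OF assms(1)[of n] assms(2)] assms(4)] by simp
  qed
  have "(\<lambda>n. (\<integral>x. X n x * H x \<partial>M) - (\<integral>x. F x * H x \<partial>M)) \<longlonglongrightarrow> 0"
    by (rule Lim_null_comparison[OF always_eventually[OF allI[OF b]] l])
  then show ?thesis by (rule LIM_zero_cancel)
qed

lemma L2_inner_tendsto:
  assumes "\<And>n. X n \<in> L2 M" "F \<in> L2 M" "(\<lambda>n. l2_dist_sq M (X n) F) \<longlonglongrightarrow> 0"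
    "\<And>n. Y n \<in> L2 M" "G \<in> L2 M" "(\<lambda>n. l2_dist_sq M (Y n) G) \<longlonglongrightarrow> 0"
  shows "(\<lambda>n. L2_inner M (X n) (Y n)) \<longlonglongrightarrow> L2_inner M F G"
proof -
  define A where "A = (\<lambda>n x. X n x - F x)"
  define B where "B = (\<lambda>n x. cnj (Y n x) - cnj (G x))"
  have AL: "A n \<in> L2 M" for n using L2_diff[OF assms(1)[of n] assms(2)] by (simp add: A_def)
  have BL: "B n \<in> L2 M" for n using L2_diff[OF L2_cnj[OF assms(4)[of n]] L2_cnj[OF assms(5)]]
      by (simp add: B_def)
  have Bsq: "l2sq M (B n) = l2_dist_sq M (Y n) G" for n
    unfolding l2sq_def B_def by (simp flip: complex_cnj_diff)
  have t1: "(\<lambda>n. \<integral>x. A n x * B n x \<partial>M) \<longlonglongrightarrow> 0"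
  proof (rule Lim_null_comparison)
    show "\<forall>\<^sub>F n in sequentially. norm (\<integral>x. A n x * B n x \<partial>M) \<le> sqrt (l2sq M (A n)) * sqrt (l2sq M (B n))"
      using L2_Cauchy_Schwarz[OF AL BL] by simp
    have "(\<lambda>n. sqrt (l2sq M (A n)) * sqrt (l2sq M (B n))) \<longlonglongrightarrow> sqrt 0 * sqrt 0"
      unfolding Bsq unfolding A_def by (intro tendsto_intros assms)
    then show "(\<lambda>n. sqrt (l2sq M (A n)) * sqrt (l2sq M (B n))) \<longlonglongrightarrow> 0" by simp
  qed
  have t2: "(\<lambda>n. \<integral>x. X n x * cnj (G x) \<partial>M) \<longlonglongrightarrow> (\<integral>x. F x * cnj (G x) \<partial>M)"
    by (rule L2_functional_tendsto[OF assms(1,2,3) L2_cnj[OF assms(5)]])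
  have t3: "(\<lambda>n. \<integral>x. B n x * F x \<partial>M) \<longlonglongrightarrow> (\<integral>x. 0 * F x \<partial>M)"
    by (rule L2_functional_tendsto[OF BL _ _ assms(2)]) (use assms(6) Bsq in \<open>auto simp: L2_def\<close>)
  have "L2_inner M (X n) (Y n) = (\<integral>x. A n x * B n x \<partial>M) + (\<integral>x. X n x * cnj (G x) \<partial>M) + (\<integral>x. B n x * F x
      \<partial>M)" for n
  proof -
    have "L2_inner M (X n) (Y n) = (\<integral>x. (A n x * B n x + X n x * cnj (G x)) + B n x * F x \<partial>M)"
      unfolding L2_inner_def A_def B_def by (simp add: algebra_simps)
    also have "\<dots> = (\<integral>x. A n x * B n x + X n x * cnj (G x) \<partial>M) + (\<integral>x. B n x * F x \<partial>M)"
      using AL BL assms by (intro Bochner_Integration.integral_add Bochner_Integration.integrable_add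
          L2_mult_integrable L2_cnj)
    also have "(\<integral>x. A n x * B n x + X n x * cnj (G x) \<partial>M) = (\<integral>x. A n x * B n x \<partial>M) + (\<integral>x. X n x * cnj (G x) \<partial>M)"
      using AL BL assms by (intro Bochner_Integration.integral_add L2_mult_integrable L2_cnj)
    finally show ?thesis .
  qed
  with tendsto_add[OF tendsto_add[OF t1 t2] t3] show ?thesis by (simp add: L2_inner_def)
qed

lemma L2_inner_self: "L2_inner M F F = of_real (l2sq M F)"
  by (simp only: L2_inner_def l2sq_def complex_norm_square[symmetric] integral_complex_of_real)

lemma (in finite_measure) L2_of_bounded:
  assumes "F \<in> borel_measurable M" "\<And>x. x \<in> space M \<Longrightarrow> cmod (F x) \<le> B"
  shows "F \<in> L2 M"
  using L2_bounded_mult(1)[of "\<lambda>_. 1" M F B] assms by (simp add: L2_def)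

lemma (in finite_measure) L2_imp_integrable: "F \<in> L2 M \<Longrightarrow> integrable M F"
  using L2_mult_integrable[of F M "\<lambda>_. 1"] by (simp add: L2_def)

text \<open>
  On a finite measure space, \<open>|g| \<le> 2\<^sup>k |g|\<^sup>2 + 2\<^sup>-\<^sup>k\<close> turns the quadratic bound for the
  increments into a summable bound in \<open>L\<^sup>1\<close>, so the increments are almost everywhere absolutely
  summable.
\<close>

lemma (in finite_measure) L2_AE_convergent_subseq:
  assumes X: "\<And>n. Y n \<in> L2 M" "\<And>k. l2_dist_sq M (Y (Suc k)) (Y k) \<le> 1 / 4 ^ k"
  shows "AE x in M. convergent (\<lambda>k. Y k x)"
proof -
  have [measurable]: "Y n \<in> borel_measurable M" for n using X(1) by (rule L2_measurable)
  define g where "g = (\<lambda>k x. Y (Suc k) x - Y k x)"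
  have gL: "g k \<in> L2 M" for k using L2_diff[OF X(1) X(1)] by (simp add: g_def)
  have gm[measurable]: "g k \<in> borel_measurable M" for k using gL by (rule L2_measurable)
  have bound: "(\<integral>x. cmod (g k x) \<partial>M) \<le> (1 + measure M (space M)) * (1/2)^k" for k
  proof -
    have "(\<integral>x. cmod (g k x) \<partial>M) \<le> (\<integral>x. 2^k * (cmod (g k x))\<^sup>2 + (1/2)^k \<partial>M)"
    proof (rule integral_mono)
      show "integrable M (\<lambda>x. cmod (g k x))" using L2_imp_integrable[OF gL] by simp
      show "integrable M (\<lambda>x. 2^k * (cmod (g k x))\<^sup>2 + (1/2)^k)" using L2_integrable_sq[OF gL] by simp
      fix x
      have "cmod (g k x) \<le> (2^k * (cmod (g k x))\<^sup>2 + (1/2)^k) / 2"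
        using norm_mult_le_squares[of "2^k" "g k x" 1] by (simp add: power_one_over)
      from le_of_le_half[OF this norm_ge_zero] show "cmod (g k x) \<le> 2^k * (cmod (g k x))\<^sup>2 + (1/2)^k" .
    qed
    also have "\<dots> = 2^k * l2sq M (g k) + measure M (space M) * (1/2)^k"
      using L2_integrable_sq[OF gL[of k]] by (simp add: l2sq_def)
    also have "2^k * l2sq M (g k) \<le> 2^k * (1 / 4^k)"
      using X(2)[of k] by (intro mult_left_mono) (auto simp: g_def)
    also have "(2::real)^k * (1 / 4^k) = (1/2)^k"
      by (simp add: power_divide[symmetric] power_mult_distrib[symmetric] flip: power_divide)
    finally show ?thesis by (simp add: algebra_simps)
  qed
  have "(\<integral>\<^sup>+x. (\<Sum>k. ennreal (cmod (g k x))) \<partial>M) = (\<Sum>k. \<integral>\<^sup>+x. ennreal (cmod (g k x)) \<partial>M)"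
    by (rule nn_integral_suminf) simp
  also have "\<dots> = (\<Sum>k. ennreal (\<integral>x. cmod (g k x) \<partial>M))"
    using L2_imp_integrable[OF gL] by (simp add: nn_integral_eq_integral)
  also have "\<dots> \<le> (\<Sum>k. ennreal ((1 + measure M (space M)) * (1/2)^k))"
    using bound by (intro suminf_le ennreal_leI) auto
  also have "\<dots> = ennreal (\<Sum>k. (1 + measure M (space M)) * (1/2)^k)"
    by (rule suminf_ennreal2) (auto intro!: summable_mult summable_geometric)
  also have "\<dots> < \<infinity>" by simp
  finally have "AE x in M. (\<Sum>k. ennreal (cmod (g k x))) \<noteq> \<infinity>"
    by (intro nn_integral_PInf_AE) auto
  then show ?thesis
  proof eventually_elim
    case (elim x)
    then have "summable (\<lambda>k. cmod (g k x))" by (intro summable_suminf_not_top) auto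
    then have "summable (\<lambda>k. g k x)" by (rule summable_norm_cancel)
    then have "convergent (\<lambda>n. \<Sum>k<n. g k x)" by (simp add: summable_iff_convergent)
    moreover have "(\<Sum>k<n. g k x) = Y n x - Y 0 x" for n unfolding g_def by (rule sum_lessThan_telescope)
    ultimately have "convergent (\<lambda>n. Y n x - Y 0 x)" by simp
    then have "convergent (\<lambda>n. (Y n x - Y 0 x) + Y 0 x)" by (intro convergent_add convergent_const)
    then show "convergent (\<lambda>n. Y n x)" by simp
  qed
qed

text \<open>
  Riesz-Fischer: a fast subsequence converges almost everywhere, and Fatou's lemma carries the
  Cauchy property over to the limit.
\<close>

theorem (in finite_measure) L2_complete:
  assumes X: "\<And>n. X n \<in> L2 M"
    and C: "\<And>e. e > 0 \<Longrightarrow> \<exists>N. \<forall>m\<ge>N. \<forall>n\<ge>N. l2_dist_sq M (X m) (X n) < e"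
  shows "\<exists>F\<in>L2 M. (\<lambda>n. l2_dist_sq M (X n) F) \<longlonglongrightarrow> 0"
proof -
  have [measurable]: "X n \<in> borel_measurable M" for n using X by (rule L2_measurable)
  have "\<forall>k. \<exists>N. \<forall>m\<ge>N. \<forall>n\<ge>N. l2_dist_sq M (X m) (X n) < 1 / 4 ^ k" by (intro allI C) simp
  then obtain N where N: "\<And>k m n. m \<ge> N k \<Longrightarrow> n \<ge> N k \<Longrightarrow> l2_dist_sq M (X m) (X n) < 1 / 4 ^ k" by metis
  \<comment> \<open>Increasing, at least \<open>N k\<close> and at least \<open>k\<close>.\<close>
  define r where "r = (\<lambda>k. k + (\<Sum>i\<le>k. N i))"
  have r1: "N k \<le> r k" for k using member_le_sum[of k "{..k}" N] by (simp add: r_def)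
  have r2: "r k \<le> r (Suc k)" for k by (simp add: r_def)
  have r3: "k \<le> r k" for k by (simp add: r_def)
  define Y where "Y = (\<lambda>k. X (r k))"
  have [measurable]: "Y n \<in> borel_measurable M" for n by (simp add: Y_def)
  define F where "F = (\<lambda>x. lim (\<lambda>k. Y k x))"
  have Fm[measurable]: "F \<in> borel_measurable M" unfolding F_def by (rule borel_measurable_lim_metric) measurable
  have "AE x in M. convergent (\<lambda>k. Y k x)"
  proof (rule L2_AE_convergent_subseq)
    show "l2_dist_sq M (Y (Suc k)) (Y k) \<le> 1 / 4 ^ k" for k
      using N[of k "r (Suc k)" "r k"] r1[of k] r2[of k] unfolding Y_def by simp
  qed (simp add: Y_def X)
  then have lim: "AE x in M. (\<lambda>k. Y k x) \<longlonglongrightarrow> F x" by eventually_elim (simp add: F_def convergent_LIMSEQ_iff)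
  have fatou: "(\<integral>\<^sup>+x. ennreal ((cmod (X n x - F x))\<^sup>2) \<partial>M) \<le> ennreal e"
    if e: "\<And>k. k \<ge> K \<Longrightarrow> l2_dist_sq M (X n) (Y k) \<le> e" for n e K
  proof -
    have "(\<integral>\<^sup>+x. ennreal ((cmod (X n x - F x))\<^sup>2) \<partial>M) = (\<integral>\<^sup>+x. liminf (\<lambda>k. ennreal ((cmod (X n x - Y k
        x))\<^sup>2)) \<partial>M)"
    proof (rule nn_integral_cong_AE)
      show "AE x in M. ennreal ((cmod (X n x - F x))\<^sup>2) = liminf (\<lambda>k. ennreal ((cmod (X n x - Y k x))\<^sup>2))"
        using lim
      proof eventually_elim
        case (elim x)
        then have "(\<lambda>k. ennreal ((cmod (X n x - Y k x))\<^sup>2)) \<longlonglongrightarrow> ennreal ((cmod (X n x - F x))\<^sup>2)"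
          by (intro tendsto_intros)
        from lim_imp_Liminf[OF _ this] show ?case by simp
      qed
    qed
    also have "\<dots> \<le> liminf (\<lambda>k. \<integral>\<^sup>+x. ennreal ((cmod (X n x - Y k x))\<^sup>2) \<partial>M)"
      by (rule nn_integral_liminf) measurable
    also have "\<dots> = liminf (\<lambda>k. ennreal (l2_dist_sq M (X n) (Y k)))"
    proof -
      have "(\<integral>\<^sup>+x. ennreal ((cmod (X n x - Y k x))\<^sup>2) \<partial>M) = ennreal (l2_dist_sq M (X n) (Y k))" for k
        unfolding l2sq_def by (rule nn_integral_eq_integral[OF L2_integrable_sq[OF L2_diff]]) (simp_all
            add: X Y_def)
      then show ?thesis by simp
    qed
    also have "\<dots> \<le> liminf (\<lambda>k. ennreal e)"
      by (rule Liminf_mono) (use e in \<open>auto simp: eventually_sequentially intro!: exI[of _ K] ennreal_leI\<close>)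
    also have "\<dots> = ennreal e" by (simp add: Liminf_const)
    finally show ?thesis .
  qed
  have dL: "(\<lambda>x. X n x - F x) \<in> L2 M" and dl: "l2_dist_sq M (X n) F \<le> e"
    if e: "\<And>k. k \<ge> K \<Longrightarrow> l2_dist_sq M (X n) (Y k) \<le> e" "e \<ge> 0" for n e K
  proof -
    have f: "(\<integral>\<^sup>+x. ennreal ((cmod (X n x - F x))\<^sup>2) \<partial>M) \<le> ennreal e" by (rule fatou, rule e(1))
    have i: "integrable M (\<lambda>x. (cmod (X n x - F x))\<^sup>2)"
      by (rule integrableI_bounded) (use f in \<open>auto intro: le_less_trans\<close>)
    then show "(\<lambda>x. X n x - F x) \<in> L2 M" by (simp add: L2_def)
    have "ennreal (l2_dist_sq M (X n) F) \<le> ennreal e"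
      using f i unfolding l2sq_def by (subst (asm) nn_integral_eq_integral) auto
    then show "l2_dist_sq M (X n) F \<le> e" using e(2) by simp
  qed
  have "l2_dist_sq M (X (N 0)) (Y k) \<le> 1" if "k \<ge> N 0" for k
    using N[of 0 "N 0" "r k"] r3[of k] that unfolding Y_def by (simp add: less_imp_le)
  then have "(\<lambda>x. X (N 0) x - F x) \<in> L2 M" using dL[of "N 0" "N 0" 1] by simp
  from L2_diff[OF X[of "N 0"] this] have FL: "F \<in> L2 M" by simp
  have "(\<lambda>n. l2_dist_sq M (X n) F) \<longlonglongrightarrow> 0"
  proof (rule LIMSEQ_I)
    fix e :: real assume "e > 0"
    then obtain K where K: "\<And>m n. m \<ge> K \<Longrightarrow> n \<ge> K \<Longrightarrow> l2_dist_sq M (X m) (X n) < e / 2" using C[of "e/2"] by auto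
    have "l2_dist_sq M (X n) F \<le> e / 2" if "n \<ge> K" for n
    proof (rule dl[of K])
      fix k assume "K \<le> k"
      then have "K \<le> r k" using r3[of k] by linarith
      from K[OF that this] show "l2_dist_sq M (X n) (Y k) \<le> e / 2" by (simp add: Y_def)
    qed (use \<open>e > 0\<close> in simp)
    then have "norm (l2_dist_sq M (X n) F - 0) < e" if "n \<ge> K" for n
      using that l2sq_nonneg[of M "\<lambda>x. X n x - F x"] \<open>e > 0\<close> by (fastforce simp: abs_of_nonneg)
    then show "\<exists>no. \<forall>n\<ge>no. norm (l2_dist_sq M (X n) F - 0) < e" by blast
  qed
  with FL show ?thesis by blast
qed

section \<open>Closed subspaces and density\<close>

definition L2_closure :: "'a measure \<Rightarrow> ('a \<Rightarrow> complex) set \<Rightarrow> ('a \<Rightarrow> complex) set" where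
  "L2_closure M U = {F \<in> L2 M. \<forall>e>0. \<exists>G\<in>U. l2_dist_sq M F G < e}"

locale L2_subspace = finite_measure M for M :: "'a measure" +
  fixes U :: "('a \<Rightarrow> complex) set"
  assumes sub: "U \<subseteq> L2 M"
    and zero: "(\<lambda>x. 0) \<in> U"
    and add: "F \<in> U \<Longrightarrow> G \<in> U \<Longrightarrow> (\<lambda>x. F x + G x) \<in> U"
    and scale: "F \<in> U \<Longrightarrow> (\<lambda>x. c * F x) \<in> U"
begin

abbreviation cl :: "('a \<Rightarrow> complex) set" where "cl \<equiv> L2_closure M U"

lemma cl_L2: "F \<in> cl \<Longrightarrow> F \<in> L2 M"
  by (simp add: L2_closure_def)

lemma cl_approx: assumes "F \<in> cl" "e > 0" obtains G where "G \<in> U" "G \<in> L2 M" "l2_dist_sq M F G < e"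
  using assms sub unfolding L2_closure_def by blast

lemma cl_incl: "F \<in> U \<Longrightarrow> F \<in> cl"
  using sub by (auto simp: L2_closure_def l2sq_def intro!: bexI[of _ F])

lemma cl_add: assumes "F \<in> cl" "G \<in> cl" shows "(\<lambda>x. F x + G x) \<in> cl"
  unfolding L2_closure_def
proof (intro CollectI conjI allI impI)
  show "(\<lambda>x. F x + G x) \<in> L2 M" by (intro L2_add cl_L2 assms)
  fix e :: real assume e: "e > 0"
  obtain F' where F': "F' \<in> U" "F' \<in> L2 M" "l2_dist_sq M F F' < e / 4"
      using cl_approx[OF assms(1), of "e/4"] e by auto
  obtain G' where G': "G' \<in> U" "G' \<in> L2 M" "l2_dist_sq M G G' < e / 4"
      using cl_approx[OF assms(2), of "e/4"] e by auto
  have "l2sq M (\<lambda>x. (F x + G x) - (F' x + G' x)) = l2sq M (\<lambda>x. (F x - F' x) + (G x - G' x))"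
    by (simp add: algebra_simps)
  also have "\<dots> \<le> 2 * l2_dist_sq M F F' + 2 * l2_dist_sq M G G'"
    by (intro L2_add(2) L2_diff cl_L2 assms F' G')
  also have "\<dots> < e" using F' G' by linarith
  finally show "\<exists>H\<in>U. l2sq M (\<lambda>x. (F x + G x) - H x) < e"
    by (rule bexI[where x = "\<lambda>x. F' x + G' x"]) (rule add[OF F'(1) G'(1)])
qed

lemma cl_scale: assumes "F \<in> cl" shows "(\<lambda>x. c * F x) \<in> cl"
  unfolding L2_closure_def
proof (intro CollectI conjI allI impI)
  show "(\<lambda>x. c * F x) \<in> L2 M" by (intro L2_scale cl_L2 assms)
  fix e :: real assume e: "e > 0"
  have p: "(cmod c)\<^sup>2 + 1 > 0" by (intro add_nonneg_pos) auto
  obtain F' where F': "F' \<in> U" "F' \<in> L2 M" "l2_dist_sq M F F' < e / ((cmod c)\<^sup>2 + 1)"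
    using cl_approx[OF assms, of "e / ((cmod c)\<^sup>2 + 1)"] e p by auto
  have "l2sq M (\<lambda>x. c * F x - c * F' x) = (cmod c)\<^sup>2 * l2_dist_sq M F F'"
    by (simp add: l2sq_scale flip: right_diff_distrib)
  also have "\<dots> \<le> ((cmod c)\<^sup>2 + 1) * l2_dist_sq M F F'"
    by (intro mult_right_mono l2sq_nonneg) simp
  also have "\<dots> < e" using F'(3) p by (simp add: pos_less_divide_eq mult.commute)
  finally show "\<exists>H\<in>U. l2sq M (\<lambda>x. c * F x - H x) < e"
    by (rule bexI[where x = "\<lambda>x. c * F' x"]) (rule scale[OF F'(1)])
qed

lemma cl_diff: "F \<in> cl \<Longrightarrow> G \<in> cl \<Longrightarrow> (\<lambda>x. F x - G x) \<in> cl"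
  using cl_add[of F "\<lambda>x. -1 * G x"] cl_scale[of G "-1"] by simp

lemma cl_sum: "finite I \<Longrightarrow> (\<And>i. i \<in> I \<Longrightarrow> F i \<in> cl) \<Longrightarrow> (\<lambda>x. \<Sum>i\<in>I. F i x) \<in> cl"
proof (induction rule: finite_induct)
  case (insert i I)
  then show ?case using cl_add[of "F i" "\<lambda>x. \<Sum>i\<in>I. F i x"] by simp
qed (simp add: cl_incl zero)

lemma cl_closed:
  assumes "F \<in> L2 M" "\<And>e. e > 0 \<Longrightarrow> \<exists>G\<in>cl. l2_dist_sq M F G < e"
  shows "F \<in> cl"
  unfolding L2_closure_def
proof (intro CollectI conjI allI impI assms(1))
  fix e :: real assume e: "e > 0"
  obtain G where G: "G \<in> cl" "l2_dist_sq M F G < e / 4" using assms(2)[of "e/4"] e by auto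
  obtain H where H: "H \<in> U" "H \<in> L2 M" "l2_dist_sq M G H < e / 4" using cl_approx[OF G(1), of "e/4"] e by auto
  have "l2_dist_sq M F H \<le> 2 * l2_dist_sq M F G + 2 * l2_dist_sq M G H"
    by (rule l2sq_triangle[OF assms(1) cl_L2[OF G(1)] H(2)])
  also have "\<dots> < e" using G H by linarith
  finally show "\<exists>G\<in>U. l2_dist_sq M F G < e" using H by blast
qed

lemma cl_limit:
  assumes "F \<in> L2 M" "\<And>n. G n \<in> cl" "(\<lambda>n. l2_dist_sq M F (G n)) \<longlonglongrightarrow> 0"
  shows "F \<in> cl"
proof (rule cl_closed[OF assms(1)])
  fix e :: real assume "e > 0"
  then have "\<forall>\<^sub>F n in sequentially. l2_dist_sq M F (G n) < e" by (rule order_tendstoD(2)[OF assms(3)])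
  then obtain n where "l2_dist_sq M F (G n) < e" by (auto simp: eventually_sequentially)
  then show "\<exists>G\<in>cl. l2_dist_sq M F G < e" using assms(2) by blast
qed

lemma cl_dominated:
  assumes F: "F \<in> borel_measurable M" and G: "\<And>n. G n \<in> cl"
    and lim: "AE x in M. (\<lambda>n. G n x) \<longlonglongrightarrow> F x"
    and W: "W \<in> L2 M" "\<And>n. AE x in M. cmod (G n x) \<le> cmod (W x)"
  shows "F \<in> cl"
proof -
  have Gm: "G n \<in> borel_measurable M" for n using L2_measurable[OF cl_L2[OF G]] .
  have bF: "AE x in M. cmod (F x) \<le> cmod (W x)"
  proof -
    have "AE x in M. \<forall>n. cmod (G n x) \<le> cmod (W x)" using W(2) by (simp add: AE_all_countable)
    with lim show ?thesis
    proof eventually_elim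
      case (elim x)
      have "(\<lambda>n. cmod (G n x)) \<longlonglongrightarrow> cmod (F x)" using elim(1) by (rule tendsto_norm)
      then show ?case by (rule LIMSEQ_le_const2) (use elim(2) in blast)
    qed
  qed
  have iW: "integrable M (\<lambda>x. (cmod (W x))\<^sup>2)" by (rule L2_integrable_sq[OF W(1)])
  have "integrable M (\<lambda>x. (cmod (F x))\<^sup>2)"
  proof (rule Bochner_Integration.integrable_bound[OF iW])
    show "(\<lambda>x. (cmod (F x))\<^sup>2) \<in> borel_measurable M" using F by simp
    show "AE x in M. norm ((cmod (F x))\<^sup>2) \<le> norm ((cmod (W x))\<^sup>2)"
      using bF by eventually_elim (simp add: power_mono)
  qed
  then have FL: "F \<in> L2 M" using F by (simp add: L2_def)
  have "(\<lambda>n. l2_dist_sq M F (G n)) \<longlonglongrightarrow> (\<integral>x. 0 \<partial>M)"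
    unfolding l2sq_def
  proof (rule integral_dominated_convergence)
    show "integrable M (\<lambda>x. 4 * (cmod (W x))\<^sup>2)" using iW by simp
    show "AE x in M. (\<lambda>n. (cmod (F x - G n x))\<^sup>2) \<longlonglongrightarrow> 0"
      using lim
    proof eventually_elim
      case (elim x)
      then have "(\<lambda>n. (cmod (F x - G n x))\<^sup>2) \<longlonglongrightarrow> (cmod (F x - F x))\<^sup>2" by (intro tendsto_intros)
      then show ?case by simp
    qed
    fix n
    show "AE x in M. norm ((cmod (F x - G n x))\<^sup>2) \<le> 4 * (cmod (W x))\<^sup>2"
      using bF W(2)[of n]
    proof eventually_elim
      case (elim x)
      have "(cmod (F x - G n x))\<^sup>2 \<le> (2 * cmod (W x))\<^sup>2"
        using norm_triangle_ineq4[of "F x" "G n x"] elim by (intro power_mono) auto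
      then show ?case by (simp add: power_mult_distrib)
    qed
  qed (use F Gm in auto)
  then show ?thesis using cl_limit[OF FL G] by simp
qed

lemma const_L2: "(\<lambda>x. c) \<in> L2 M"
  by (rule L2_of_bounded[where B = "cmod c"]) auto

lemma cl_cong: "F \<in> cl \<Longrightarrow> G \<in> borel_measurable M \<Longrightarrow> AE x in M. F x = G x \<Longrightarrow> G \<in> cl"
  by (rule cl_dominated[of G "\<lambda>_. F" F]) (auto simp: cl_L2)

text \<open>
  The sets whose indicator functions lie in a closed subspace form a Dynkin system. The lemma is
  stated for preimages under \<open>f\<close> intersected with a fixed set \<open>B\<close>, so that one factor of a product
  space can be treated at a time.
\<close>

lemma cl_indicator_dynkin:
  assumes f: "f \<in> measurable M N" and N: "sets N = sigma_sets (space N) \<G>" "Int_stable \<G>" "\<G> \<subseteq> Pow (space N)"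
    and B: "B \<in> sets M" "(\<lambda>x. indicator B x) \<in> cl"
    and basic: "\<And>S. S \<in> \<G> \<Longrightarrow> (\<lambda>x. indicator (f -` S \<inter> B) x) \<in> cl"
    and S: "S \<in> sets N"
  shows "(\<lambda>x. indicator (f -` S \<inter> B) x) \<in> cl"
proof -
  have BM: "B \<subseteq> space M" using sets.sets_into_space[OF B(1)] .
  have fs: "f x \<in> space N" if "x \<in> B" for x using measurable_space[OF f] BM that by blast
  have meas: "f -` S \<inter> B \<in> sets M" if "S \<in> sets N" for S
  proof -
    have "f -` S \<inter> B = (f -` S \<inter> space M) \<inter> B" using BM by auto
    then show ?thesis using measurable_sets[OF f that] B(1) by simp
  qed
  have imeas: "(\<lambda>x. indicator (f -` S \<inter> B) x :: complex) \<in> borel_measurable M" if "S \<in> sets N" for S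
    using meas[OF that] by (rule borel_measurable_indicator)
  have "S \<in> sigma_sets (space N) \<G>" using S N by simp
  then show ?thesis
  proof (induction rule: sigma_sets_induct_disjoint[OF N(2,3), consumes 1, case_names basic empty compl union])
    case (basic A)
    then show ?case by (rule assms(7))
  next
    case empty
    then show ?case using cl_incl[OF zero] by simp
  next
    case (compl A)
    have "(\<lambda>x. indicator (f -` (space N - A) \<inter> B) x :: complex)
        = (\<lambda>x. indicator B x - indicator (f -` A \<inter> B) x)"
      using fs by (auto simp: indicator_def fun_eq_iff)
    then show ?case using cl_diff[OF B(2) compl(2)] by simp
  next
    case (union A)
    have A: "A i \<in> sets N" for i using union N(1) by auto
    \<comment> \<open>The partial unions are finite sums of indicator functions, and they converge boundedly.\<close>
    define P where "P = (\<lambda>n x. \<Sum>i<n. indicator (f -` A i \<inter> B) x :: complex)"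
    have Pe: "P n x = indicator (f -` (\<Union>i<n. A i) \<inter> B) x" for n x
    proof -
      have "disjoint_family_on (\<lambda>i. f -` A i \<inter> B) {..<n}"
        using union(1) by (fastforce simp: disjoint_family_on_def)
      then have "P n x = indicator (\<Union>i<n. f -` A i \<inter> B) x"
        unfolding P_def by (intro indicator_UN_disjoint[symmetric]) auto
      also have "(\<Union>i<n. f -` A i \<inter> B) = f -` (\<Union>i<n. A i) \<inter> B" by auto
      finally show ?thesis .
    qed
    show ?case
    proof (rule cl_dominated[where G = P and W = "\<lambda>_. 1"])
      show "(\<lambda>x. indicator (f -` (\<Union>i. A i) \<inter> B) x :: complex) \<in> borel_measurable M"
        by (rule imeas) (use A in auto)
      show "P n \<in> cl" for n unfolding P_def by (rule cl_sum) (use union in auto)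
      show "AE x in M. (\<lambda>n. P n x) \<longlonglongrightarrow> indicator (f -` (\<Union>i. A i) \<inter> B) x"
      proof (rule AE_I2)
        fix x
        show "(\<lambda>n. P n x) \<longlonglongrightarrow> indicator (f -` (\<Union>i. A i) \<inter> B) x"
        proof (cases "x \<in> f -` (\<Union>i. A i) \<inter> B")
          case True
          then obtain j where j: "f x \<in> A j" "x \<in> B" by auto
          have "P n x = 1" if "n \<ge> Suc j" for n
            unfolding Pe using j that by (auto simp: indicator_def)
          then show ?thesis using True
            by (intro tendsto_eventually eventually_sequentiallyI[of "Suc j"]) simp
        next
          case False
          then have "P n x = 0" for n unfolding Pe by (auto simp: indicator_def)
          then show ?thesis using False by simp
        qed
      qed
      show "AE x in M. cmod (P n x) \<le> cmod 1" for n unfolding Pe by (auto simp: indicator_def)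
    qed (rule const_L2)
  qed
qed

lemma cl_eq_L2:
  assumes ind: "\<And>S. S \<in> sets M \<Longrightarrow> (\<lambda>x. indicator S x) \<in> cl" and F: "F \<in> L2 M"
  shows "F \<in> cl"
proof -
  obtain s where s: "\<And>i. simple_function M (s i)" "\<And>x. x \<in> space M \<Longrightarrow> (\<lambda>i. s i x) \<longlonglongrightarrow> F x"
    "\<And>i x. x \<in> space M \<Longrightarrow> cmod (s i x) \<le> 2 * cmod (F x)"
    using borel_measurable_implies_sequence_metric[OF L2_measurable[OF F], of 0] by (metis norm_conv_dist)
  have scl: "s i \<in> cl" for i
  proof -
    have "(\<lambda>x. \<Sum>y\<in>s i ` space M. y * indicator (s i -` {y} \<inter> space M) x) \<in> cl"
      using simple_functionD[OF s(1)[of i]] by (intro cl_sum cl_scale ind) auto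
    then show ?thesis
    proof (rule cl_cong)
      show "s i \<in> borel_measurable M" using s(1) by (rule borel_measurable_simple_function)
      show "AE x in M. (\<Sum>y\<in>s i ` space M. y * indicator (s i -` {y} \<inter> space M) x) = s i x"
      proof (rule AE_I2)
        fix x assume x: "x \<in> space M"
        have "(\<Sum>y\<in>s i ` space M. y * indicator (s i -` {y} \<inter> space M) x) = (\<Sum>y\<in>s i ` space M. if y
            = s i x then y else 0)"
          using x by (intro sum.cong) (auto simp: indicator_def)
        also have "\<dots> = s i x" using x simple_functionD(1)[OF s(1)[of i]] by simp
        finally show "(\<Sum>y\<in>s i ` space M. y * indicator (s i -` {y} \<inter> space M) x) = s i x" .
      qed
    qed
  qed
  show ?thesis
  proof (rule cl_dominated[OF L2_measurable[OF F] scl])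
    show "AE x in M. (\<lambda>n. s n x) \<longlonglongrightarrow> F x" using s(2) by (intro AE_I2)
    show "(\<lambda>x. 2 * F x) \<in> L2 M" by (rule L2_scale[OF F])
    show "AE x in M. cmod (s n x) \<le> cmod (2 * F x)" for n using s(3) by (intro AE_I2) (simp add: norm_mult)
  qed
qed

end

section \<open>The circle and Fourier coefficients\<close>

lemma cis_measurable_circle:
  "cis \<in> measurable (restrict_space lborel {0..<2 * pi}) (restrict_space borel (sphere 0 1))"
proof (rule measurable_restrict_space2)
  have "continuous_on UNIV cis" by (intro continuous_intros)
  then have "cis \<in> borel_measurable borel" by (rule borel_measurable_continuous_onI)
  then show "cis \<in> borel_measurable (restrict_space lborel {0..<2 * pi})"
    by (intro measurable_restrict_space1) simp
qed auto

lemma space_circle: "space circle_measure = sphere 0 1"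
  by (simp add: circle_measure_def space_restrict_space)

lemma sets_circle: "sets circle_measure = sets (restrict_space borel (sphere 0 1))"
  by (simp add: circle_measure_def)

lemma measurable_circle: "continuous_on (sphere 0 1) f \<Longrightarrow> f \<in> borel_measurable circle_measure"
  using borel_measurable_continuous_on_restrict[of "sphere 0 1" f]
  by (simp add: circle_measure_def)

lemma integral_circle:
  fixes F :: "complex \<Rightarrow> complex"
  assumes "F \<in> borel_measurable circle_measure"
  shows "integral\<^sup>L circle_measure F = (\<integral>t. indicator {0..2*pi} t *\<^sub>R F (cis t) \<partial>lborel)"
proof -
  have F: "F \<in> borel_measurable (restrict_space borel (sphere 0 1))"
    using assms by (simp add: circle_measure_def)
  have m: "(\<lambda>t. indicator {0..<2*pi} t *\<^sub>R F (cis t)) \<in> borel_measurable lborel"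
  proof -
    have "(\<lambda>t. F (cis t)) \<in> borel_measurable (restrict_space lborel {0..<2 * pi})"
      using measurable_compose[OF cis_measurable_circle F] .
    then show ?thesis by (subst (asm) borel_measurable_restrict_space_iff) auto
  qed
  have e: "indicator {0..2*pi} t *\<^sub>R F (cis t) = indicator {0..<2*pi} t *\<^sub>R F (cis t) + indicator {2*pi} t
      *\<^sub>R F (cis (2*pi))" for t :: real
    using pi_gt_zero by (auto simp: indicator_def)
  have "integral\<^sup>L circle_measure F = (\<integral>t. indicator {0..<2*pi} t *\<^sub>R F (cis t) \<partial>lborel)"
    unfolding circle_measure_def by (subst integral_distr[OF cis_measurable_circle F], subst
        integral_restrict_space) auto
  also have "\<dots> = (\<integral>t. indicator {0..2*pi} t *\<^sub>R F (cis t) \<partial>lborel)"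
  proof (rule integral_cong_AE)
    show "AE t in lborel. indicator {0..<2*pi} t *\<^sub>R F (cis t) = indicator {0..2*pi} t *\<^sub>R F (cis t)"
      using AE_lborel_singleton[of "2*pi"] by eventually_elim (auto simp: e)
    show "(\<lambda>t. indicator {0..2*pi} t *\<^sub>R F (cis t)) \<in> borel_measurable lborel"
      unfolding e by (rule borel_measurable_add[OF m]) auto
  qed (rule m)
  finally show ?thesis .
qed

lemma emeasure_circle: "emeasure circle_measure (space circle_measure) = ennreal (2 * pi)"
proof -
  have "sphere (0::complex) 1 \<in> sets (restrict_space borel (sphere 0 1))"
    using sets.top[of "restrict_space borel (sphere (0::complex) 1)"] by (simp add: space_restrict_space)
  then have "emeasure circle_measure (space circle_measure)
      = emeasure (restrict_space lborel {0..<2 * pi}) (space (restrict_space lborel {0..<2 * pi}))"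
    unfolding circle_measure_def
    by (subst emeasure_distr[OF cis_measurable_circle]) (auto simp: space_restrict_space intro!:
        arg_cong2[of _ _ _ _ emeasure])
  also have "\<dots> = emeasure lborel {0..<2*pi}"
    by (subst emeasure_restrict_space) (auto simp: space_restrict_space)
  finally show ?thesis by simp
qed

lemma finite_measure_circle: "finite_measure circle_measure"
  by (rule finite_measureI) (simp add: emeasure_circle)

text \<open>
  Orthogonality of the characters, by the fundamental theorem of calculus.
\<close>

lemma integral_circle_powi:
  "(\<integral>\<xi>. \<xi> powi n \<partial>circle_measure) = (if n = 0 then 2 * pi else 0)"
proof (cases "n = 0")
  case True
  then show ?thesis using emeasure_circle by (simp add: measure_def scaleR_conv_of_real)
next
  case False
  have c: "continuous_on (sphere 0 1) (\<lambda>\<xi>::complex. \<xi> powi n)"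
    by (intro continuous_intros) auto
  let ?F = "\<lambda>t. cis (of_int n * t) / (\<i> * of_int n)"
  have "(\<integral>\<xi>. \<xi> powi n \<partial>circle_measure) = (\<integral>t. indicator {0..2*pi} t *\<^sub>R (cis t powi n) \<partial>lborel)"
    by (rule integral_circle[OF measurable_circle[OF c]])
  also have "\<dots> = (\<integral>t. indicator {0..2*pi} t *\<^sub>R cis (of_int n * t) \<partial>lborel)"
    by (simp add: cis_power_int)
  also have "\<dots> = ?F (2 * pi) - ?F 0"
  proof (rule integral_FTC_Icc)
    fix t :: real
    have "((\<lambda>t. exp (\<i> * (of_int n * of_real t)) / (\<i> * of_int n)) has_vector_derivative exp (\<i> * (of_int
        n * of_real t))) (at t within {0..2*pi})"
      using False by (auto intro!: derivative_eq_intros has_vector_derivative_real_field simp: field_simps)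
    then show "(?F has_vector_derivative cis (of_int n * t)) (at t within {0..2*pi})"
      by (simp add: cis_conv_exp)
  qed (auto intro!: continuous_intros)
  also have "\<dots> = 0"
  proof -
    have "cis (of_int n * (2 * pi)) = 1" by (metis cis_multiple_2pi Ints_of_int mult.commute)
    then show ?thesis by simp
  qed
  finally show ?thesis using False by simp
qed

text \<open>
  The factor \<open>\<xi> - \<xi>\<^sup>-\<^sup>1\<close> vanishes at two points of the circle only, so one can divide by it almost
  everywhere.
\<close>

lemma AE_circle_not_real: "AE \<xi> in circle_measure. \<xi> \<noteq> inverse \<xi>"
proof -
  have sq: "\<xi> = inverse \<xi> \<longleftrightarrow> \<xi> = 1 \<or> \<xi> = -1" if "cmod \<xi> = 1" for \<xi>
  proof -
    have "\<xi> \<noteq> 0" using that by auto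
    then have "\<xi> = inverse \<xi> \<longleftrightarrow> \<xi>\<^sup>2 = 1" by (simp add: field_simps power2_eq_square)
    then show ?thesis by (simp add: power2_eq_1_iff)
  qed
  have s: "{\<xi> \<in> space (restrict_space borel (sphere 0 1)). \<xi> \<noteq> inverse \<xi>} \<in> sets (restrict_space borel
      (sphere (0::complex) 1))"
  proof -
    have "{\<xi> \<in> space (restrict_space borel (sphere 0 1)). \<xi> \<noteq> inverse \<xi>} = sphere 0 1 \<inter> (- {1, -1 :: complex})"
    proof (rule set_eqI)
      fix \<xi> :: complex
      show "\<xi> \<in> {\<xi> \<in> space (restrict_space borel (sphere 0 1)). \<xi> \<noteq> inverse \<xi>} \<longleftrightarrow> \<xi> \<in> sphere 0 1 \<inter> (- {1, -1})"
        using sq[of \<xi>] by (cases "cmod \<xi> = 1") (simp_all add: space_restrict_space)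
    qed
    then show ?thesis by (auto simp: sets_restrict_space)
  qed
  have "AE t in lborel. t \<notin> range (\<lambda>i::int. of_int i * pi)"
    by (rule AE_not_in, rule countable_imp_null_set_lborel) auto
  then have "AE t in lborel. t \<in> {0..<2*pi} \<longrightarrow> cis t \<noteq> inverse (cis t)"
  proof eventually_elim
    case (elim t)
    then have "sin t \<noteq> 0" by (auto simp: sin_zero_iff_int2)
    then show ?case by (auto simp: complex_eq_iff)
  qed
  then show ?thesis unfolding circle_measure_def
    by (subst AE_distr_iff[OF cis_measurable_circle s], subst AE_restrict_space_iff) auto
qed

lemma norm_powi_circle: "cmod \<xi> = 1 \<Longrightarrow> cmod (\<xi> powi n) = 1"
  by (simp add: norm_power_int)

text \<open>
  The integers are enumerated in order to integrate the absolutely convergent series term by term.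
\<close>

lemma fourier_coefficient:
  fixes a :: "int \<Rightarrow> complex"
  assumes a: "(\<lambda>t. norm (a t)) summable_on UNIV"
  shows "(\<integral>\<xi>. (\<Sum>\<^sub>\<infinity>t. a t * \<xi> powi t) * \<xi> powi s \<partial>circle_measure) = 2 * pi * a (- s)"
proof -
  interpret finite_measure circle_measure by (rule finite_measure_circle)
  have bij: "bij_betw int_decode UNIV UNIV" by (rule bij_int_decode)
  define f where "f = (\<lambda>n \<xi>. a (int_decode n) * \<xi> powi (int_decode n + s))"
  have sa: "summable (\<lambda>n. norm (a (int_decode n)))"
    using summable_on_reindex_bij_betw[OF bij, of "\<lambda>t. norm (a t)"] a summable_on_imp_summable by metis
  have fn: "norm (f n \<xi>) = norm (a (int_decode n))" if "cmod \<xi> = 1" for n \<xi>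
    using norm_powi_circle[OF that] by (simp add: f_def norm_mult)
  have int: "integrable circle_measure (f n)" for n
  proof (rule integrable_const_bound[where B = "norm (a (int_decode n))"])
    show "AE \<xi> in circle_measure. norm (f n \<xi>) \<le> norm (a (int_decode n))"
      by (rule AE_I2) (simp add: fn space_circle)
    show "f n \<in> borel_measurable circle_measure"
      unfolding f_def by (rule measurable_circle) (auto intro!: continuous_intros)
  qed
  have eq: "(\<Sum>\<^sub>\<infinity>t. a t * \<xi> powi t) * \<xi> powi s = (\<Sum>n. f n \<xi>)" if "cmod \<xi> = 1" for \<xi>
  proof -
    have nz: "\<xi> \<noteq> 0" using that by auto
    have "(\<lambda>t. a t * \<xi> powi t) summable_on UNIV"
      by (rule abs_summable_summable) (use a that norm_powi_circle in \<open>simp add: norm_mult\<close>)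
    then have "((\<lambda>t. a t * \<xi> powi t) has_sum (\<Sum>\<^sub>\<infinity>t. a t * \<xi> powi t)) UNIV" by simp
    then have "((\<lambda>n. a (int_decode n) * \<xi> powi int_decode n) has_sum (\<Sum>\<^sub>\<infinity>t. a t * \<xi> powi t)) UNIV"
      using has_sum_reindex_bij_betw[OF bij, of "\<lambda>t. a t * \<xi> powi t"] by simp
    then have "(\<lambda>n. a (int_decode n) * \<xi> powi int_decode n) sums (\<Sum>\<^sub>\<infinity>t. a t * \<xi> powi t)"
        by (rule has_sum_imp_sums)
    then have "(\<lambda>n. a (int_decode n) * \<xi> powi int_decode n * \<xi> powi s) sums ((\<Sum>\<^sub>\<infinity>t. a t * \<xi> powi t) * \<xi> powi s)"
      by (rule sums_mult2)
    moreover have "a (int_decode n) * \<xi> powi int_decode n * \<xi> powi s = f n \<xi>" for n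
      using nz by (simp add: f_def power_int_add)
    ultimately show ?thesis by (simp add: sums_iff)
  qed
  have "(\<integral>\<xi>. (\<Sum>\<^sub>\<infinity>t. a t * \<xi> powi t) * \<xi> powi s \<partial>circle_measure) = (\<integral>\<xi>. (\<Sum>n. f n \<xi>) \<partial>circle_measure)"
    by (rule Bochner_Integration.integral_cong) (simp_all add: eq space_circle)
  also have "\<dots> = (\<Sum>n. \<integral>\<xi>. f n \<xi> \<partial>circle_measure)"
  proof (rule integral_suminf[OF int])
    show "AE \<xi> in circle_measure. summable (\<lambda>n. norm (f n \<xi>))"
      by (rule AE_I2) (use sa in \<open>simp add: fn space_circle\<close>)
    have "(\<integral>\<xi>. norm (f n \<xi>) \<partial>circle_measure) = (\<integral>\<xi>. norm (a (int_decode n)) \<partial>circle_measure)" for n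
      by (rule Bochner_Integration.integral_cong) (simp_all add: fn space_circle)
    then show "summable (\<lambda>n. \<integral>\<xi>. norm (f n \<xi>) \<partial>circle_measure)" using sa by (simp add: summable_mult)
  qed
  also have "\<dots> = (\<Sum>n. if n = int_encode (- s) then 2 * pi * a (- s) else 0)"
  proof (rule suminf_cong)
    fix n
    have "(\<integral>\<xi>. f n \<xi> \<partial>circle_measure) = a (int_decode n) * (if int_decode n + s = 0 then 2 * pi else 0)"
      unfolding f_def by (simp only: integral_mult_right_zero integral_circle_powi)
    moreover have "int_decode n + s = 0 \<longleftrightarrow> n = int_encode (- s)"
      by (metis add_eq_0_iff2 int_decode_inverse int_encode_inverse)
    ultimately show "(\<integral>\<xi>. f n \<xi> \<partial>circle_measure) = (if n = int_encode (- s) then 2 * pi * a (- s) else 0)"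
        by simp
  qed
  also have "\<dots> = 2 * pi * a (- s)"
    using sums_unique[OF sums_single[of "int_encode (- s)" "\<lambda>_. 2 * pi * a (- s)"]] by simp
  finally show ?thesis .
qed

context regular_tree begin

section \<open>The Helgason transform of finitely supported data\<close>

lemma infsum_finite_support:
  fixes f :: "'b \<Rightarrow> complex"
  assumes "finite A" "\<And>x. x \<notin> A \<Longrightarrow> f x = 0" shows "infsum f UNIV = sum f A"
  using infsum_cong_neutral[of A UNIV f f] assms by auto

lemma finite_support_adjop:
  assumes "finite {v. f v \<noteq> 0}" shows "finite {v. adjop f v \<noteq> 0}"
proof (rule finite_subset)
  show "{v. adjop f v \<noteq> 0} \<subseteq> (\<Union>w\<in>{v. f v \<noteq> 0}. {v. adj w v})"
  proof
    fix v assume "v \<in> {v. adjop f v \<noteq> 0}"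
    then have "(\<Sum>w | adj v w. f w) \<noteq> 0" by (simp add: adjop_def)
    then obtain w where "adj v w" "f w \<noteq> 0" by (metis (mono_tags, lifting) mem_Collect_eq sum.neutral)
    then show "v \<in> (\<Union>w\<in>{v. f v \<noteq> 0}. {v. adj w v})" using adj_sym by auto
  qed
  show "finite (\<Union>w\<in>{v. f v \<noteq> 0}. {v. adj w v})" using assms finite_nbrs by blast
qed

lemma adjop_symmetric:
  assumes "finite {v. f v \<noteq> 0}"
  shows "(\<Sum>\<^sub>\<infinity>x. adjop f x * g x) = (\<Sum>\<^sub>\<infinity>x. f x * adjop g x)"
proof -
  let ?A = "{v. f v \<noteq> 0}"
  define B where "B = (\<Union>w\<in>?A. {v. adj w v})"
  have B: "finite B" unfolding B_def using assms finite_nbrs by blast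
  have out: "adjop f x * g x = 0" if "x \<notin> B" for x
  proof -
    have "f w = 0" if "adj x w" for w using that \<open>x \<notin> B\<close> adj_sym unfolding B_def by blast
    then show ?thesis by (simp add: adjop_def)
  qed
  have "(\<Sum>\<^sub>\<infinity>x. adjop f x * g x) = (\<Sum>x\<in>B. adjop f x * g x)"
    by (rule infsum_finite_support[OF B out])
  also have "\<dots> = (\<Sum>x\<in>B. \<Sum>w\<in>?A. if adj x w then f w * g x else 0)"
  proof (rule sum.cong[OF refl])
    fix x
    have "adjop f x = (\<Sum>w | adj x w \<and> f w \<noteq> 0. f w)"
      unfolding adjop_def by (rule sum.mono_neutral_right) (use finite_nbrs in auto)
    also have "\<dots> = (\<Sum>w\<in>?A. if adj x w then f w else 0)"
      using assms by (subst sum.inter_filter[symmetric]) (auto intro!: sum.cong)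
    finally show "adjop f x * g x = (\<Sum>w\<in>?A. if adj x w then f w * g x else 0)"
      by (simp add: sum_distrib_right if_distrib[of "\<lambda>z. z * g x"] cong: if_cong)
  qed
  also have "\<dots> = (\<Sum>w\<in>?A. \<Sum>x\<in>B. if adj x w then f w * g x else 0)" by (rule sum.swap)
  also have "\<dots> = (\<Sum>w\<in>?A. f w * adjop g w)"
  proof (rule sum.cong[OF refl])
    fix w assume w: "w \<in> ?A"
    have "{x \<in> B. adj x w} = {x. adj w x}" using w adj_sym unfolding B_def by blast
    then have "adjop g w = (\<Sum>x\<in>B. if adj x w then g x else 0)"
      unfolding adjop_def using sum.inter_filter[OF B, of g "\<lambda>x. adj x w"] by simp
    then show "(\<Sum>x\<in>B. if adj x w then f w * g x else 0) = f w * adjop g w"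
      by (simp add: sum_distrib_left if_distrib[of "\<lambda>z. f w * z"] cong: if_cong)
  qed
  also have "\<dots> = (\<Sum>\<^sub>\<infinity>x. f x * adjop g x)"
    by (rule infsum_finite_support[symmetric]) (use assms in auto)
  finally show ?thesis .
qed

text \<open>
  One neighbour contributes the factor \<open>\<alpha>\<close> and the other \<open>q\<close> the factor \<open>\<alpha>\<^sup>-\<^sup>1\<close>.
\<close>

lemma horo_eigenfunction:
  assumes "\<omega> \<in> boundary" "\<xi> \<noteq> 0"
  shows "adjop (\<lambda>v. horo \<xi> v \<omega>) v = sqrt_q * (\<xi> + inverse \<xi>) * horo \<xi> v \<omega>"
proof -
  let ?s = "sqrt_q"
  define \<alpha> where "\<alpha> = ?s * \<xi>"
  have \<alpha>: "\<alpha> \<noteq> 0" using assms q_ge_2 by (auto simp: \<alpha>_def)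
  obtain w0 where w0: "adj v w0" "busemann \<omega> w0 = busemann \<omega> v + 1"
    "\<And>w. adj v w \<Longrightarrow> w \<noteq> w0 \<Longrightarrow> busemann \<omega> w = busemann \<omega> v - 1"
    using busemann_nbrs[OF assms(1), of v] by blast
  have hp: "horo \<xi> w \<omega> = \<alpha> powi busemann \<omega> w" for w by (simp only: horo_powi \<alpha>_def)
  have "adjop (\<lambda>v. horo \<xi> v \<omega>) v = horo \<xi> w0 \<omega> + of_nat q * (inverse \<alpha> * horo \<xi> v \<omega>)"
    unfolding adjop_def
  proof (rule sum_nbrs_split[OF w0(1)])
    fix w assume w: "adj v w" "w \<noteq> w0"
    show "horo \<xi> w \<omega> = inverse \<alpha> * horo \<xi> v \<omega>"
      unfolding hp w0(3)[OF w] using \<alpha> by (simp add: power_int_diff divide_inverse)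
  qed
  also have "horo \<xi> w0 \<omega> = \<alpha> * horo \<xi> v \<omega>" unfolding hp w0(2) using \<alpha> by (simp add: power_int_add)
  also have "\<alpha> * horo \<xi> v \<omega> + of_nat q * (inverse \<alpha> * horo \<xi> v \<omega>) = (\<alpha> + of_nat q * inverse \<alpha>) * horo \<xi> v \<omega>"
    by (simp add: algebra_simps)
  also have "of_nat q * inverse \<alpha> = ?s * inverse \<xi>"
  proof -
    have "of_nat q = ?s * ?s" by (simp flip: of_real_mult)
    then show ?thesis using q_ge_2 by (simp add: \<alpha>_def)
  qed
  finally show ?thesis by (simp add: \<alpha>_def algebra_simps)
qed

lemma fin_pairs_iff: "f \<in> fin_pairs \<longleftrightarrow> finite {v. fst f v \<noteq> 0} \<and> finite {v. snd f v \<noteq> 0}"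
  by (simp add: fin_pairs_def)

lemma helgason_sum:
  assumes "finite A" "\<And>x. x \<notin> A \<Longrightarrow> f x = 0"
  shows "helgason f \<xi> \<omega> = (\<Sum>x\<in>A. f x * horo \<xi> x \<omega>)"
  unfolding helgason_def by (rule infsum_finite_support) (use assms in auto)

lemma helgason_lin:
  assumes "finite {v. f v \<noteq> 0}" "finite {v. g v \<noteq> 0}"
  shows "helgason (\<lambda>v. a * f v + b * g v) \<xi> \<omega> = a * helgason f \<xi> \<omega> + b * helgason g \<xi> \<omega>"
proof -
  let ?A = "{v. f v \<noteq> 0} \<union> {v. g v \<noteq> 0}"
  have "helgason (\<lambda>v. a * f v + b * g v) \<xi> \<omega> = (\<Sum>x\<in>?A. (a * f x + b * g x) * horo \<xi> x \<omega>)"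
    by (rule helgason_sum) (use assms in auto)
  moreover have "helgason f \<xi> \<omega> = (\<Sum>x\<in>?A. f x * horo \<xi> x \<omega>)" by (rule helgason_sum) (use assms in auto)
  moreover have "helgason g \<xi> \<omega> = (\<Sum>x\<in>?A. g x * horo \<xi> x \<omega>)" by (rule helgason_sum) (use assms in auto)
  ultimately show ?thesis by (simp add: sum_distrib_left sum.distrib[symmetric] algebra_simps)
qed

lemma helgason_adjop:
  assumes "finite {v. f v \<noteq> 0}" "\<omega> \<in> boundary" "\<xi> \<noteq> 0"
  shows "helgason (adjop f) \<xi> \<omega> = sqrt_q * (\<xi> + inverse \<xi>) * helgason f \<xi> \<omega>"
proof -
  have "helgason (adjop f) \<xi> \<omega> = (\<Sum>\<^sub>\<infinity>x. f x * adjop (\<lambda>v. horo \<xi> v \<omega>) x)"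
    unfolding helgason_def by (rule adjop_symmetric[OF assms(1)])
  also have "\<dots> = (\<Sum>x | f x \<noteq> 0. f x * adjop (\<lambda>v. horo \<xi> v \<omega>) x)"
    by (rule infsum_finite_support) (use assms in auto)
  also have "\<dots> = sqrt_q * (\<xi> + inverse \<xi>) * (\<Sum>x | f x \<noteq> 0. f x * horo \<xi> x \<omega>)"
    unfolding horo_eigenfunction[OF assms(2,3)] by (simp add: sum_distrib_left algebra_simps)
  also have "(\<Sum>x | f x \<noteq> 0. f x * horo \<xi> x \<omega>) = helgason f \<xi> \<omega>"
    by (rule helgason_sum[symmetric]) (use assms in auto)
  finally show ?thesis .
qed

text \<open>
  The common part of \<open>T\<^sub>+\<close> and \<open>R\<^sub>+\<close>: both are multiples of this function by functions of \<open>\<xi>\<close>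
  alone. The factor in front of the transform of \<open>f\<^sub>1\<close> appears because the solution with data
  \<open>(f\<^sub>1, 0)\<close> is the central difference in time of the solution with data \<open>(0, f\<^sub>1)\<close>.
\<close>

definition wave_transform :: "('v \<Rightarrow> complex) \<times> ('v \<Rightarrow> complex) \<Rightarrow> complex \<Rightarrow> (nat \<Rightarrow> 'v) set \<Rightarrow> complex" where
  "wave_transform f \<xi> \<omega> = helgason (snd f) (inverse \<xi>) \<omega> - (\<xi> - inverse \<xi>) / 2 * helgason (fst f) (inverse \<xi>) \<omega>"

lemma wave_transform_sum:
  assumes "finite A" "\<And>x. x \<notin> A \<Longrightarrow> fst f x = 0" "\<And>x. x \<notin> A \<Longrightarrow> snd f x = 0"
  shows "wave_transform f \<xi> \<omega> = (\<Sum>x\<in>A. (snd f x - (\<xi> - inverse \<xi>) / 2 * fst f x) * horo (inverse \<xi>) x \<omega>)"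
  unfolding wave_transform_def
  by (subst (1 2) helgason_sum[OF assms(1)]) (use assms in \<open>simp_all add: sum_distrib_left sum_subtractf
      algebra_simps\<close>)

definition tau :: "complex \<Rightarrow> complex" where
  "tau \<xi> = (\<xi> - inverse \<xi>) / (inverse \<xi> - inverse (of_nat q) * \<xi>)"

lemma T_plus_fin_eq: "T_plus_fin f (\<xi>, \<omega>) = tau \<xi> * wave_transform f \<xi> \<omega>"
proof -
  have "inverse (c_fun (inverse \<xi>)) = - tau \<xi>"
    by (simp add: c_fun_def tau_def flip: minus_divide_left) (simp add: minus_divide_left)
  then show ?thesis
    by (simp add: T_plus_fin_def wave_transform_def algebra_simps add_divide_distrib diff_divide_distrib)
qed

section \<open>The fundamental solution of the wave equation\<close>

text \<open>
  The positive times at which the fundamental solution is nonzero at distance \<open>d\<close> from its centre.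
\<close>

definition pos_times :: "nat \<Rightarrow> int set" where "pos_times d = range (\<lambda>k. int (Suc (d + 2 * k)))"

text \<open>
  The value at distance \<open>d\<close> and time \<open>t\<close> of the solution with initial data \<open>(0, \<delta>)\<close>. At a time
  \<open>t \<ge> 1\<close> this solution is \<open>U\<^sub>t\<^sub>-\<^sub>1(A/2\<surd>q) \<delta>\<close> with the Chebyshev polynomial of the second kind,
  which has the parity of \<open>t - 1\<close>; hence it vanishes at the distances of the other parity.
\<close>

definition fund :: "nat \<Rightarrow> int \<Rightarrow> complex" where
  "fund d t = (if t \<in> pos_times d then inverse (sqrt_q ^ (nat t - 1))
     else if - t \<in> pos_times d then - inverse (sqrt_q ^ (nat (- t) - 1)) else 0)"

lemma fund_odd: "fund d (- t) = - fund d t"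
proof -
  have "\<not> (t \<in> pos_times d \<and> - t \<in> pos_times d)" by (auto simp: pos_times_def)
  then show ?thesis by (auto simp: fund_def)
qed

lemma fund_0: "fund d 0 = 0"
  using fund_odd[of d 0] by simp

lemma fund_1: "fund d 1 = (if d = 0 then 1 else 0)"
proof -
  have "1 \<in> pos_times d \<longleftrightarrow> d = 0" by (auto simp: pos_times_def intro: range_eqI[of _ _ 0])
  moreover have "- 1 \<notin> pos_times d" by (auto simp: pos_times_def)
  ultimately show ?thesis by (simp add: fund_def)
qed

lemma fund_pos: "fund d (int (Suc (d + 2 * k))) = inverse (sqrt_q ^ (d + 2 * k))"
proof -
  have "int (Suc (d + 2 * k)) \<in> pos_times d" by (auto simp: pos_times_def)
  then show ?thesis by (simp add: fund_def del: of_nat_Suc)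
qed

text \<open>
  The increments of time are two, so the series is geometric with ratio \<open>\<eta>\<^sup>2/q\<close>.
\<close>

lemma has_sum_geometric_steps:
  fixes \<eta> :: complex assumes "cmod \<eta> = 1"
  shows "((\<lambda>k. inverse (sqrt_q ^ (d + 2 * k)) * \<eta> ^ Suc (d + 2 * k)) has_sum
    (\<eta> ^ Suc d / (1 - \<eta>\<^sup>2 / of_nat q) / sqrt_q ^ d)) UNIV"
    "summable (\<lambda>k. cmod (inverse (sqrt_q ^ (d + 2 * k))))"
proof -
  let ?s = "sqrt_q"
  have s2: "?s ^ 2 = of_nat q" by (simp flip: of_real_power)
  have q1: "cmod (\<eta>\<^sup>2 / of_nat q) < 1" using assms q_ge_2 by (simp add: norm_divide norm_power)
  have e: "inverse (?s ^ (d + 2 * k)) * \<eta> ^ Suc (d + 2 * k) = \<eta> ^ Suc d / ?s ^ d * (\<eta>\<^sup>2 / of_nat q) ^ k" for k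
  proof -
    have "\<eta> ^ Suc (d + 2 * k) = \<eta> ^ Suc d * (\<eta>\<^sup>2) ^ k" "?s ^ (d + 2 * k) = ?s ^ d * of_nat q ^ k"
      by (simp_all only: s2[symmetric] power_add[symmetric] power_mult[symmetric] add_Suc)
    then show ?thesis
      by (simp only: power_mult_distrib power_inverse inverse_mult_distrib divide_inverse ac_simps)
  qed
  have n: "norm (\<eta> ^ Suc d / ?s ^ d * (\<eta>\<^sup>2 / of_nat q) ^ k)
      = cmod (\<eta> ^ Suc d / ?s ^ d) * cmod (\<eta>\<^sup>2 / of_nat q) ^ k" for k
    by (simp only: norm_mult[of "\<eta> ^ Suc d / ?s ^ d"] norm_power)
  have sn: "summable (\<lambda>k. norm (\<eta> ^ Suc d / ?s ^ d * (\<eta>\<^sup>2 / of_nat q) ^ k))"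
    unfolding n using q1 by (intro summable_mult summable_geometric) simp
  have "(\<lambda>k. \<eta> ^ Suc d / ?s ^ d * (\<eta>\<^sup>2 / of_nat q) ^ k) sums (\<eta> ^ Suc d / ?s ^ d * (1 / (1 - \<eta>\<^sup>2 / of_nat q)))"
    by (intro sums_mult geometric_sums q1)
  then have "((\<lambda>k. \<eta> ^ Suc d / ?s ^ d * (\<eta>\<^sup>2 / of_nat q) ^ k)
      has_sum (\<eta> ^ Suc d / ?s ^ d * (1 / (1 - \<eta>\<^sup>2 / of_nat q)))) UNIV"
    by (rule norm_summable_imp_has_sum[OF sn])
  then show "((\<lambda>k. inverse (?s ^ (d + 2 * k)) * \<eta> ^ Suc (d + 2 * k)) has_sum
    (\<eta> ^ Suc d / (1 - \<eta>\<^sup>2 / of_nat q) / ?s ^ d)) UNIV"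
    unfolding e by (simp add: mult.commute)
  have "norm (\<eta> ^ Suc d / ?s ^ d * (\<eta>\<^sup>2 / of_nat q) ^ k) = cmod (inverse (?s ^ (d + 2 * k)))" for k
    unfolding e[symmetric] using assms by (simp add: norm_mult norm_power)
  then show "summable (\<lambda>k. cmod (inverse (?s ^ (d + 2 * k))))" using sn by simp
qed

end

context regular_tree_measure begin

lemma inj_times: "inj (\<lambda>k. int (Suc (d + 2 * k)))" "inj (\<lambda>k. - int (Suc (d + 2 * k)))"
  by (auto simp: inj_on_def)

lemma fund_outside:
  assumes "t \<notin> range (\<lambda>k. int (Suc (d + 2 * k))) \<union> range (\<lambda>k. - int (Suc (d + 2 * k)))"
  shows "fund d t = 0"
proof -
  have "t \<notin> pos_times d" using assms by (simp add: pos_times_def)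
  moreover have "- t \<notin> pos_times d"
  proof
    assume "- t \<in> pos_times d"
    then obtain k where "- t = int (Suc (d + 2 * k))" unfolding pos_times_def by blast
    then have "t = - int (Suc (d + 2 * k))" by linarith
    then show False using assms by blast
  qed
  ultimately show ?thesis by (simp add: fund_def)
qed

text \<open>
  The positive times give the first term of \<open>wave_symbol\<close> and the negative times the second one.
\<close>

lemma fund_has_sum:
  assumes "cmod \<xi> = 1"
  shows "((\<lambda>t. fund d t * \<xi> powi t) has_sum wave_symbol d \<xi>) UNIV"
proof -
  let ?s = "sqrt_q"
  let ?p = "\<lambda>k. int (Suc (d + 2 * k))" and ?f = "\<lambda>t. fund d t * \<xi> powi t"
  have \<xi>: "cmod (inverse \<xi>) = 1" using assms by (simp add: norm_inverse)
  have "?f (?p k) = inverse (?s ^ (d + 2 * k)) * \<xi> ^ Suc (d + 2 * k)" for k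
    by (simp only: fund_pos power_int_of_nat)
  then have p: "(?f has_sum (\<xi> ^ Suc d / (1 - \<xi>\<^sup>2 / of_nat q) / ?s ^ d)) (range ?p)"
    using has_sum_geometric_steps(1)[OF assms, of d] by (subst has_sum_reindex[OF inj_times(1)]) (simp
        add: o_def)
  have "?f (- ?p k) = - (inverse (?s ^ (d + 2 * k)) * inverse \<xi> ^ Suc (d + 2 * k))" for k
    by (simp only: fund_odd fund_pos power_int_minus power_int_of_nat power_inverse mult_minus_left)
  then have n: "(?f has_sum (- (inverse \<xi> ^ Suc d / (1 - (inverse \<xi>)\<^sup>2 / of_nat q) / ?s ^ d))) (range (\<lambda>k.
      - ?p k))"
    using has_sum_geometric_steps(1)[OF \<xi>, of d]
    by (subst has_sum_reindex[OF inj_times(2)]) (simp add: o_def has_sum_uminus del: of_nat_Suc)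
  have "range ?p \<inter> range (\<lambda>k. - ?p k) = {}" by auto
  from has_sum_Un_disjoint[OF p n this]
  have "(?f has_sum wave_symbol d \<xi>) (range ?p \<union> range (\<lambda>k. - ?p k))"
    by (simp add: wave_symbol_def diff_divide_distrib)
  moreover have "?f t = 0" if "t \<notin> range ?p \<union> range (\<lambda>k. - ?p k)" for t
    using fund_outside[OF that] by simp
  ultimately show ?thesis by (subst has_sum_cong_neutral[where T = "range ?p \<union> range (\<lambda>k. - ?p k)"]) auto
qed

lemma fund_abs_summable: "(\<lambda>t. norm (fund d t)) summable_on UNIV"
proof -
  let ?p = "\<lambda>k. int (Suc (d + 2 * k))"
  have s: "(\<lambda>k. cmod (inverse (sqrt_q ^ (d + 2 * k)))) summable_on UNIV"
    using has_sum_geometric_steps(2)[of 1 d] by (intro norm_summable_imp_summable_on) simp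
  have p: "(\<lambda>t. norm (fund d t)) summable_on range ?p"
    using s by (subst summable_on_reindex[OF inj_times(1)]) (simp only: o_def fund_pos)
  have n: "(\<lambda>t. norm (fund d t)) summable_on range (\<lambda>k. - ?p k)"
    using s by (subst summable_on_reindex[OF inj_times(2)]) (simp only: o_def fund_odd fund_pos
        norm_minus_cancel)
  have "range ?p \<inter> range (\<lambda>k. - ?p k) = {}" by auto
  from summable_on_Un_disjoint[OF p n this]
  have "(\<lambda>t. norm (fund d t)) summable_on (range ?p \<union> range (\<lambda>k. - ?p k))" .
  moreover have "norm (fund d t) = 0" if "t \<notin> range ?p \<union> range (\<lambda>k. - ?p k)" for t
    using fund_outside[OF that] by simp
  moreover have "(\<lambda>t. norm (fund d t)) summable_on (range ?p \<union> range (\<lambda>k. - ?p k))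
      \<longleftrightarrow> (\<lambda>t. norm (fund d t)) summable_on UNIV"
    by (rule summable_on_cong_neutral) (use calculation(2) in blast)+
  ultimately show ?thesis by blast
qed

lemma continuous_wave_symbol: "continuous_on (sphere 0 1) (wave_symbol d)"
  unfolding wave_symbol_def
  using one_minus_square_ne one_minus_square_ne[of "inverse _"] q_ge_2
  by (intro continuous_intros) (auto simp: norm_inverse)

lemma fund_fourier:
  "(\<integral>\<xi>. wave_symbol d \<xi> * \<xi> powi s \<partial>circle_measure) = 2 * pi * fund d (- s)"
proof -
  have "(\<integral>\<xi>. wave_symbol d \<xi> * \<xi> powi s \<partial>circle_measure)
      = (\<integral>\<xi>. (\<Sum>\<^sub>\<infinity>t. fund d t * \<xi> powi t) * \<xi> powi s \<partial>circle_measure)"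
    by (rule Bochner_Integration.integral_cong) (simp_all add: space_circle infsumI[OF fund_has_sum])
  then show ?thesis using fourier_coefficient[OF fund_abs_summable] by simp
qed

lemma spherical_eigenfunction:
  assumes "\<xi> \<noteq> 0"
  shows "(\<Sum>w | adj v w. spherical \<xi> x w) = sqrt_q * (\<xi> + inverse \<xi>) * spherical \<xi> x v"
proof -
  have "(\<Sum>w | adj v w. spherical \<xi> x w) = (\<integral>\<omega>. (\<Sum>w | adj v w. horo (inverse \<xi>) x \<omega> * horo \<xi> w \<omega>) \<partial>\<nu>)"
    unfolding spherical_def by (rule Bochner_Integration.integral_sum[symmetric]) (rule integrable_horo2)
  also have "\<dots> = (\<integral>\<omega>. sqrt_q * (\<xi> + inverse \<xi>) * (horo (inverse \<xi>) x \<omega> * horo \<xi> v \<omega>) \<partial>\<nu>)"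
  proof (rule integral_boundary_cong)
    fix \<omega> assume \<omega>: "\<omega> \<in> boundary"
    show "(\<Sum>w | adj v w. horo (inverse \<xi>) x \<omega> * horo \<xi> w \<omega>)
        = sqrt_q * (\<xi> + inverse \<xi>) * (horo (inverse \<xi>) x \<omega> * horo \<xi> v \<omega>)"
      using horo_eigenfunction[OF \<omega> assms, of v] by (simp add: adjop_def flip: sum_distrib_left)
  qed
  finally show ?thesis by (simp add: spherical_def)
qed

text \<open>
  The symbol of the fundamental solution is a multiple of the spherical function, and this is an
  eigenfunction with eigenvalue \<open>\<surd>q (\<xi> + \<xi>\<^sup>-\<^sup>1)\<close>. Comparing Fourier coefficients gives the wave
  equation.
\<close>

lemma fund_wave_eq:
  "(\<Sum>w | adj v w. fund (tdist x w) t) = sqrt_q * (fund (tdist x v) (t + 1) + fund (tdist x v) (t - 1))"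
proof -
  interpret C: finite_measure circle_measure by (rule finite_measure_circle)
  let ?s = "sqrt_q"
  have int: "integrable circle_measure (\<lambda>\<xi>. c * (wave_symbol d \<xi> * \<xi> powi k))" for c d k
  proof -
    have c: "continuous_on (sphere 0 1) (\<lambda>\<xi>. c * (wave_symbol d \<xi> * \<xi> powi k))"
      using continuous_wave_symbol by (intro continuous_intros) auto
    then have "compact ((\<lambda>\<xi>. c * (wave_symbol d \<xi> * \<xi> powi k)) ` sphere 0 1)"
      by (rule compact_continuous_image) simp
    then obtain B where "\<And>\<xi>. \<xi> \<in> sphere 0 1 \<Longrightarrow> norm (c * (wave_symbol d \<xi> * \<xi> powi k)) \<le> B"
      using compact_imp_bounded bounded_iff by (metis (no_types, lifting) imageI)
    then show ?thesis
      by (intro C.integrable_const_bound[where B = B] measurable_circle[OF c] AE_I2) (simp add: space_circle)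
  qed
  have "2 * pi * (\<Sum>w | adj v w. fund (tdist x w) t) = (\<Sum>w | adj v w. \<integral>\<xi>. 1 * (wave_symbol (tdist x w) \<xi> *
      \<xi> powi (- t)) \<partial>circle_measure)"
    by (simp add: fund_fourier sum_distrib_left)
  also have "\<dots> = (\<integral>\<xi>. (\<Sum>w | adj v w. 1 * (wave_symbol (tdist x w) \<xi> * \<xi> powi (- t))) \<partial>circle_measure)"
    by (rule Bochner_Integration.integral_sum[symmetric]) (rule int)
  also have "\<dots> = (\<integral>\<xi>. ?s * (wave_symbol (tdist x v) \<xi> * \<xi> powi (1 - t)) + ?s * (wave_symbol (tdist x v) \<xi>
      * \<xi> powi (- 1 - t)) \<partial>circle_measure)"
  proof (rule Bochner_Integration.integral_cong[OF refl])
    fix \<xi> assume "\<xi> \<in> space circle_measure"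
    then have n: "cmod \<xi> = 1" and nz: "\<xi> \<noteq> 0" by (auto simp: space_circle)
    have "(\<Sum>w | adj v w. wave_symbol (tdist x w) \<xi>) = kappa \<xi> * (\<Sum>w | adj v w. spherical \<xi> x w)"
      by (simp add: kappa_spherical[OF n, symmetric] sum_distrib_left)
    also have "\<dots> = ?s * (\<xi> + inverse \<xi>) * wave_symbol (tdist x v) \<xi>"
      unfolding spherical_eigenfunction[OF nz] kappa_spherical[OF n, symmetric] by (simp add: algebra_simps)
    finally have "(\<Sum>w | adj v w. wave_symbol (tdist x w) \<xi> * \<xi> powi (- t))
        = ?s * (\<xi> + inverse \<xi>) * wave_symbol (tdist x v) \<xi> * \<xi> powi (- t)"
      by (simp flip: sum_distrib_right)
    moreover have "\<xi> powi (1 - t) = \<xi> * \<xi> powi (- t)" "\<xi> powi (- 1 - t) = inverse \<xi> * \<xi> powi (- t)"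
      using nz by (simp_all add: power_int_diff power_int_minus divide_inverse)
    ultimately show "(\<Sum>w | adj v w. 1 * (wave_symbol (tdist x w) \<xi> * \<xi> powi (- t))) =
      ?s * (wave_symbol (tdist x v) \<xi> * \<xi> powi (1 - t)) + ?s * (wave_symbol (tdist x v) \<xi> * \<xi> powi (- 1 - t))"
      by (simp add: algebra_simps)
  qed
  also have "\<dots> = ?s * (2 * pi * fund (tdist x v) (- (1 - t))) + ?s * (2 * pi * fund (tdist x v) (- (- 1 - t)))"
    by (subst Bochner_Integration.integral_add[OF int int]) (simp only: integral_mult_right_zero fund_fourier)
  also have "\<dots> = 2 * pi * (?s * (fund (tdist x v) (t + 1) + fund (tdist x v) (t - 1)))"
    by (simp add: algebra_simps)
  finally show ?thesis by simp
qed

end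

context regular_tree begin

section \<open>Solutions of the wave equation with finitely supported data\<close>

definition fin_supp :: "('v \<Rightarrow> complex) \<times> ('v \<Rightarrow> complex) \<Rightarrow> 'v set" where
  "fin_supp f = {v. fst f v \<noteq> 0} \<union> {v. snd f v \<noteq> 0}"

lemma finite_fin_supp: "f \<in> fin_pairs \<Longrightarrow> finite (fin_supp f)"
  by (simp add: fin_supp_def fin_pairs_iff)

text \<open>
  The solution with data \<open>(\<delta>, 0)\<close> is the central difference in time of the one with data \<open>(0, \<delta>)\<close>.
\<close>

definition wave_sol :: "('v \<Rightarrow> complex) \<times> ('v \<Rightarrow> complex) \<Rightarrow> 'v \<Rightarrow> int \<Rightarrow> complex" where
  "wave_sol f v t = (\<Sum>x\<in>fin_supp f. snd f x * fund (tdist x v) t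
      + fst f x * ((fund (tdist x v) (t + 1) - fund (tdist x v) (t - 1)) / 2))"

text \<open>
  The values at time zero and the wave equation determine \<open>u(\<cdot>,1) + u(\<cdot>,-1)\<close>, and the second
  initial condition determines \<open>u(\<cdot>,1) - u(\<cdot>,-1)\<close>; then one steps forwards and backwards in time.
\<close>

lemma wave_eq_unique:
  assumes "wave_eq u" "wave_eq w" "\<And>v. u v 0 = w v 0" "\<And>v. (u v 1 - u v (-1)) / 2 = (w v 1 - w v (-1)) / 2"
  shows "u = w"
proof -
  have step: "z v (t + 1) + z v (t - 1) = adjop (\<lambda>w. z w t) v / sqrt_q" if "wave_eq z" for z v t
    using that unfolding wave_eq_def by (simp add: field_simps)
  have s0: "u v 1 + u v (-1) = w v 1 + w v (-1)" for v
    using step[OF assms(1), of v 0] step[OF assms(2), of v 0] assms(3) by simp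
  have one: "u v 1 = w v 1" "u v (-1) = w v (-1)" for v
  proof -
    have "u v 1 - u v (-1) = w v 1 - w v (-1)" using assms(4)[of v] unfolding divide_cancel_right by simp
    then have "2 * u v 1 = 2 * w v 1" using s0[of v] by algebra
    then show "u v 1 = w v 1" by simp
    then show "u v (-1) = w v (-1)" using s0[of v] by simp
  qed
  have pos: "u v (int n) = w v (int n) \<and> u v (int (Suc n)) = w v (int (Suc n))" for n v
  proof (induction n arbitrary: v)
    case (Suc n)
    have "u v (int (Suc n) + 1) + u v (int (Suc n) - 1) = w v (int (Suc n) + 1) + w v (int (Suc n) - 1)"
      unfolding step[OF assms(1)] step[OF assms(2)] using Suc by simp
    then show ?case using Suc[of v] by (simp add: add.commute)
  qed (use assms(3) one in simp)
  have neg: "u v (- int n) = w v (- int n) \<and> u v (- int (Suc n)) = w v (- int (Suc n))" for n v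
  proof (induction n arbitrary: v)
    case (Suc n)
    have "u v (- int (Suc n) + 1) + u v (- int (Suc n) - 1) = w v (- int (Suc n) + 1) + w v (- int (Suc n) - 1)"
      unfolding step[OF assms(1)] step[OF assms(2)] using Suc by simp
    then show ?case using Suc[of v] by (simp add: algebra_simps)
  qed (use assms(3) one in simp)
  show "u = w"
  proof (intro ext)
    fix v t show "u v t = w v t"
      using pos[of v "nat t"] neg[of v "nat (- t)"] by (cases "t \<ge> 0") auto
  qed
qed

end

context regular_tree_measure begin

lemma wave_sol_wave_eq: "wave_eq (wave_sol f)"
  unfolding wave_eq_def
proof (intro allI)
  fix v t
  let ?s = "sqrt_q"
  have s: "?s \<noteq> 0" using q_ge_2 by simp
  have "adjop (\<lambda>w. wave_sol f w t) v = (\<Sum>x\<in>fin_supp f. snd f x * (\<Sum>w | adj v w. fund (tdist x w) t)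
      + fst f x * (((\<Sum>w | adj v w. fund (tdist x w) (t + 1)) - (\<Sum>w | adj v w. fund (tdist x w) (t - 1))) / 2))"
    unfolding adjop_def wave_sol_def
    by (subst sum.swap) (simp add: sum.distrib sum_distrib_left sum_subtractf sum_divide_distrib
        right_diff_distrib diff_divide_distrib)
  also have "\<dots> = ?s * (wave_sol f v (t + 1) + wave_sol f v (t - 1))"
    unfolding fund_wave_eq wave_sol_def sum.distrib[symmetric] sum_distrib_left
    by (rule sum.cong) (simp_all add: algebra_simps add_divide_distrib diff_divide_distrib)
  finally show "adjop (\<lambda>w. wave_sol f w t) v / (2 * ?s) = (wave_sol f v (t + 1) + wave_sol f v (t - 1)) / 2"
    using s by simp
qed

lemma wave_sol_initial:
  assumes "f \<in> fin_pairs"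
  shows "wave_sol f v 0 = fst f v" "(wave_sol f v 1 - wave_sol f v (-1)) / 2 = snd f v"
proof -
  have f1: "fund d (- 1) = - fund d 1" "fund d (- 2) = - fund d 2" for d using fund_odd by blast+
  have "wave_sol f v 0 = (\<Sum>x\<in>fin_supp f. if x = v then fst f x else 0)"
    unfolding wave_sol_def by (rule sum.cong) (simp_all add: fund_0 f1 fund_1)
  also have "\<dots> = fst f v" using finite_fin_supp[OF assms] by (simp add: fin_supp_def)
  finally show "wave_sol f v 0 = fst f v" .
  have "(wave_sol f v 1 - wave_sol f v (-1)) / 2 = (\<Sum>x\<in>fin_supp f. if x = v then snd f x else 0)"
    unfolding wave_sol_def sum_subtractf[symmetric] sum_divide_distrib
    by (rule sum.cong) (simp_all add: fund_0 f1 fund_1)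
  also have "\<dots> = snd f v" using finite_fin_supp[OF assms] by (simp add: fin_supp_def)
  finally show "(wave_sol f v 1 - wave_sol f v (-1)) / 2 = snd f v" .
qed

lemma wave_fin_eq: assumes "f \<in> fin_pairs" shows "wave_fin f = wave_sol f"
  unfolding wave_fin_def
proof (rule the_equality)
  show "wave_eq (wave_sol f) \<and> (\<forall>v. wave_sol f v 0 = fst f v) \<and> (\<forall>v. (wave_sol f v 1 - wave_sol f v (- 1))
      / 2 = snd f v)"
    using wave_sol_wave_eq wave_sol_initial[OF assms] by simp
  fix u assume "wave_eq u \<and> (\<forall>v. u v 0 = fst f v) \<and> (\<forall>v. (u v 1 - u v (- 1)) / 2 = snd f v)"
  then show "u = wave_sol f"
    using wave_eq_unique[of u "wave_sol f"] wave_sol_wave_eq[of f] wave_sol_initial[OF assms] by simp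
qed

lemma has_sum_finite_sum:
  fixes f :: "'i \<Rightarrow> 'a \<Rightarrow> 'b::topological_comm_monoid_add"
  assumes "\<And>i. i \<in> I \<Longrightarrow> (f i has_sum S i) A"
  shows "((\<lambda>t. \<Sum>i\<in>I. f i t) has_sum (\<Sum>i\<in>I. S i)) A"
  using assms by (induction I rule: infinite_finite_induct) (auto intro: has_sum_add)

lemma bij_int_shift: "bij_betw (\<lambda>t::int. t + k) UNIV UNIV"
  by (rule bij_betwI[of _ _ _ "\<lambda>t. t - k"]) auto

lemma fund_shift_abs_summable: "(\<lambda>t. norm (fund d (t + k))) summable_on UNIV"
  using summable_on_reindex_bij_betw[OF bij_int_shift[of k], of "\<lambda>t. norm (fund d t)"] fund_abs_summable by simp

lemma fund_shift_has_sum: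
  assumes "cmod \<xi> = 1"
  shows "((\<lambda>t. fund d (t + k) * \<xi> powi t) has_sum wave_symbol d \<xi> * \<xi> powi (- k)) UNIV"
proof -
  have nz: "\<xi> \<noteq> 0" using assms by auto
  have "((\<lambda>t. fund d (t + k) * \<xi> powi (t + k)) has_sum wave_symbol d \<xi>) UNIV"
    using has_sum_reindex_bij_betw[OF bij_int_shift[of k], of "\<lambda>t. fund d t * \<xi> powi t"] fund_has_sum[OF
        assms, of d] by simp
  then have "((\<lambda>t. fund d (t + k) * \<xi> powi (t + k) * \<xi> powi (- k)) has_sum wave_symbol d \<xi> * \<xi> powi (- k)) UNIV"
    by (rule has_sum_cmult_left)
  moreover have "fund d (t + k) * \<xi> powi (t + k) * \<xi> powi (- k) = fund d (t + k) * \<xi> powi t" for t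
    using nz by (simp add: power_int_add power_int_minus)
  ultimately show ?thesis by simp
qed

lemma wave_sol_abs_summable: "(\<lambda>t. norm (wave_sol f v t)) summable_on UNIV"
proof -
  let ?g = "\<lambda>x t. norm (snd f x) * norm (fund (tdist x v) t)
      + (norm (fst f x) / 2 * norm (fund (tdist x v) (t + 1)) + norm (fst f x) / 2 * norm (fund (tdist x
          v) (t + -1)))"
  have "(\<lambda>t. \<Sum>x\<in>fin_supp f. ?g x t) summable_on UNIV"
  proof -
    have "(\<lambda>t. ?g x t) summable_on UNIV" for x
      by (intro summable_on_add summable_on_cmult_right fund_abs_summable fund_shift_abs_summable)
    then have "((\<lambda>t. \<Sum>x\<in>fin_supp f. ?g x t) has_sum (\<Sum>x\<in>fin_supp f. infsum (?g x) UNIV)) UNIV"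
      by (intro has_sum_finite_sum has_sum_infsum)
    then show ?thesis by (rule has_sum_imp_summable)
  qed
  then show ?thesis
  proof (rule summable_on_comparison_test)
    fix t :: int
    show "norm (wave_sol f v t) \<le> (\<Sum>x\<in>fin_supp f. ?g x t)"
      unfolding wave_sol_def
    proof (rule order_trans[OF norm_sum sum_mono])
      fix x
      have "norm (snd f x * fund (tdist x v) t + fst f x * ((fund (tdist x v) (t + 1) - fund (tdist x v)
          (t - 1)) / 2))
        \<le> norm (snd f x) * norm (fund (tdist x v) t) + norm (fst f x) * (norm (fund (tdist x v) (t + 1) -
            fund (tdist x v) (t - 1)) / 2)"
        by (rule order_trans[OF norm_triangle_ineq]) (simp add: norm_mult norm_divide)
      also have "\<dots> \<le> norm (snd f x) * norm (fund (tdist x v) t) + norm (fst f x) * ((norm (fund (tdist x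
          v) (t + 1)) + norm (fund (tdist x v) (t - 1))) / 2)"
        using norm_triangle_ineq4[of "fund (tdist x v) (t + 1)" "fund (tdist x v) (t - 1)"]
        by (intro add_mono mult_left_mono divide_right_mono order_refl) auto
      also have "\<dots> = ?g x t" by (simp add: algebra_simps add_divide_distrib)
      finally show "norm (snd f x * fund (tdist x v) t + fst f x * ((fund (tdist x v) (t + 1) - fund
          (tdist x v) (t - 1)) / 2)) \<le> ?g x t" .
    qed
  qed simp
qed

text \<open>
  A shift of time multiplies the Fourier series by a power of \<open>\<xi>\<close>, so the central difference in
  time yields the factor \<open>-(\<xi> - \<xi>\<^sup>-\<^sup>1)/2\<close>.
\<close>

lemma wave_sol_has_sum:
  assumes "cmod \<xi> = 1"
  shows "((\<lambda>t. wave_sol f v t * \<xi> powi t) has_sum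
     (\<Sum>x\<in>fin_supp f. (snd f x - (\<xi> - inverse \<xi>) / 2 * fst f x) * wave_symbol (tdist x v) \<xi>)) UNIV"
proof -
  have e: "wave_sol f v t * \<xi> powi t = (\<Sum>x\<in>fin_supp f. snd f x * (fund (tdist x v) t * \<xi> powi t)
      + (fst f x / 2 * (fund (tdist x v) (t + 1) * \<xi> powi t) + - (fst f x / 2) * (fund (tdist x v) (t +
          -1) * \<xi> powi t)))" for t
    unfolding wave_sol_def sum_distrib_right
    by (rule sum.cong) (simp_all add: algebra_simps diff_divide_distrib)
  have "((\<lambda>t. \<Sum>x\<in>fin_supp f. snd f x * (fund (tdist x v) t * \<xi> powi t)
      + (fst f x / 2 * (fund (tdist x v) (t + 1) * \<xi> powi t) + - (fst f x / 2) * (fund (tdist x v) (t +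
          -1) * \<xi> powi t)))
    has_sum (\<Sum>x\<in>fin_supp f. snd f x * wave_symbol (tdist x v) \<xi>
      + (fst f x / 2 * (wave_symbol (tdist x v) \<xi> * \<xi> powi (- 1)) + - (fst f x / 2) * (wave_symbol (tdist
          x v) \<xi> * \<xi> powi (- (-1)))))) UNIV"
    by (intro has_sum_finite_sum has_sum_add has_sum_cmult_right fund_has_sum fund_shift_has_sum assms)
  moreover have "(\<Sum>x\<in>fin_supp f. snd f x * wave_symbol (tdist x v) \<xi>
      + (fst f x / 2 * (wave_symbol (tdist x v) \<xi> * \<xi> powi (- 1)) + - (fst f x / 2) * (wave_symbol (tdist
          x v) \<xi> * \<xi> powi (- (-1)))))
     = (\<Sum>x\<in>fin_supp f. (snd f x - (\<xi> - inverse \<xi>) / 2 * fst f x) * wave_symbol (tdist x v) \<xi>)"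
    by (rule sum.cong) (simp_all add: power_int_minus algebra_simps diff_divide_distrib add_divide_distrib)
  ultimately show ?thesis unfolding e by simp
qed

section \<open>The map \<open>R\<^sub>+\<close> on finitely supported data\<close>

definition R_plus_fin :: "('v \<Rightarrow> complex) \<times> ('v \<Rightarrow> complex) \<Rightarrow> complex \<times> (nat \<Rightarrow> 'v) set \<Rightarrow> complex" where
  "R_plus_fin f = (\<lambda>(\<xi>, \<omega>). kappa \<xi> * wave_transform f \<xi> \<omega>)"

lemma wave_transform_fin_supp:
  assumes "f \<in> fin_pairs"
  shows "wave_transform f \<xi> \<omega> = (\<Sum>x\<in>fin_supp f. (snd f x - (\<xi> - inverse \<xi>) / 2 * fst f x) * horo (inverse
      \<xi>) x \<omega>)"
  by (rule wave_transform_sum) (use finite_fin_supp[OF assms] in \<open>auto simp: fin_supp_def\<close>)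

lemma integrable_horo_mult: "integrable \<nu> (\<lambda>\<omega>. c * horo \<eta> x \<omega>)"
  by (rule integrable_level_const[OF level_const_map[OF level_const_horo, where g = "\<lambda>z. c * z"]])

lemma integrable_horo2_mult: "integrable \<nu> (\<lambda>\<omega>. c * (horo \<eta> x \<omega> * horo \<xi> v \<omega>))"
  using integrable_horo2 by (rule integrable_mult_right)

lemma R_plus_fin_integrable: assumes "f \<in> fin_pairs" shows "integrable \<nu> (\<lambda>\<omega>. R_plus_fin f (\<xi>, \<omega>))"
  unfolding R_plus_fin_def prod.case wave_transform_fin_supp[OF assms]
  by (intro integrable_mult_right Bochner_Integration.integrable_sum integrable_horo_mult)

text \<open>
  The Fourier series of the solution is a Poisson transform: each \<open>wave_symbol\<close> is \<open>kappa\<close> times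
  an integral over the boundary.
\<close>

lemma wave_hat_eq_integral:
  assumes "f \<in> fin_pairs" "cmod \<xi> = 1"
  shows "wave_hat f \<xi> v = (\<integral>\<omega>. horo \<xi> v \<omega> * R_plus_fin f (\<xi>, \<omega>) \<partial>\<nu>)"
proof -
  have "wave_hat f \<xi> v = (\<Sum>x\<in>fin_supp f. (snd f x - (\<xi> - inverse \<xi>) / 2 * fst f x) * wave_symbol (tdist x v) \<xi>)"
    unfolding wave_hat_def wave_fin_eq[OF assms(1)] by (rule infsumI[OF wave_sol_has_sum[OF assms(2)]])
  also have "\<dots> = (\<Sum>x\<in>fin_supp f. \<integral>\<omega>. (kappa \<xi> * (snd f x - (\<xi> - inverse \<xi>) / 2 * fst f x)) * (horo
      (inverse \<xi>) x \<omega> * horo \<xi> v \<omega>) \<partial>\<nu>)"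
    unfolding kappa_spherical[OF assms(2), symmetric] spherical_def integral_mult_right_zero
    by (simp add: mult.assoc mult.left_commute)
  also have "\<dots> = (\<integral>\<omega>. (\<Sum>x\<in>fin_supp f. (kappa \<xi> * (snd f x - (\<xi> - inverse \<xi>) / 2 * fst f x)) * (horo
      (inverse \<xi>) x \<omega> * horo \<xi> v \<omega>)) \<partial>\<nu>)"
    by (rule Bochner_Integration.integral_sum[symmetric]) (rule integrable_horo2_mult)
  also have "\<dots> = (\<integral>\<omega>. horo \<xi> v \<omega> * R_plus_fin f (\<xi>, \<omega>) \<partial>\<nu>)"
    unfolding R_plus_fin_def prod.case wave_transform_fin_supp[OF assms(1)] sum_distrib_left
    by (simp add: mult.assoc mult.left_commute mult.commute)
  finally show ?thesis .
qed

lemma integrable_level_const_mult: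
  assumes "integrable \<nu> g" "level_const N \<phi>" shows "integrable \<nu> (\<lambda>\<omega>. \<phi> \<omega> * g \<omega> :: complex)"
proof -
  have "finite (\<phi> ` boundary)" by (rule level_const_finite_image[OF assms(2)])
  then obtain B where "\<And>\<omega>. \<omega> \<in> boundary \<Longrightarrow> cmod (\<phi> \<omega>) \<le> B"
    using finite_imp_bounded[of "\<phi> ` boundary"] unfolding bounded_iff by blast
  then have B: "cmod (\<phi> \<omega> * g \<omega>) \<le> norm (of_real B * g \<omega>)" if "\<omega> \<in> boundary" for \<omega>
    using that by (simp add: norm_mult) (meson abs_ge_self mult_right_mono norm_ge_zero order_trans)
  have m: "\<phi> \<in> borel_measurable \<nu>" using measurable_level_const[OF assms(2)] by simp
  show ?thesis
  proof (rule Bochner_Integration.integrable_bound)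
    show "integrable \<nu> (\<lambda>\<omega>. of_real B * g \<omega>)" using assms(1) by simp
    show "(\<lambda>\<omega>. \<phi> \<omega> * g \<omega>) \<in> borel_measurable \<nu>" using m assms(1) by auto
    show "AE \<omega> in \<nu>. norm (\<phi> \<omega> * g \<omega>) \<le> norm (of_real B * g \<omega>)" using B by (intro AE_I2) (simp add: space_nu)
  qed
qed

lemma integrable_test_mult:
  "integrable \<nu> g \<Longrightarrow> \<phi> \<in> test_functions \<Longrightarrow> integrable \<nu> (\<lambda>\<omega>. \<phi> \<omega> * g \<omega>)"
  using test_function_level_const integrable_level_const_mult by blast

lemma density_functional_apply:
  assumes "level_const N F"
  shows "density_functional g (\<lambda>\<omega>\<in>boundary. F \<omega>) = (\<integral>\<omega>. F \<omega> * g \<omega> \<partial>\<nu>)"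
  unfolding density_functional_def restrict_apply'[OF test_functionI[OF assms]]
  by (rule integral_boundary_cong) simp

lemma density_functional_fin_add:
  assumes g: "integrable \<nu> g" shows "density_functional g \<in> fin_add_measures"
  unfolding fin_add_measures_def
proof (intro CollectI conjI ballI allI)
  show "density_functional g \<in> extensional test_functions" by (simp add: density_functional_def)
  fix \<phi> assume p: "\<phi> \<in> test_functions"
  obtain N where N: "level_const N \<phi>" using test_function_level_const[OF p] by blast
  have dp: "density_functional g \<phi> = (\<integral>\<omega>. \<phi> \<omega> * g \<omega> \<partial>\<nu>)" using p by (simp add: density_functional_def)
  { fix \<psi> assume q: "\<psi> \<in> test_functions"
    obtain M where M: "level_const M \<psi>" using test_function_level_const[OF q] by blast
    have dq: "density_functional g \<psi> = (\<integral>\<omega>. \<psi> \<omega> * g \<omega> \<partial>\<nu>)" using q by (simp add: density_functional_def)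
    have "density_functional g (\<lambda>\<omega>\<in>boundary. \<phi> \<omega> + \<psi> \<omega>) = (\<integral>\<omega>. (\<phi> \<omega> + \<psi> \<omega>) * g \<omega> \<partial>\<nu>)"
      by (rule density_functional_apply[OF level_const_map2[OF N M]])
    also have "\<dots> = density_functional g \<phi> + density_functional g \<psi>"
      unfolding dp dq distrib_right
      by (rule Bochner_Integration.integral_add[OF integrable_test_mult[OF g p] integrable_test_mult[OF g q]])
    finally show "density_functional g (\<lambda>\<omega>\<in>boundary. \<phi> \<omega> + \<psi> \<omega>)
        = density_functional g \<phi> + density_functional g \<psi>" . }
  fix a
  have "density_functional g (\<lambda>\<omega>\<in>boundary. a * \<phi> \<omega>) = (\<integral>\<omega>. (a * \<phi> \<omega>) * g \<omega> \<partial>\<nu>)"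
    by (rule density_functional_apply[OF level_const_map[OF N]])
  then show "density_functional g (\<lambda>\<omega>\<in>boundary. a * \<phi> \<omega>) = a * density_functional g \<phi>"
    unfolding dp mult.assoc by simp
qed

lemma poisson_density:
  "poisson \<xi> (density_functional g) v = (\<integral>\<omega>. horo \<xi> v \<omega> * g \<omega> \<partial>\<nu>)"
  unfolding poisson_def by (rule density_functional_apply[OF level_const_horo])

lemma R_plus_fin_correct:
  assumes "f \<in> fin_pairs" shows "is_R_plus_fin f (R_plus_fin f)"
  unfolding is_R_plus_fin_def
proof (intro ballI conjI allI)
  fix \<xi> :: complex assume "\<xi> \<in> sphere 0 1"
  then have \<xi>: "cmod \<xi> = 1" by simp
  show "(\<lambda>t. wave_fin f v t * \<xi> powi t) summable_on UNIV" for v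
    unfolding wave_fin_eq[OF assms] using wave_sol_has_sum[OF \<xi>] summable_on_def by blast
  show inj: "inj_on (poisson \<xi>) fin_add_measures" by (rule poisson_inj[OF \<xi>])
  show int: "integrable \<nu> (\<lambda>\<omega>. R_plus_fin f (\<xi>, \<omega>))" by (rule R_plus_fin_integrable[OF assms])
  let ?D = "density_functional (\<lambda>\<omega>. R_plus_fin f (\<xi>, \<omega>))"
  have D: "?D \<in> fin_add_measures" by (rule density_functional_fin_add[OF int])
  have e: "wave_hat f \<xi> = poisson \<xi> ?D"
    by (rule ext) (simp only: poisson_density wave_hat_eq_integral[OF assms \<xi>])
  show "wave_hat f \<xi> \<in> poisson \<xi> ` fin_add_measures" unfolding e using D by (rule imageI)
  show "the_inv_into fin_add_measures (poisson \<xi>) (wave_hat f \<xi>) = ?D"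
    unfolding e by (rule the_inv_into_f_f[OF inj D])
qed

lemma sets_nu_shadows: "sets \<nu> = sigma_sets boundary (insert {} (range shadow))"
proof
  have "sigma_sets boundary {U. openin boundary_top U} \<subseteq> sigma_sets boundary (insert {} (range shadow))"
  proof (rule sigma_sets_mono, rule subsetI)
    fix U assume "U \<in> {U. openin boundary_top U}"
    then have U: "openin boundary_top U" by simp
    have Un: "U = (\<Union>v\<in>{v. shadow v \<subseteq> U}. shadow v)"
    proof
      show "U \<subseteq> (\<Union>v\<in>{v. shadow v \<subseteq> U}. shadow v)"
      proof
        fix \<omega> assume \<omega>: "\<omega> \<in> U"
        then have "\<omega> \<in> boundary" using openin_subset[OF U] topspace_boundary_top by blast
        then show "\<omega> \<in> (\<Union>v\<in>{v. shadow v \<subseteq> U}. shadow v)"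
          using openin_contains_shadow[OF U \<omega>] in_shadow_geod by blast
      qed
    qed blast
    have "(\<Union>v\<in>{v. shadow v \<subseteq> U}. shadow v) \<in> sigma_sets boundary (insert {} (range shadow))"
    proof (rule sigma_sets_UNION)
      show "countable (shadow ` {v. shadow v \<subseteq> U})"
        by (rule countable_image, rule countable_subset[OF subset_UNIV countable_vertices])
      fix b assume "b \<in> shadow ` {v. shadow v \<subseteq> U}"
      then have "b \<in> insert {} (range shadow)" by auto
      then show "b \<in> sigma_sets boundary (insert {} (range shadow))" by (rule sigma_sets.Basic)
    qed
    then show "U \<in> sigma_sets boundary (insert {} (range shadow))" by (simp only: Un[symmetric])
  qed
  then show "sets \<nu> \<subseteq> sigma_sets boundary (insert {} (range shadow))" by (simp add: sets_nu)
  show "sigma_sets boundary (insert {} (range shadow)) \<subseteq> sets \<nu>"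
    unfolding sets_nu
  proof (rule sigma_sets_mono, rule subsetI)
    fix A assume "A \<in> insert {} (range shadow)"
    then have "A \<in> {U. openin boundary_top U}" using openin_shadow by auto
    then show "A \<in> sigma_sets boundary {U. openin boundary_top U}" by (rule sigma_sets.Basic)
  qed
qed

lemma Int_stable_shadows: "Int_stable (insert {} (range shadow))"
proof -
  have "shadow v \<inter> shadow w = {} \<or> shadow v \<inter> shadow w = shadow v \<or> shadow v \<inter> shadow w = shadow w" for v w
  proof (cases "shadow v \<inter> shadow w = {}")
    case False
    then obtain \<omega> where \<omega>: "\<omega> \<in> boundary" "geod \<omega> (tdist x0 v) = v" "geod \<omega> (tdist x0 w) = w"
      by (auto simp: shadow_iff_geod)
    show ?thesis
      using shadow_decreasing[OF \<omega>(1), of "tdist x0 v" "tdist x0 w"] shadow_decreasing[OF \<omega>(1), of "tdist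
          x0 w" "tdist x0 v"] \<omega>(2,3)
      by (cases "tdist x0 v \<le> tdist x0 w") auto
  qed simp
  then have "shadow v \<inter> shadow w \<in> insert {} (range shadow)" for v w by (metis insertCI rangeI)
  then show ?thesis unfolding Int_stable_def by auto
qed

text \<open>
  Shadows are test functions, form a class stable under intersection and generate the Borel sets.
\<close>

lemma density_functional_inj_AE:
  assumes g: "integrable \<nu> g" and h: "integrable \<nu> h" and eq: "density_functional g = density_functional h"
  shows "AE \<omega> in \<nu>. g \<omega> = h \<omega>"
proof -
  interpret N: finite_measure \<nu> by (rule finite_measure_nu)
  have i: "integrable \<nu> (\<lambda>\<omega>. indicator A \<omega> *\<^sub>R k \<omega>)" if "A \<in> sets \<nu>" "integrable \<nu> k"
      for A and k :: "_ \<Rightarrow> complex"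
    using integrable_mult_indicator[OF that] .
  define D where "D = (\<lambda>A. set_lebesgue_integral \<nu> A g - set_lebesgue_integral \<nu> A h)"
  have Dsh: "D (shadow v) = 0" for v
  proof -
    have "set_lebesgue_integral \<nu> (shadow v) k = density_functional k (\<lambda>\<omega>\<in>boundary. shadow_ind v \<omega>)" for k
      unfolding density_functional_apply[OF level_const_shadow_ind] set_lebesgue_integral_def
      by (rule integral_boundary_cong) (simp add: indicator_def)
    then show ?thesis by (simp add: D_def eq)
  qed
  have shp: "insert {} (range shadow) \<subseteq> Pow boundary" by (auto simp: shadow_def)
  have "D A = 0" if "A \<in> sigma_sets boundary (insert {} (range shadow))" for A
    using that
  proof (induction rule: sigma_sets_induct_disjoint[OF Int_stable_shadows shp, consumes 1, case_names
      basic empty compl union])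
    case (compl A)
    then have A: "A \<in> sets \<nu>" by (simp add: sets_nu_shadows)
    have e: "set_lebesgue_integral \<nu> (boundary - A) k = set_lebesgue_integral \<nu> boundary k -
        set_lebesgue_integral \<nu> A k" if "integrable \<nu> k" for k :: "_ \<Rightarrow> complex"
    proof -
      have bs: "boundary \<in> sets \<nu>" using sets.top[of \<nu>] by (simp add: space_nu)
      have AB: "A \<subseteq> boundary" using sets.sets_into_space[OF A] by (simp add: space_nu)
      have "set_lebesgue_integral \<nu> (boundary - A) k = (\<integral>\<omega>. indicator boundary \<omega> *\<^sub>R k \<omega> - indicator A \<omega>
          *\<^sub>R k \<omega> \<partial>\<nu>)"
        unfolding set_lebesgue_integral_def
        by (intro Bochner_Integration.integral_cong) (use AB in \<open>auto simp: indicator_def\<close>)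
      then show ?thesis unfolding set_lebesgue_integral_def using i[OF bs that] i[OF A that] by simp
    qed
    have "D (boundary - A) = D boundary - D A" unfolding D_def e[OF g] e[OF h] by simp
    then show ?case using compl Dsh[of x0] by (simp add: shadow_root)
  next
    case (union A)
    have A: "A n \<in> sets \<nu>" for n using union by (auto simp: sets_nu_shadows)
    have "set_lebesgue_integral \<nu> (\<Union>n. A n) k = (\<Sum>n. set_lebesgue_integral \<nu> (A n) k)" if "integrable \<nu> k"
        for k :: "_ \<Rightarrow> complex"
    proof (rule lebesgue_integral_countable_add)
      show "set_integrable \<nu> (\<Union>n. A n) k" unfolding set_integrable_def by (rule i) (use A that in auto)
    qed (use A union in \<open>auto simp: disjoint_family_on_def\<close>)
    moreover have "set_lebesgue_integral \<nu> (A n) g = set_lebesgue_integral \<nu> (A n) h" for n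
      using union(3)[of n] by (simp add: D_def)
    ultimately show ?case using g h by (simp add: D_def)
  qed (use Dsh in \<open>auto simp: D_def set_lebesgue_integral_def shadow_def\<close>)
  then have "set_lebesgue_integral \<nu> A g = set_lebesgue_integral \<nu> A h" if "A \<in> sets \<nu>" for A
    using that by (simp add: sets_nu_shadows D_def)
  then show ?thesis by (intro N.density_unique_banach[OF g h])
qed

text \<open>
  The procedure determines the density only up to null sets of the boundary, separately for every
  \<open>\<xi>\<close>.
\<close>

lemma is_R_plus_fin_unique:
  assumes "f \<in> fin_pairs" "is_R_plus_fin f G" "cmod \<xi> = 1"
  shows "AE \<omega> in \<nu>. G (\<xi>, \<omega>) = R_plus_fin f (\<xi>, \<omega>)"
proof (rule density_functional_inj_AE)
  have s: "\<xi> \<in> sphere 0 1" using assms(3) by simp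
  have H: "integrable \<nu> (\<lambda>\<omega>. H (\<xi>, \<omega>)) \<and>
      the_inv_into fin_add_measures (poisson \<xi>) (wave_hat f \<xi>) = density_functional (\<lambda>\<omega>. H (\<xi>, \<omega>))"
    if "is_R_plus_fin f H" for H
    using that[unfolded is_R_plus_fin_def, THEN bspec, OF s] by (elim conjE) (intro conjI)
  note G = H[OF assms(2)] and R = H[OF R_plus_fin_correct[OF assms(1)]]
  show "integrable \<nu> (\<lambda>\<omega>. G (\<xi>, \<omega>))" by (rule G[THEN conjunct1])
  show "integrable \<nu> (\<lambda>\<omega>. R_plus_fin f (\<xi>, \<omega>))" by (rule R[THEN conjunct1])
  show "density_functional (\<lambda>\<omega>. G (\<xi>, \<omega>)) = density_functional (\<lambda>\<omega>. R_plus_fin f (\<xi>, \<omega>))"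
    by (rule trans[OF G[THEN conjunct2, symmetric] R[THEN conjunct2]])
qed

end

context regular_tree_measure begin

interpretation N: finite_measure \<nu> by (rule finite_measure_nu)
interpretation C: finite_measure circle_measure by (rule finite_measure_circle)
interpretation P: pair_sigma_finite circle_measure \<nu> ..

section \<open>The isometry on finitely supported data\<close>

lemma finite_measure_target: "finite_measure target"
  by (rule finite_measure_pair_measure) (rule finite_measure_nu finite_measure_circle)+

lemma space_target: "space target = sphere 0 1 \<times> boundary"
  by (simp add: space_pair_measure space_circle space_nu)

lemma measurable_circle_target:
  "continuous_on (sphere 0 1) m \<Longrightarrow> (\<lambda>x. m (fst x)) \<in> borel_measurable target"
  by (rule measurable_compose[OF measurable_fst measurable_circle])

lemma circle_bound:
  fixes m :: "complex \<Rightarrow> complex"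
  assumes "continuous_on (sphere 0 1) m" obtains B where "\<And>\<xi>. cmod \<xi> = 1 \<Longrightarrow> cmod (m \<xi>) \<le> B"
proof -
  have "compact (m ` sphere 0 1)" by (rule compact_continuous_image[OF assms]) simp
  then obtain B where "\<And>z. z \<in> m ` sphere 0 1 \<Longrightarrow> norm z \<le> B"
    using compact_imp_bounded bounded_iff by metis
  then show ?thesis using that[of B] by simp
qed

lemma circle_integrable: "continuous_on (sphere 0 1) (m :: complex \<Rightarrow> complex) \<Longrightarrow> integrable circle_measure m"
proof -
  assume c: "continuous_on (sphere 0 1) m"
  obtain B where "\<And>\<xi>. cmod \<xi> = 1 \<Longrightarrow> cmod (m \<xi>) \<le> B" using circle_bound[OF c] by blast
  then show ?thesis
    by (intro C.integrable_const_bound[where B = B] measurable_circle[OF c] AE_I2) (simp add: space_circle)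
qed

lemma L2_circle_mult:
  assumes "continuous_on (sphere 0 1) m" "F \<in> L2 target"
  shows "(\<lambda>x. m (fst x) * F x) \<in> L2 target"
proof -
  obtain B where B: "\<And>\<xi>. cmod \<xi> = 1 \<Longrightarrow> cmod (m \<xi>) \<le> B" using circle_bound[OF assms(1)] by blast
  show ?thesis
    by (rule L2_bounded_mult(1)[OF assms(2) measurable_circle_target[OF assms(1)], of B])
       (use B in \<open>auto simp: space_target\<close>)
qed

lemma horo_bound:
  assumes "cmod \<xi> = 1" "\<omega> \<in> boundary" shows "cmod (horo \<xi> v \<omega>) \<le> sqrt (real q) ^ tdist x0 v"
proof -
  have s: "1 \<le> sqrt (real q)" using q_ge_2 by simp
  have "cmod (horo \<xi> v \<omega>) = sqrt (real q) powi busemann \<omega> v"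
    using assms(1) by (simp add: horo_powi norm_power_int norm_mult)
  also have "\<dots> \<le> sqrt (real q) powi int (tdist x0 v)"
    by (rule power_int_increasing) (use busemann_bounds[OF assms(2), of v] s in auto)
  also have "\<dots> = sqrt (real q) ^ tdist x0 v" by (rule power_int_of_nat)
  finally show ?thesis .
qed

text \<open>
  The Busemann function takes countably many values, so joint measurability reduces to a fixed
  exponent.
\<close>

lemma horo_measurable_target:
  assumes "continuous_on (sphere 0 1) m" "\<And>\<xi>. cmod \<xi> = 1 \<Longrightarrow> m \<xi> \<noteq> 0"
  shows "(\<lambda>x. horo (m (fst x)) v (snd x)) \<in> borel_measurable target"
proof -
  have b: "(\<lambda>x. busemann (snd x) v) \<in> measurable target (count_space UNIV)"
    by (rule measurable_compose[OF measurable_snd measurable_level_const[OF level_const_busemann]]) simp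
  have "(\<lambda>x. (\<lambda>k x. (sqrt_q * m (fst x)) powi k) (busemann (snd x) v) x) \<in> borel_measurable target"
  proof (rule measurable_compose_countable[OF _ b])
    fix k
    have "continuous_on (sphere 0 1) (\<lambda>\<xi>. (sqrt_q * m \<xi>) powi k)"
      using assms q_ge_2 by (intro continuous_intros) auto
    then show "(\<lambda>x. (sqrt_q * m (fst x)) powi k) \<in> borel_measurable target"
      by (rule measurable_circle_target)
  qed
  then show ?thesis by (simp add: horo_powi)
qed

lemma horo_L2: "(\<lambda>x. horo (fst x) v (snd x)) \<in> L2 target" "(\<lambda>x. horo (inverse (fst x)) v (snd x)) \<in> L2 target"
proof -
  interpret T: finite_measure target by (rule finite_measure_target)
  show "(\<lambda>x. horo (fst x) v (snd x)) \<in> L2 target"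
    by (rule T.L2_of_bounded[OF horo_measurable_target, of "\<lambda>\<xi>. \<xi>" _ "sqrt (real q) ^ tdist x0 v"])
       (auto intro!: horo_bound continuous_intros simp: space_target)
  show "(\<lambda>x. horo (inverse (fst x)) v (snd x)) \<in> L2 target"
    by (rule T.L2_of_bounded[OF horo_measurable_target, of inverse _ "sqrt (real q) ^ tdist x0 v"])
       (auto intro!: horo_bound continuous_intros simp: space_target norm_inverse)
qed

lemma L2_sum:
  assumes "\<And>i. i \<in> I \<Longrightarrow> F i \<in> L2 M" shows "(\<lambda>x. \<Sum>i\<in>I. F i x) \<in> L2 M"
  using assms
proof (induction I rule: infinite_finite_induct)
  case (insert i I)
  then show ?case using L2_add(1)[of "F i" M "\<lambda>x. \<Sum>i\<in>I. F i x"] by simp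
qed (simp_all add: L2_def)

lemma circle_denominators:
  assumes "cmod \<xi> = 1"
  shows "\<xi> - inverse (of_nat q) * inverse \<xi> \<noteq> 0" "inverse \<xi> - inverse (of_nat q) * \<xi> \<noteq> 0"
proof -
  have "inverse (real q) < 1" using q_ge_2 by (simp add: inverse_less_1_iff)
  then have n: "cmod (inverse (of_nat q) * inverse \<xi>) < 1" "cmod (inverse (of_nat q) * \<xi>) < 1"
    using assms by (simp_all add: norm_mult norm_inverse)
  show "\<xi> - inverse (of_nat q) * inverse \<xi> \<noteq> 0" using n(1) assms by auto
  have "cmod (inverse \<xi>) = 1" using assms by (simp add: norm_inverse)
  then show "inverse \<xi> - inverse (of_nat q) * \<xi> \<noteq> 0" using n(2) by auto
qed

lemma continuous_tau: "continuous_on (sphere 0 1) tau"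
  unfolding tau_def using circle_denominators by (intro continuous_intros) auto

text \<open>
  The factor that turns \<open>T\<^sub>+\<close> into \<open>R\<^sub>+\<close>; its denominator has no zeros on the circle.
\<close>

definition rho :: "complex \<Rightarrow> complex" where
  "rho \<xi> = (1 + inverse (of_nat q)) / (\<xi> - inverse (of_nat q) * inverse \<xi>)"

lemma continuous_rho: "continuous_on (sphere 0 1) rho"
  unfolding rho_def using circle_denominators by (intro continuous_intros) auto

lemma kappa_rho_tau: "kappa \<xi> = rho \<xi> * tau \<xi>"
  by (simp add: kappa_def rho_def tau_def)

lemma R_plus_fin_eq: "R_plus_fin f x = rho (fst x) * T_plus_fin f x"
  by (cases x) (simp add: R_plus_fin_def T_plus_fin_eq kappa_rho_tau)

lemma T_plus_fin_L2: assumes "f \<in> fin_pairs" shows "T_plus_fin f \<in> L2 target"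
proof -
  have e: "T_plus_fin f = (\<lambda>x. \<Sum>y\<in>fin_supp f. (tau (fst x) * (snd f y - (fst x - inverse (fst x)) / 2 *
      fst f y)) * horo (inverse (fst x)) y (snd x))"
    by (rule ext) (auto simp: T_plus_fin_eq wave_transform_fin_supp[OF assms] sum_distrib_left mult.assoc)
  have c: "continuous_on (sphere 0 1) (\<lambda>\<xi>. tau \<xi> * (snd f y - (\<xi> - inverse \<xi>) / 2 * fst f y))" for y
    by (intro continuous_intros continuous_tau) auto
  show ?thesis unfolding e by (rule L2_sum) (rule L2_circle_mult[OF c horo_L2(2)])
qed

lemma R_plus_fin_L2: assumes "f \<in> fin_pairs" shows "R_plus_fin f \<in> L2 target"
  using L2_circle_mult[OF continuous_rho T_plus_fin_L2[OF assms]] by (simp add: R_plus_fin_eq[abs_def])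

lemma wave_hat_fourier:
  assumes "f \<in> fin_pairs"
  shows "(\<integral>\<xi>. wave_hat f \<xi> y * \<xi> powi s \<partial>circle_measure) = 2 * pi * wave_fin f y (- s)"
  unfolding wave_hat_def wave_fin_eq[OF assms] by (rule fourier_coefficient[OF wave_sol_abs_summable])

lemma wave_hat_circle_continuous:
  assumes "f \<in> fin_pairs" shows "continuous_on (sphere 0 1) (\<lambda>\<xi>. wave_hat f \<xi> y)"
proof -
  have e: "(\<Sum>x\<in>fin_supp f. (snd f x - (\<xi> - inverse \<xi>) / 2 * fst f x) * wave_symbol (tdist x y) \<xi>)
      = wave_hat f \<xi> y"
    if "\<xi> \<in> sphere 0 1" for \<xi>
    unfolding wave_hat_def wave_fin_eq[OF assms] by (rule infsumI[OF wave_sol_has_sum, symmetric]) (use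
        that in simp)
  have c: "continuous_on (sphere 0 1) (\<lambda>\<xi>. \<Sum>x\<in>fin_supp f. (snd f x - (\<xi> - inverse \<xi>) / 2 * fst f x) *
      wave_symbol (tdist x y) \<xi>)"
    by (intro continuous_intros continuous_wave_symbol) auto
  show ?thesis by (rule continuous_on_eq[OF c e])
qed

lemma cnj_circle: assumes "cmod \<xi> = 1" shows "cnj \<xi> = inverse \<xi>"
proof -
  have "\<xi> * cnj \<xi> = 1" using assms by (simp flip: complex_norm_square)
  from inverse_unique[OF this] show ?thesis by simp
qed

lemma cnj_powi: "cnj (z powi n) = (cnj z) powi n"
  by (simp add: power_int_def)

lemma cnj_horo:
  assumes "cmod \<xi> = 1" shows "cnj (horo (inverse \<xi>) y \<omega>) = horo \<xi> y \<omega>"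
proof -
  have "cnj (inverse \<xi>) = \<xi>" using cnj_circle[OF assms] by simp
  then show ?thesis by (simp add: horo_powi cnj_powi)
qed

text \<open>
  On the circle conjugation is inversion, so the denominator of \<open>cnj (tau \<xi>)\<close> is the first factor
  of the denominator of \<open>kappa\<close>.
\<close>

lemma tau_cnj:
  assumes "cmod \<xi> = 1"
  shows "tau \<xi> * cnj (tau \<xi>) = of_nat q / (of_nat q + 1) * (inverse \<xi> - \<xi>) * kappa \<xi>"
proof -
  have c: "cnj \<xi> = inverse \<xi>" "cnj (inverse \<xi>) = \<xi>" using cnj_circle[OF assms] by simp_all
  have "cnj (tau \<xi>) = (inverse \<xi> - \<xi>) / (\<xi> - inverse (of_nat q) * inverse \<xi>)"
    using assms c by (simp add: tau_def)
  moreover have "1 + inverse (of_nat q) = (of_nat q + 1) / (of_nat q :: complex)"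
    using q_ne_complex by (simp add: field_simps)
  then have "of_nat q / (of_nat q + 1) * (1 + inverse (of_nat q)) = (1::complex)"
    using q_ne_complex by simp
  then have "of_nat q / (of_nat q + 1) * (inverse \<xi> - \<xi>) * kappa \<xi> =
      (inverse \<xi> - \<xi>) * ((\<xi> - inverse \<xi>) / ((\<xi> - inverse (of_nat q) * inverse \<xi>) * (inverse \<xi> - inverse
          (of_nat q) * \<xi>)))"
  proof -
    have "K * J * (L * D / X) = J * (D / X)" if "K * L = 1" for K L J D X :: complex
    proof -
      have "K * J * (L * D / X) = (K * L) * (J * (D / X))" by simp
      then show ?thesis using that by simp
    qed
    from this[OF \<open>of_nat q / (of_nat q + 1) * (1 + inverse (of_nat q)) = 1\<close>] show ?thesis
      unfolding kappa_def .
  qed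
  ultimately show ?thesis by (simp add: tau_def mult.commute)
qed

text \<open>
  Since \<open>|tau|\<^sup>2\<close> contains the factor \<open>kappa\<close>, one copy of \<open>R\<^sub>+ f\<close> can be split off, and its
  integral against \<open>horo \<xi> y\<close> is the Fourier series of the solution at \<open>y\<close>.
\<close>

lemma T_plus_inner_circle:
  assumes f: "f \<in> fin_pairs" and g: "g \<in> fin_pairs" and \<xi>: "cmod \<xi> = 1"
  shows "(\<integral>\<omega>. T_plus_fin f (\<xi>, \<omega>) * cnj (T_plus_fin g (\<xi>, \<omega>)) \<partial>\<nu>) =
    of_nat q / (of_nat q + 1) * (\<Sum>y\<in>fin_supp g. (inverse \<xi> - \<xi>) * (cnj (snd g y) + (\<xi> - inverse \<xi>) / 2 *
        cnj (fst g y)) * wave_hat f \<xi> y)"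
proof -
  let ?c = "of_nat q / (of_nat q + 1) :: complex"
  let ?d = "\<lambda>y. cnj (snd g y) + (\<xi> - inverse \<xi>) / 2 * cnj (fst g y)"
  have ci: "cnj (inverse \<xi>) = \<xi>" "cnj \<xi> = inverse \<xi>" using cnj_circle[OF \<xi>] by simp_all
  have e: "T_plus_fin f (\<xi>, \<omega>) * cnj (T_plus_fin g (\<xi>, \<omega>)) =
     (\<Sum>y\<in>fin_supp g. ?c * ((inverse \<xi> - \<xi>) * ?d y) * (horo \<xi> y \<omega> * R_plus_fin f (\<xi>, \<omega>)))" for \<omega>
  proof -
    have cg: "cnj (wave_transform g \<xi> \<omega>) = (\<Sum>y\<in>fin_supp g. ?d y * horo \<xi> y \<omega>)"
      unfolding wave_transform_fin_supp[OF g] cnj_sum complex_cnj_mult cnj_horo[OF \<xi>]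
      by (rule sum.cong) (simp_all add: ci algebra_simps add_divide_distrib diff_divide_distrib flip:
          complex_cnj_inverse)
    have "T_plus_fin f (\<xi>, \<omega>) * cnj (T_plus_fin g (\<xi>, \<omega>))
        = (tau \<xi> * cnj (tau \<xi>)) * wave_transform f \<xi> \<omega> * cnj (wave_transform g \<xi> \<omega>)"
      by (simp add: T_plus_fin_eq)
    also have "\<dots> = ?c * (inverse \<xi> - \<xi>) * R_plus_fin f (\<xi>, \<omega>) * (\<Sum>y\<in>fin_supp g. ?d y * horo \<xi> y \<omega>)"
      unfolding tau_cnj[OF \<xi>] cg by (simp only: R_plus_fin_def prod.case mult.assoc)
    also have "\<dots> = (\<Sum>y\<in>fin_supp g. ?c * ((inverse \<xi> - \<xi>) * ?d y) * (horo \<xi> y \<omega> * R_plus_fin f (\<xi>, \<omega>)))"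
      unfolding sum_distrib_left by (rule sum.cong) (simp_all only: ac_simps)
    finally show ?thesis .
  qed
  have i: "integrable \<nu> (\<lambda>\<omega>. horo \<xi> y \<omega> * R_plus_fin f (\<xi>, \<omega>))" for y
    by (rule integrable_level_const_mult[OF R_plus_fin_integrable[OF f] level_const_horo])
  have "(\<integral>\<omega>. T_plus_fin f (\<xi>, \<omega>) * cnj (T_plus_fin g (\<xi>, \<omega>)) \<partial>\<nu>) =
    (\<Sum>y\<in>fin_supp g. \<integral>\<omega>. ?c * ((inverse \<xi> - \<xi>) * ?d y) * (horo \<xi> y \<omega> * R_plus_fin f (\<xi>, \<omega>)) \<partial>\<nu>)"
    unfolding e by (rule Bochner_Integration.integral_sum) (intro integrable_mult_right i)
  also have "\<dots> = (\<Sum>y\<in>fin_supp g. ?c * ((inverse \<xi> - \<xi>) * ?d y) * wave_hat f \<xi> y)"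
    unfolding integral_mult_right_zero wave_hat_eq_integral[OF f \<xi>] ..
  finally show ?thesis by (simp add: sum_distrib_left mult.assoc)
qed

text \<open>
  Two applications of the wave equation express \<open>u(y,2) + 2 u(y,0) + u(y,-2)\<close> by \<open>A\<^sup>2 f\<^sub>1\<close>.
\<close>

lemma wave_sol_second_difference:
  assumes "f \<in> fin_pairs"
  shows "wave_fin f y 2 - 2 * wave_fin f y 0 + wave_fin f y (-2)
      = - 4 * (fst f y - adjop (adjop (fst f)) y / (4 * of_nat q))"
proof -
  let ?s = "sqrt_q"
  have ss: "?s * ?s = of_nat q" by (rule sqrt_q_mult_self)
  have s: "?s \<noteq> 0" using q_ge_2 by simp
  have w: "wave_fin f = wave_sol f" by (rule wave_fin_eq[OF assms])
  have step: "wave_fin f v (t + 1) + wave_fin f v (t - 1) = adjop (\<lambda>w. wave_fin f w t) v / ?s" for v t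
    using wave_sol_wave_eq[of f] s unfolding wave_eq_def w by (simp add: field_simps)
  have z: "wave_fin f v 0 = fst f v" for v using wave_sol_initial[OF assms] by (simp add: w)
  have "(wave_fin f y 2 + wave_fin f y 0) + (wave_fin f y 0 + wave_fin f y (-2)) =
     (adjop (\<lambda>w. wave_fin f w 1) y + adjop (\<lambda>w. wave_fin f w (-1)) y) / ?s"
    using step[of y 1] step[of y "-1"] by (simp add: add_divide_distrib)
  also have "adjop (\<lambda>w. wave_fin f w 1) y + adjop (\<lambda>w. wave_fin f w (-1)) y
      = adjop (\<lambda>w. wave_fin f w 1 + wave_fin f w (-1)) y"
    by (simp add: adjop_def sum.distrib)
  also have "(\<lambda>w. wave_fin f w 1 + wave_fin f w (-1)) = (\<lambda>w. adjop (fst f) w / ?s)"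
    using step[of _ 0] z by (simp add: adjop_def)
  also have "adjop (\<lambda>w. adjop (fst f) w / ?s) y / ?s = adjop (adjop (fst f)) y / of_nat q"
    by (simp add: adjop_def flip: sum_divide_distrib ss)
  finally have sum4: "(wave_fin f y 2 + wave_fin f y 0) + (wave_fin f y 0 + wave_fin f y (-2))
      = adjop (adjop (fst f)) y / of_nat q" .
  have "wave_fin f y 2 - 2 * wave_fin f y 0 + wave_fin f y (-2)
      = ((wave_fin f y 2 + wave_fin f y 0) + (wave_fin f y 0 + wave_fin f y (-2))) - 4 * wave_fin f y 0" by simp
  also have "\<dots> = - 4 * (fst f y - adjop (adjop (fst f)) y / (4 * of_nat q))"
    unfolding sum4 unfolding z by (simp add: right_diff_distrib)
  finally show ?thesis .
qed

lemma energy_fin: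
  assumes "f \<in> fin_pairs" "g \<in> fin_pairs"
  shows "energy f g = (\<Sum>y\<in>fin_supp g. (fst f y - adjop (adjop (fst f)) y / (4 * of_nat q)) * cnj (fst g y)
      + snd f y * cnj (snd g y))"
  unfolding energy_def l2_inner_def
  by (subst (1 2) infsum_finite_support[OF finite_fin_supp[OF assms(2)]])
     (auto simp: fin_supp_def sum.distrib)

text \<open>
  By orthogonality of the characters, the integral over the circle of the expression in
  \<open>T_plus_inner_circle\<close> picks out the first and second differences in time of the solution at time
  zero, and these are multiples of what the energy form pairs with the components of \<open>g\<close>.
\<close>

theorem T_plus_fin_isometry:
  assumes f: "f \<in> fin_pairs" and g: "g \<in> fin_pairs"
  shows "L2_inner target (T_plus_fin f) (T_plus_fin g) = of_real (4 * pi * real q / (real q + 1)) * energy f g"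
proof -
  let ?c = "of_nat q / (of_nat q + 1) :: complex" and ?w = "\<lambda>\<xi> y. wave_hat f \<xi> y"
  let ?W = "\<lambda>s y \<xi>. wave_hat f \<xi> y * \<xi> powi s"
  have int: "integrable circle_measure (\<lambda>\<xi>. c * ?W s y \<xi>)" for c s y
    by (rule circle_integrable) (intro continuous_intros wave_hat_circle_continuous[OF f]; auto)
  \<comment> \<open>The product \<open>(\<xi>\<^sup>-\<^sup>1 - \<xi>) (cnj g\<^sub>2 + (\<xi> - \<xi>\<^sup>-\<^sup>1)/2 cnj g\<^sub>1)\<close> expanded in powers of \<open>\<xi>\<close>.\<close>
  let ?G = "\<lambda>y \<xi>. (cnj (snd g y) * ?W (-1) y \<xi> - cnj (snd g y) * ?W 1 y \<xi>)
     - (cnj (fst g y) / 2 * ?W 2 y \<xi> - cnj (fst g y) * ?W 0 y \<xi> + cnj (fst g y) / 2 * ?W (-2) y \<xi>)"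
  have "L2_inner target (T_plus_fin f) (T_plus_fin g) = (\<integral>\<xi>. (\<integral>\<omega>. T_plus_fin f (\<xi>, \<omega>) * cnj (T_plus_fin g
      (\<xi>, \<omega>)) \<partial>\<nu>) \<partial>circle_measure)"
    unfolding L2_inner_def
    by (rule P.integral_fst'[symmetric]) (rule L2_mult_integrable[OF T_plus_fin_L2[OF f] L2_cnj[OF
        T_plus_fin_L2[OF g]]])
  also have "\<dots> = (\<integral>\<xi>. ?c * (\<Sum>y\<in>fin_supp g. ?G y \<xi>) \<partial>circle_measure)"
  proof (rule Bochner_Integration.integral_cong[OF refl])
    fix \<xi> assume "\<xi> \<in> space circle_measure"
    then have \<xi>: "cmod \<xi> = 1" "\<xi> \<noteq> 0" by (auto simp: space_circle)
    have p: "\<xi> powi 2 = \<xi> * \<xi>" "\<xi> powi (-2) = inverse \<xi> * inverse \<xi>" "\<xi> powi (-1) = inverse \<xi>" "\<xi> powi 1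
        = \<xi>" "\<xi> powi 0 = 1"
      by (simp_all add: power_int_def power2_eq_square power_inverse)
    have "(inverse \<xi> - \<xi>) * (cnj (snd g y) + (\<xi> - inverse \<xi>) / 2 * cnj (fst g y)) * wave_hat f \<xi> y
        = ?G y \<xi>" for y
    proof -
      have "(j - z) * (b + (z - j) / 2 * a) * w = (b * (w * j) - b * (w * z)) - (a / 2 * (w * (z * z)) - a
          * (w * (z * j)) + a / 2 * (w * (j * j)))"
        for j z a b w :: complex by (simp add: algebra_simps diff_divide_distrib add_divide_distrib)
      moreover have "\<xi> * inverse \<xi> = 1" using \<xi> by simp
      ultimately show ?thesis unfolding p by (simp only:)
    qed
    then show "(\<integral>\<omega>. T_plus_fin f (\<xi>, \<omega>) * cnj (T_plus_fin g (\<xi>, \<omega>)) \<partial>\<nu>) = ?c * (\<Sum>y\<in>fin_supp g. ?G y \<xi>)"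
      unfolding T_plus_inner_circle[OF f g \<xi>(1)] by simp
  qed
  also have "\<dots> = ?c * (\<Sum>y\<in>fin_supp g. \<integral>\<xi>. ?G y \<xi> \<partial>circle_measure)"
    unfolding integral_mult_right_zero
    by (subst Bochner_Integration.integral_sum)
       (intro Bochner_Integration.integrable_diff Bochner_Integration.integrable_add int, rule refl)
  also have "(\<Sum>y\<in>fin_supp g. \<integral>\<xi>. ?G y \<xi> \<partial>circle_measure) = (\<Sum>y\<in>fin_supp g. 4 * pi *
     ((fst f y - adjop (adjop (fst f)) y / (4 * of_nat q)) * cnj (fst g y) + snd f y * cnj (snd g y)))"
  proof (rule sum.cong[OF refl])
    fix y
    let ?u = "\<lambda>t. wave_fin f y t"
    have u2: "(?u 1 - ?u (-1)) = 2 * snd f y"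
      using wave_sol_initial(2)[OF f, of y] by (simp add: wave_fin_eq[OF f] field_simps)
    have I: "(\<integral>\<xi>. c * ?W s y \<xi> \<partial>circle_measure) = c * (2 * pi * ?u (- s))" for c s
      by (simp only: integral_mult_right_zero wave_hat_fourier[OF f])
    have "(\<integral>\<xi>. ?G y \<xi> \<partial>circle_measure) = (cnj (snd g y) * (2 * pi * ?u (-(-1))) - cnj (snd g y) * (2 * pi
        * ?u (- 1)))
       - (cnj (fst g y) / 2 * (2 * pi * ?u (- 2)) - cnj (fst g y) * (2 * pi * ?u (- 0)) + cnj (fst g y) /
           2 * (2 * pi * ?u (- (-2))))"
      unfolding I[symmetric]
      by (simp only: Bochner_Integration.integral_diff Bochner_Integration.integral_add
          Bochner_Integration.integrable_diff Bochner_Integration.integrable_add int)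
    also have "\<dots> = 2 * pi * (cnj (snd g y) * (?u 1 - ?u (-1)) - cnj (fst g y) / 2 * (?u 2 - 2 * ?u 0 + ?u
        (-2)))"
      by (simp add: algebra_simps)
    also have "\<dots> = 4 * pi * ((fst f y - adjop (adjop (fst f)) y / (4 * of_nat q)) * cnj (fst g y) + snd f
        y * cnj (snd g y))"
      unfolding u2 wave_sol_second_difference[OF f] by (simp add: algebra_simps)
    finally show "(\<integral>\<xi>. ?G y \<xi> \<partial>circle_measure) = 4 * pi * ((fst f y - adjop (adjop (fst f)) y / (4 *
        of_nat q)) * cnj (fst g y) + snd f y * cnj (snd g y))" .
  qed
  also have "\<dots> = 4 * pi * energy f g" unfolding energy_fin[OF f g] by (simp add: sum_distrib_left)
  also have "?c * (4 * pi * energy f g) = of_real (4 * pi * real q / (real q + 1)) * energy f g"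
    by (simp add: field_simps)
  finally show ?thesis .
qed

end

context regular_tree begin

section \<open>The image as a module over polynomials\<close>

lemma fin_pairs_lin:
  assumes "f \<in> fin_pairs" "g \<in> fin_pairs"
  shows "(\<lambda>v. a * fst f v + b * fst g v, \<lambda>v. a * snd f v + b * snd g v) \<in> fin_pairs"
proof -
  have "finite {v. a * h v + b * k v \<noteq> 0}" if "finite {v. h v \<noteq> 0}" "finite {v. k v \<noteq> 0}"
      for h k :: "'v \<Rightarrow> complex"
    by (rule finite_subset[OF _ finite_UnI[OF that]]) auto
  then show ?thesis using assms by (simp add: fin_pairs_iff)
qed

lemma wave_transform_lin:
  assumes "f \<in> fin_pairs" "g \<in> fin_pairs"
  shows "wave_transform (\<lambda>v. a * fst f v + b * fst g v, \<lambda>v. a * snd f v + b * snd g v) \<xi> \<omega>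
    = a * wave_transform f \<xi> \<omega> + b * wave_transform g \<xi> \<omega>"
  using assms by (simp add: wave_transform_def fin_pairs_iff helgason_lin algebra_simps add_divide_distrib
      diff_divide_distrib)

lemma helgason_scale:
  assumes "finite {v. f v \<noteq> 0}" shows "helgason (\<lambda>v. a * f v) \<xi> \<omega> = a * helgason f \<xi> \<omega>"
  using helgason_lin[OF assms assms, of a 0 \<xi> \<omega>] by simp

text \<open>
  Functions of \<open>\<xi>\<close> that preserve the image of the finitely supported data. They form an algebra.
\<close>

definition multiplier :: "(complex \<Rightarrow> complex) \<Rightarrow> bool" where
  "multiplier m \<longleftrightarrow> (\<forall>f\<in>fin_pairs. \<exists>g\<in>fin_pairs. \<forall>\<xi>\<in>sphere 0 1. \<forall>\<omega>\<in>boundary.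
      wave_transform g \<xi> \<omega> = m \<xi> * wave_transform f \<xi> \<omega>)"

lemma multiplierE:
  assumes "multiplier m" "f \<in> fin_pairs"
  obtains g where "g \<in> fin_pairs" "\<And>\<xi> \<omega>. cmod \<xi> = 1 \<Longrightarrow> \<omega> \<in> boundary \<Longrightarrow> wave_transform g \<xi> \<omega>
      = m \<xi> * wave_transform f \<xi> \<omega>"
  using assms unfolding multiplier_def by fastforce

lemma multiplierI:
  assumes "\<And>f. f \<in> fin_pairs \<Longrightarrow> \<exists>g\<in>fin_pairs. \<forall>\<xi> \<omega>. cmod \<xi> = 1 \<longrightarrow> \<omega> \<in> boundary \<longrightarrow> wave_transform g \<xi> \<omega>
      = m \<xi> * wave_transform f \<xi> \<omega>"
  shows "multiplier m"
  using assms unfolding multiplier_def by fastforce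

lemma multiplier_cong: "multiplier m \<Longrightarrow> (\<And>\<xi>. cmod \<xi> = 1 \<Longrightarrow> m \<xi> = m' \<xi>) \<Longrightarrow> multiplier m'"
  unfolding multiplier_def by simp

lemma multiplier_const: "multiplier (\<lambda>\<xi>. c)"
proof (rule multiplierI)
  fix f :: "('v \<Rightarrow> complex) \<times> ('v \<Rightarrow> complex)" assume f: "f \<in> fin_pairs"
  show "\<exists>g\<in>fin_pairs. \<forall>\<xi> \<omega>. cmod \<xi> = 1 \<longrightarrow> \<omega> \<in> boundary \<longrightarrow> wave_transform g \<xi> \<omega> = c * wave_transform f \<xi> \<omega>"
    by (rule bexI[OF _ fin_pairs_lin[OF f f, of c 0]]) (simp only: wave_transform_lin[OF f f], simp)
qed

lemma multiplier_add:
  assumes "multiplier m" "multiplier m'" shows "multiplier (\<lambda>\<xi>. m \<xi> + m' \<xi>)"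
proof (rule multiplierI)
  fix f :: "('v \<Rightarrow> complex) \<times> ('v \<Rightarrow> complex)" assume f: "f \<in> fin_pairs"
  obtain g where g: "g \<in> fin_pairs" "\<And>\<xi> \<omega>. cmod \<xi> = 1 \<Longrightarrow> \<omega> \<in> boundary \<Longrightarrow> wave_transform g \<xi> \<omega>
      = m \<xi> * wave_transform f \<xi> \<omega>"
    using multiplierE[OF assms(1) f] by blast
  obtain h where h: "h \<in> fin_pairs" "\<And>\<xi> \<omega>. cmod \<xi> = 1 \<Longrightarrow> \<omega> \<in> boundary \<Longrightarrow> wave_transform h \<xi> \<omega>
      = m' \<xi> * wave_transform f \<xi> \<omega>"
    using multiplierE[OF assms(2) f] by blast
  show "\<exists>g\<in>fin_pairs. \<forall>\<xi> \<omega>. cmod \<xi> = 1 \<longrightarrow> \<omega> \<in> boundary \<longrightarrow> wave_transform g \<xi> \<omega>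
      = (m \<xi> + m' \<xi>) * wave_transform f \<xi> \<omega>"
    by (rule bexI[OF _ fin_pairs_lin[OF g(1) h(1), of 1 1]])
       (simp only: wave_transform_lin[OF g(1) h(1)], simp add: g h distrib_right)
qed

lemma multiplier_mult:
  assumes "multiplier m" "multiplier m'" shows "multiplier (\<lambda>\<xi>. m \<xi> * m' \<xi>)"
proof (rule multiplierI)
  fix f :: "('v \<Rightarrow> complex) \<times> ('v \<Rightarrow> complex)" assume f: "f \<in> fin_pairs"
  obtain h where h: "h \<in> fin_pairs" "\<And>\<xi> \<omega>. cmod \<xi> = 1 \<Longrightarrow> \<omega> \<in> boundary \<Longrightarrow> wave_transform h \<xi> \<omega>
      = m' \<xi> * wave_transform f \<xi> \<omega>"
    using multiplierE[OF assms(2) f] by blast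
  obtain g where g: "g \<in> fin_pairs" "\<And>\<xi> \<omega>. cmod \<xi> = 1 \<Longrightarrow> \<omega> \<in> boundary \<Longrightarrow> wave_transform g \<xi> \<omega>
      = m \<xi> * wave_transform h \<xi> \<omega>"
    using multiplierE[OF assms(1) h(1)] by blast
  show "\<exists>g\<in>fin_pairs. \<forall>\<xi> \<omega>. cmod \<xi> = 1 \<longrightarrow> \<omega> \<in> boundary \<longrightarrow> wave_transform g \<xi> \<omega>
      = (m \<xi> * m' \<xi>) * wave_transform f \<xi> \<omega>"
    by (rule bexI[OF _ g(1)]) (simp add: g h)
qed

lemma multiplier_cmult: "multiplier m \<Longrightarrow> multiplier (\<lambda>\<xi>. c * m \<xi>)"
  using multiplier_mult[OF multiplier_const] .

lemma multiplier_power: "multiplier m \<Longrightarrow> multiplier (\<lambda>\<xi>. m \<xi> ^ n)"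
  by (induction n) (simp_all add: multiplier_const multiplier_mult)

text \<open>
  By the eigenfunction property, \<open>A/2\<surd>q\<close> acts on the data as multiplication by \<open>(\<xi> + \<xi>\<^sup>-\<^sup>1)/2\<close>.
\<close>

lemma multiplier_half_sum: "multiplier (\<lambda>\<xi>. (\<xi> + inverse \<xi>) / 2)"
proof (rule multiplierI)
  fix f :: "('v \<Rightarrow> complex) \<times> ('v \<Rightarrow> complex)" assume f: "f \<in> fin_pairs"
  let ?s = "sqrt_q" and ?k = "inverse (2 * sqrt_q) :: complex"
  have s: "?s \<noteq> 0" using q_ge_2 by simp
  have f': "finite {v. fst f v \<noteq> 0}" "finite {v. snd f v \<noteq> 0}" using f by (simp_all add: fin_pairs_iff)
  define g where "g = (\<lambda>v. ?k * adjop (fst f) v, \<lambda>v. ?k * adjop (snd f) v)"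
  have "g \<in> fin_pairs" using finite_support_adjop[OF f'(1)] finite_support_adjop[OF f'(2)] s
      by (simp add: g_def fin_pairs_iff)
  moreover have "wave_transform g \<xi> \<omega> = (\<xi> + inverse \<xi>) / 2 * wave_transform f \<xi> \<omega>"
    if "cmod \<xi> = 1" "\<omega> \<in> boundary" for \<xi> \<omega>
  proof -
    have nz: "inverse \<xi> \<noteq> 0" using that by auto
    have h: "helgason (\<lambda>v. ?k * adjop k v) (inverse \<xi>) \<omega> = (\<xi> + inverse \<xi>) / 2 * helgason k (inverse \<xi>) \<omega>"
      if "finite {v. k v \<noteq> 0}" for k
      unfolding helgason_scale[OF finite_support_adjop[OF that]] helgason_adjop[OF that \<open>\<omega> \<in> boundary\<close> nz]
      using s by (simp add: field_simps)
    have "a * S - d * (a * F) = a * (S - d * F)" for a S d F :: complex by (simp add: algebra_simps)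
    then show ?thesis unfolding wave_transform_def g_def fst_conv snd_conv h[OF f'(1)] h[OF f'(2)] .
  qed
  ultimately show "\<exists>g\<in>fin_pairs. \<forall>\<xi> \<omega>. cmod \<xi> = 1 \<longrightarrow> \<omega> \<in> boundary \<longrightarrow> wave_transform g \<xi> \<omega>
      = (\<xi> + inverse \<xi>) / 2 * wave_transform f \<xi> \<omega>"
    by blast
qed

text \<open>
  The data \<open>(-f\<^sub>2, (1 - A\<^sup>2/4q) f\<^sub>1)\<close> do it, because \<open>1 - ((\<xi> + \<xi>\<^sup>-\<^sup>1)/2)\<^sup>2 = -((\<xi> - \<xi>\<^sup>-\<^sup>1)/2)\<^sup>2\<close>.
\<close>

lemma multiplier_half_diff: "multiplier (\<lambda>\<xi>. (\<xi> - inverse \<xi>) / 2)"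
proof (rule multiplierI)
  fix f :: "('v \<Rightarrow> complex) \<times> ('v \<Rightarrow> complex)" assume f: "f \<in> fin_pairs"
  let ?s = "sqrt_q" and ?k = "- inverse (4 * of_nat q) :: complex"
  have ss: "?s * ?s = of_nat q" by (simp flip: of_real_mult)
  have qn: "(of_nat q :: complex) \<noteq> 0" using q_ge_2 by simp
  have f': "finite {v. fst f v \<noteq> 0}" "finite {v. snd f v \<noteq> 0}" using f by (simp_all add: fin_pairs_iff)
  have fa: "finite {v. adjop (fst f) v \<noteq> 0}" "finite {v. adjop (adjop (fst f)) v \<noteq> 0}"
    using finite_support_adjop f' by blast+
  define g where "g = (\<lambda>v. (-1) * snd f v, \<lambda>v. 1 * fst f v + ?k * adjop (adjop (fst f)) v)"
  have "finite {v. 1 * fst f v + ?k * adjop (adjop (fst f)) v \<noteq> 0}"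
    by (rule finite_subset[OF _ finite_UnI[OF f'(1) fa(2)]]) auto
  then have "g \<in> fin_pairs" using f' by (simp add: g_def fin_pairs_iff)
  moreover have "wave_transform g \<xi> \<omega> = (\<xi> - inverse \<xi>) / 2 * wave_transform f \<xi> \<omega>"
    if "cmod \<xi> = 1" "\<omega> \<in> boundary" for \<xi> \<omega>
  proof -
    have nz: "inverse \<xi> \<noteq> 0" "\<xi> \<noteq> 0" using that by auto
    have "helgason (\<lambda>v. 1 * fst f v + ?k * adjop (adjop (fst f)) v) (inverse \<xi>) \<omega>
       = helgason (fst f) (inverse \<xi>) \<omega> + ?k * (?s * (inverse \<xi> + \<xi>) * (?s * (inverse \<xi> + \<xi>) * helgason
           (fst f) (inverse \<xi>) \<omega>))"
      unfolding helgason_lin[OF f'(1) fa(2)] helgason_adjop[OF fa(1) that(2) nz(1)] helgason_adjop[OF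
          f'(1) that(2) nz(1)] by simp
    also have "\<dots> = helgason (fst f) (inverse \<xi>) \<omega> + ?k * (?s * ?s) * (inverse \<xi> + \<xi>)\<^sup>2 * helgason (fst f)
        (inverse \<xi>) \<omega>"
      by (simp add: power2_eq_square)
    also have "?k * (?s * ?s) = - (1 / 4)" unfolding ss using qn by simp
    also have "helgason (fst f) (inverse \<xi>) \<omega> + - (1 / 4) * (inverse \<xi> + \<xi>)\<^sup>2 * helgason (fst f) (inverse \<xi>) \<omega>
       = - ((\<xi> - inverse \<xi>) / 2)\<^sup>2 * helgason (fst f) (inverse \<xi>) \<omega>"
    proof -
      have "1 + - (1 / 4) * (inverse \<xi> + \<xi>)\<^sup>2 = - ((\<xi> - inverse \<xi>) / 2)\<^sup>2"
        using nz by (simp add: power2_eq_square field_simps)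
      from this[symmetric] show ?thesis by (simp only: distrib_right mult_1)
    qed
    finally have h1: "helgason (\<lambda>v. 1 * fst f v + ?k * adjop (adjop (fst f)) v) (inverse \<xi>) \<omega>
        = - ((\<xi> - inverse \<xi>) / 2)\<^sup>2 * helgason (fst f) (inverse \<xi>) \<omega>" .
    have "- d\<^sup>2 * F - d * (-1 * S) = d * (S - d * F)" for d S F :: complex
      by (simp add: power2_eq_square algebra_simps)
    then show ?thesis unfolding wave_transform_def g_def fst_conv snd_conv h1 helgason_scale[OF f'(2)] .
  qed
  ultimately show "\<exists>g\<in>fin_pairs. \<forall>\<xi> \<omega>. cmod \<xi> = 1 \<longrightarrow> \<omega> \<in> boundary \<longrightarrow> wave_transform g \<xi> \<omega>
      = (\<xi> - inverse \<xi>) / 2 * wave_transform f \<xi> \<omega>"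
    by blast
qed

lemma multiplier_id: "multiplier (\<lambda>\<xi>. \<xi>)"
  by (rule multiplier_cong[OF multiplier_add[OF multiplier_half_sum multiplier_half_diff]])
     (simp add: field_simps)

lemma multiplier_inverse: "multiplier inverse"
  by (rule multiplier_cong[OF multiplier_add[OF multiplier_half_sum multiplier_cmult[OF
      multiplier_half_diff, of "-1"]]])
     (simp add: field_simps)

end

context regular_tree_measure begin

text \<open>
  On the circle the real and the imaginary part of \<open>\<xi>\<close> are \<open>(\<xi> + \<xi>\<^sup>-\<^sup>1)/2\<close> and \<open>(\<xi> - \<xi>\<^sup>-\<^sup>1)/2\<i>\<close>.
\<close>

lemma multiplier_real_polynomial:
  assumes "real_polynomial_function p" shows "multiplier (\<lambda>\<xi>. of_real (p \<xi>))"
  using assms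
proof induction
  case (linear f)
  have "multiplier (\<lambda>\<xi>. of_real (f 1) * ((\<xi> + inverse \<xi>) / 2) + (of_real (f \<i>) / \<i>) * ((\<xi> - inverse \<xi>) / 2))"
    by (intro multiplier_add multiplier_cmult multiplier_half_sum multiplier_half_diff)
  then show ?case
  proof (rule multiplier_cong)
    fix \<xi> :: complex assume "cmod \<xi> = 1"
    then have c: "inverse \<xi> = cnj \<xi>" using cnj_circle by simp
    have r: "(\<xi> + inverse \<xi>) / 2 = of_real (Re \<xi>)" "(\<xi> - inverse \<xi>) / 2 = \<i> * of_real (Im \<xi>)"
      unfolding c by (simp_all add: complex_eq_iff)
    have "f \<xi> = f (Re \<xi> *\<^sub>R 1 + Im \<xi> *\<^sub>R \<i>)"
      by (rule arg_cong[of _ _ f]) (simp add: complex_eq_iff)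
    also have "\<dots> = Re \<xi> * f 1 + Im \<xi> * f \<i>"
      using linear by (simp add: linear_simps bounded_linear.linear linear_add linear_scale)
    finally show "of_real (f 1) * ((\<xi> + inverse \<xi>) / 2) + (of_real (f \<i>) / \<i>) * ((\<xi> - inverse \<xi>) / 2)
        = of_real (f \<xi>)"
      unfolding r by (simp add: algebra_simps)
  qed
next
  case (const c)
  show ?case by (rule multiplier_const)
next
  case (add f g)
  then show ?case using multiplier_add by (simp add: multiplier_add)
next
  case (mult f g)
  then show ?case by (simp add: multiplier_mult)
qed

lemma multiplier_polynomial:
  fixes p :: "complex \<Rightarrow> complex"
  assumes "polynomial_function p" shows "multiplier p"
proof -
  have "real_polynomial_function (Re \<circ> p)" "real_polynomial_function (Im \<circ> p)"
    using assms bounded_linear_Re bounded_linear_Im unfolding polynomial_function_def by blast+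
  then have "multiplier (\<lambda>\<xi>. of_real ((Re \<circ> p) \<xi>) + \<i> * of_real ((Im \<circ> p) \<xi>))"
    by (intro multiplier_add multiplier_cmult multiplier_real_polynomial)
  then show ?thesis by (rule multiplier_cong) (simp add: complex_eq_iff)
qed

lemma delta_fin_pairs: "(\<lambda>_. 0, \<lambda>x. if x = v then 1 else 0) \<in> fin_pairs"
  by (simp add: fin_pairs_iff)

lemma wave_transform_delta: "wave_transform (\<lambda>_. 0, \<lambda>x. if x = v then 1 else 0) \<xi> \<omega> = horo (inverse \<xi>) v \<omega>"
  by (subst wave_transform_sum[of "{v}"]) auto

text \<open>
  The identity \<open>shadow_ind_horo\<close> at \<open>\<xi>\<^sup>-\<^sup>1\<close> expresses a shadow by the transforms of \<open>(0, \<delta>\<^sub>v)\<close> and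
  \<open>(0, \<delta>\<^sub>p)\<close>, and powers of \<open>\<xi>\<close> are multipliers. The remaining factor \<open>\<xi>\<^sup>-\<^sup>1 - \<xi>/q\<close> is the
  denominator of \<open>tau\<close>.
\<close>

lemma shadow_in_image:
  obtains f where "f \<in> fin_pairs" "\<And>\<xi> \<omega>. cmod \<xi> = 1 \<Longrightarrow> \<omega> \<in> boundary \<Longrightarrow>
     wave_transform f \<xi> \<omega> = (inverse \<xi> - inverse (of_nat q) * \<xi>) * shadow_ind v \<omega>"
proof (cases "v = x0")
  case True
  have "multiplier (\<lambda>\<xi>. inverse \<xi> + (- inverse (of_nat q)) * \<xi>)"
    by (intro multiplier_add multiplier_cmult multiplier_inverse multiplier_id)
  then obtain f where f: "f \<in> fin_pairs" "\<And>\<xi> \<omega>. cmod \<xi> = 1 \<Longrightarrow> \<omega> \<in> boundary \<Longrightarrow>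
     wave_transform f \<xi> \<omega> = (inverse \<xi> + (- inverse (of_nat q)) * \<xi>) * wave_transform (\<lambda>_. 0, \<lambda>x. if x
         = x0 then 1 else 0) \<xi> \<omega>"
    using multiplierE[OF _ delta_fin_pairs[of x0]] by blast
  show ?thesis
    by (rule that[OF f(1)]) (simp add: f(2) wave_transform_delta horo_root True shadow_root)
next
  case False
  then obtain p where p: "adj p v" "tdist x0 v = Suc (tdist x0 p)" using parent_exists by blast
  let ?s = "sqrt_q"
  let ?n = "tdist x0 p"
  have s: "?s \<noteq> 0" using q_ge_2 by simp
  have ss: "?s * ?s = of_nat q" by (rule sqrt_q_mult_self)
  obtain f1 where f1: "f1 \<in> fin_pairs" "\<And>\<xi> \<omega>. cmod \<xi> = 1 \<Longrightarrow> \<omega> \<in> boundary \<Longrightarrow>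
     wave_transform f1 \<xi> \<omega> = (inverse ?s * \<xi>) * wave_transform (\<lambda>_. 0, \<lambda>x. if x = p then 1 else 0) \<xi> \<omega>"
    using multiplierE[OF multiplier_cmult[OF multiplier_id] delta_fin_pairs[of p]] by blast
  let ?d = "(\<lambda>_::'v. 0::complex, \<lambda>x. if x = v then 1 else 0::complex)"
  let ?f2 = "(\<lambda>x. 1 * fst ?d x + (-1) * fst f1 x, \<lambda>x. 1 * snd ?d x + (-1) * snd f1 x)"
  have f2: "?f2 \<in> fin_pairs" by (rule fin_pairs_lin[OF delta_fin_pairs f1(1)])
  have "multiplier (\<lambda>\<xi>. inverse ?s * (inverse ?s * \<xi>) ^ ?n)"
    by (intro multiplier_cmult multiplier_power multiplier_id)
  then obtain f where f: "f \<in> fin_pairs" "\<And>\<xi> \<omega>. cmod \<xi> = 1 \<Longrightarrow> \<omega> \<in> boundary \<Longrightarrow>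
     wave_transform f \<xi> \<omega> = (inverse ?s * (inverse ?s * \<xi>) ^ ?n) * wave_transform ?f2 \<xi> \<omega>"
    using multiplierE[OF _ f2] by blast
  show ?thesis
  proof (rule that[OF f(1)])
    fix \<xi> \<omega> assume a: "cmod \<xi> = 1" "\<omega> \<in> boundary"
    then have nz: "\<xi> \<noteq> 0" "inverse \<xi> \<noteq> 0" by auto
    let ?\<alpha> = "?s * inverse \<xi>"
    have al: "inverse ?\<alpha> = inverse ?s * \<xi>" using nz by simp
    have "(inverse ?s * \<xi>) * ?\<alpha> = (inverse ?s * ?s) * (\<xi> * inverse \<xi>)" by (simp only: ac_simps)
    also have "\<dots> = 1" using nz s by simp
    finally have c1: "(inverse ?s * \<xi>) * ?\<alpha> = 1" .
    have c2: "inverse ?s * (?\<alpha> - inverse ?\<alpha>) = inverse \<xi> - inverse (of_nat q) * \<xi>"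
      unfolding al ss[symmetric] using s by (simp add: right_diff_distrib)
    have "wave_transform ?f2 \<xi> \<omega> = 1 * horo (inverse \<xi>) v \<omega> + (-1) * ((inverse ?s * \<xi>) * horo (inverse \<xi>) p \<omega>)"
      unfolding wave_transform_lin[OF delta_fin_pairs f1(1)] f1(2)[OF a] wave_transform_delta ..
    also have "\<dots> = horo (inverse \<xi>) v \<omega> - inverse ?\<alpha> * horo (inverse \<xi>) p \<omega>" unfolding al by simp
    also have "\<dots> = (?\<alpha> - inverse ?\<alpha>) * ?\<alpha> ^ ?n * shadow_ind v \<omega>"
      by (rule shadow_ind_horo[OF a(2) p nz(2)])
    finally have w: "wave_transform ?f2 \<xi> \<omega> = (?\<alpha> - inverse ?\<alpha>) * ?\<alpha> ^ ?n * shadow_ind v \<omega>" .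
    have "(inverse ?s * (inverse ?s * \<xi>) ^ ?n) * ((?\<alpha> - inverse ?\<alpha>) * ?\<alpha> ^ ?n * shadow_ind v \<omega>)
      = (inverse ?s * (?\<alpha> - inverse ?\<alpha>)) * ((inverse ?s * \<xi>) * ?\<alpha>) ^ ?n * shadow_ind v \<omega>"
      unfolding power_mult_distrib[of "inverse ?s * \<xi>" ?\<alpha>] by (simp only: ac_simps)
    then show "wave_transform f \<xi> \<omega> = (inverse \<xi> - inverse (of_nat q) * \<xi>) * shadow_ind v \<omega>"
      unfolding f(2)[OF a] w c1 c2 by simp
  qed
qed

section \<open>Density of the image\<close>

lemma L2_subspace_image: "L2_subspace target (T_plus_fin ` fin_pairs)"
proof -
  interpret T: finite_measure target by (rule finite_measure_target)
  have lin: "(\<lambda>x. a * T_plus_fin f x + b * T_plus_fin g x)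
      = T_plus_fin (\<lambda>v. a * fst f v + b * fst g v, \<lambda>v. a * snd f v + b * snd g v)"
    if "f \<in> fin_pairs" "g \<in> fin_pairs" for f g a b
    by (rule ext) (auto simp: T_plus_fin_eq wave_transform_lin[OF that] algebra_simps)
  have z: "(\<lambda>_. 0, \<lambda>_. 0) \<in> fin_pairs" by (simp add: fin_pairs_iff)
  show ?thesis
  proof
    show "T_plus_fin ` fin_pairs \<subseteq> L2 target" using T_plus_fin_L2 by blast
    show "(\<lambda>x. 0) \<in> T_plus_fin ` fin_pairs"
      by (rule image_eqI[OF _ fin_pairs_lin[OF z z, of 0 0]]) (simp only: lin[OF z z, symmetric], simp)
    fix F assume "F \<in> T_plus_fin ` fin_pairs"
    then obtain f where f: "f \<in> fin_pairs" "F = T_plus_fin f" by blast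
    { fix G assume "G \<in> T_plus_fin ` fin_pairs"
      then obtain g where g: "g \<in> fin_pairs" "G = T_plus_fin g" by blast
      show "(\<lambda>x. F x + G x) \<in> T_plus_fin ` fin_pairs"
        by (rule image_eqI[OF _ fin_pairs_lin[OF f(1) g(1), of 1 1]]) (simp only: lin[OF f(1) g(1),
            symmetric], simp add: f g) }
    show "(\<lambda>x. c * F x) \<in> T_plus_fin ` fin_pairs" for c
      by (rule image_eqI[OF _ fin_pairs_lin[OF f(1) f(1), of c 0]]) (simp only: lin[OF f(1) f(1),
          symmetric], simp add: f)
  qed
qed

interpretation I: L2_subspace target "T_plus_fin ` fin_pairs" by (rule L2_subspace_image)

lemma polynomial_shadow_in_image:
  assumes "polynomial_function p"
  obtains f where "f \<in> fin_pairs" "\<And>x. x \<in> space target \<Longrightarrow>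
     T_plus_fin f x = p (fst x) * (fst x - inverse (fst x)) * shadow_ind v (snd x)"
proof -
  obtain f0 where f0: "f0 \<in> fin_pairs" "\<And>\<xi> \<omega>. cmod \<xi> = 1 \<Longrightarrow> \<omega> \<in> boundary \<Longrightarrow>
     wave_transform f0 \<xi> \<omega> = (inverse \<xi> - inverse (of_nat q) * \<xi>) * shadow_ind v \<omega>"
    using shadow_in_image by blast
  obtain f where f: "f \<in> fin_pairs" "\<And>\<xi> \<omega>. cmod \<xi> = 1 \<Longrightarrow> \<omega> \<in> boundary \<Longrightarrow>
     wave_transform f \<xi> \<omega> = p \<xi> * wave_transform f0 \<xi> \<omega>"
    using multiplierE[OF multiplier_polynomial[OF assms] f0(1)] by blast
  show ?thesis
  proof (rule that[OF f(1)])
    fix x assume "x \<in> space target"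
    then obtain \<xi> \<omega> where x: "x = (\<xi>, \<omega>)" "cmod \<xi> = 1" "\<omega> \<in> boundary" by (auto simp: space_target)
    have "tau \<xi> * (inverse \<xi> - inverse (of_nat q) * \<xi>) = \<xi> - inverse \<xi>"
      using circle_denominators(2)[OF x(2)] by (simp add: tau_def)
    moreover have "T_plus_fin f x = p \<xi> * (tau \<xi> * (inverse \<xi> - inverse (of_nat q) * \<xi>)) * shadow_ind v \<omega>"
      unfolding x(1) T_plus_fin_eq f(2)[OF x(2,3)] f0(2)[OF x(2,3)] by (simp only: ac_simps)
    ultimately show "T_plus_fin f x = p (fst x) * (fst x - inverse (fst x)) * shadow_ind v (snd x)"
      by (simp add: x(1))
  qed
qed

lemma shadow_ind_measurable_target: "(\<lambda>x. shadow_ind v (snd x)) \<in> borel_measurable target"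
  by (rule measurable_compose[OF measurable_snd measurable_level_const[OF level_const_shadow_ind]]) simp

text \<open>
  By the Stone-Weierstrass theorem, \<open>g\<close> is a uniform limit of polynomials on the circle.
\<close>

lemma continuous_shadow_in_closure:
  assumes g: "continuous_on (sphere 0 1) g"
  shows "(\<lambda>x. g (fst x) * (fst x - inverse (fst x)) * shadow_ind v (snd x)) \<in> I.cl"
proof -
  have "\<exists>p. polynomial_function p \<and> (\<forall>\<xi>\<in>sphere 0 1. norm (g \<xi> - p \<xi>) < inverse (real (Suc n)))" for n
    by (rule Stone_Weierstrass_polynomial_function[OF _ g]) auto
  then obtain p where p: "\<And>n. polynomial_function (p n)" "\<And>n \<xi>. cmod \<xi> = 1 \<Longrightarrow> norm (g \<xi> - p n \<xi>)
      < inverse (real (Suc n))"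
    by (metis mem_sphere_0)
  have "\<forall>n. \<exists>f. f \<in> fin_pairs \<and> (\<forall>x\<in>space target. T_plus_fin f x
      = p n (fst x) * (fst x - inverse (fst x)) * shadow_ind v (snd x))"
  proof
    fix n
    show "\<exists>f. f \<in> fin_pairs \<and> (\<forall>x\<in>space target. T_plus_fin f x
        = p n (fst x) * (fst x - inverse (fst x)) * shadow_ind v (snd x))"
    proof (rule polynomial_shadow_in_image[OF p(1)[of n], of v])
      fix f assume "f \<in> fin_pairs" "\<And>x. x \<in> space target \<Longrightarrow> T_plus_fin f x
          = p n (fst x) * (fst x - inverse (fst x)) * shadow_ind v (snd x)"
      then show ?thesis by (intro exI[of _ f] conjI ballI)
    qed
  qed
  from choice[OF this] obtain f where fn: "\<forall>n. f n \<in> fin_pairs \<and> (\<forall>x\<in>space target. T_plus_fin (f n) x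
      = p n (fst x) * (fst x - inverse (fst x)) * shadow_ind v (snd x))" ..
  have f: "f n \<in> fin_pairs"
    "x \<in> space target \<Longrightarrow> T_plus_fin (f n) x = p n (fst x) * (fst x - inverse (fst x)) * shadow_ind v (snd
        x)" for n x
    by (rule fn[rule_format, THEN conjunct1], rule fn[rule_format, THEN conjunct2, rule_format])
  obtain B where B: "\<And>\<xi>. cmod \<xi> = 1 \<Longrightarrow> cmod (g \<xi>) \<le> B" using circle_bound[OF g] by blast
  have "cmod (g 1) \<le> B" by (rule B) simp
  then have B0: "0 \<le> B" by (rule order_trans[OF norm_ge_zero])
  show ?thesis
  proof (rule I.cl_dominated[where G = "\<lambda>n. T_plus_fin (f n)" and W = "\<lambda>_. of_real ((B + 1) * 2)"])
    have "continuous_on (sphere 0 1) (\<lambda>\<xi>. g \<xi> * (\<xi> - inverse \<xi>))" by (intro continuous_intros g) auto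
    from measurable_circle_target[OF this] shadow_ind_measurable_target[of v]
    show "(\<lambda>x. g (fst x) * (fst x - inverse (fst x)) * shadow_ind v (snd x)) \<in> borel_measurable target"
        by (rule borel_measurable_times)
    show "T_plus_fin (f n) \<in> I.cl" for n by (rule I.cl_incl) (use f in blast)
    show "(\<lambda>_. of_real ((B + 1) * 2)) \<in> L2 target" by (rule I.const_L2)
    show "AE x in target. (\<lambda>n. T_plus_fin (f n) x) \<longlonglongrightarrow> g (fst x) * (fst x - inverse (fst x)) * shadow_ind v
        (snd x)"
    proof (rule AE_I2)
      fix x assume x: "x \<in> space target"
      then have c: "cmod (fst x) = 1" by (auto simp: space_target)
      have "(\<lambda>n. p n (fst x) - g (fst x)) \<longlonglongrightarrow> 0"
      proof (rule Lim_null_comparison[OF always_eventually LIMSEQ_inverse_real_of_nat], rule allI)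
        fix n show "norm (p n (fst x) - g (fst x)) \<le> inverse (real (Suc n))"
          using p(2)[OF c, of n] by (simp add: norm_minus_commute)
      qed
      then have "(\<lambda>n. p n (fst x)) \<longlonglongrightarrow> g (fst x)" by (rule LIM_zero_cancel)
      then show "(\<lambda>n. T_plus_fin (f n) x) \<longlonglongrightarrow> g (fst x) * (fst x - inverse (fst x)) * shadow_ind v (snd x)"
        unfolding f(2)[OF x] by (intro tendsto_intros)
    qed
    fix n
    show "AE x in target. cmod (T_plus_fin (f n) x) \<le> cmod (of_real ((B + 1) * 2))"
    proof (rule AE_I2)
      fix x assume x: "x \<in> space target"
      then have c: "cmod (fst x) = 1" by (auto simp: space_target)
      have "norm (p n (fst x)) \<le> norm (g (fst x)) + norm (g (fst x) - p n (fst x))"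
        by (metis norm_triangle_sub norm_minus_commute)
      also have "\<dots> \<le> B + 1"
        using B[OF c] p(2)[OF c, of n] inverse_le_1_iff[of "real (Suc n)"] by (intro add_mono) auto
      finally have 1: "norm (p n (fst x)) \<le> B + 1" .
      have 2: "norm (fst x - inverse (fst x)) \<le> 2"
        using norm_triangle_ineq4[of "fst x" "inverse (fst x)"] c by (simp add: norm_inverse)
      have 3: "norm (shadow_ind v (snd x)) \<le> 1" by simp
      have "cmod (T_plus_fin (f n) x) \<le> (B + 1) * 2 * 1"
        unfolding f(2)[OF x] norm_mult by (intro mult_mono 1 2 3) (use B0 in auto)
      also have "\<dots> = cmod (of_real ((B + 1) * 2))" using B0 by (simp add: norm_mult flip: of_real_add)
      finally show "cmod (T_plus_fin (f n) x) \<le> cmod (of_real ((B + 1) * 2))" .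
    qed
  qed
qed

text \<open>
  The indicator function of \<open>C\<close> is the bounded limit, away from \<open>\<plusminus>1\<close>, of functions
  \<open>g\<^sub>n \<cdot> (\<xi> - \<xi>\<^sup>-\<^sup>1)\<close> with continuous \<open>g\<^sub>n\<close>: one factor of \<open>g\<^sub>n\<close> cuts off around \<open>C\<close>, the other is
  a regularised inverse of \<open>\<xi> - \<xi>\<^sup>-\<^sup>1\<close>.
\<close>

lemma closed_shadow_in_closure:
  assumes C: "closed C" "C \<noteq> {}"
  shows "(\<lambda>x. indicator C (fst x) * shadow_ind v (snd x)) \<in> I.cl"
proof -
  define cut where "cut = (\<lambda>n \<xi>. max 0 (1 - real n * infdist \<xi> C))"
  define r where "r = (\<lambda>n \<xi>. (cmod (\<xi> - inverse \<xi>))\<^sup>2 / ((cmod (\<xi> - inverse \<xi>))\<^sup>2 + inverse (real (Suc n))))"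
  define g where "g = (\<lambda>n \<xi>. cnj (\<xi> - inverse \<xi>) * of_real (cut n \<xi> / ((cmod (\<xi> - inverse \<xi>))\<^sup>2 + inverse
      (real (Suc n)))))"
  have pos: "(cmod (\<xi> - inverse \<xi>))\<^sup>2 + inverse (real (Suc n)) > 0" for \<xi> n
    by (intro add_nonneg_pos) auto
  have gc: "continuous_on (sphere 0 1) (g n)" for n
    unfolding g_def cut_def using pos[THEN less_imp_neq, symmetric]
    by (intro continuous_intros) auto
  have gr: "g n \<xi> * (\<xi> - inverse \<xi>) = of_real (r n \<xi> * cut n \<xi>)" for n \<xi>
  proof -
    have "(\<xi> - inverse \<xi>) * cnj (\<xi> - inverse \<xi>) = of_real ((cmod (\<xi> - inverse \<xi>))\<^sup>2)"
        by (simp only: complex_norm_square)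
    moreover have "g n \<xi> * (\<xi> - inverse \<xi>) = ((\<xi> - inverse \<xi>) * cnj (\<xi> - inverse \<xi>)) * of_real (cut n \<xi> /
        ((cmod (\<xi> - inverse \<xi>))\<^sup>2 + inverse (real (Suc n))))"
      by (simp only: g_def ac_simps)
    ultimately show ?thesis by (simp only: r_def of_real_mult[symmetric]) simp
  qed
  have r01: "0 \<le> r n \<xi>" "r n \<xi> \<le> 1" for n \<xi>
    using pos[of \<xi> n] by (auto simp: r_def divide_le_eq_1)
  have x01: "0 \<le> cut n \<xi>" "cut n \<xi> \<le> 1" for n \<xi>
    by (auto simp: cut_def infdist_nonneg)
  have rl: "(\<lambda>n. r n \<xi>) \<longlonglongrightarrow> 1" if "\<xi> \<noteq> inverse \<xi>" for \<xi>
  proof -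
    have "(\<lambda>n. (cmod (\<xi> - inverse \<xi>))\<^sup>2 / ((cmod (\<xi> - inverse \<xi>))\<^sup>2 + inverse (real (Suc n))))
        \<longlonglongrightarrow> (cmod (\<xi> - inverse \<xi>))\<^sup>2 / ((cmod (\<xi> - inverse \<xi>))\<^sup>2 + 0)"
      by (intro tendsto_intros LIMSEQ_inverse_real_of_nat) (use that in simp)
    then show ?thesis using that by (simp add: r_def)
  qed
  have xl: "(\<lambda>n. cut n \<xi>) \<longlonglongrightarrow> indicator C \<xi>" for \<xi>
  proof (cases "\<xi> \<in> C")
    case True
    then show ?thesis by (simp add: cut_def)
  next
    case False
    then have d: "infdist \<xi> C > 0" using C in_closed_iff_infdist_zero infdist_nonneg less_eq_real_def by metis
    obtain N where N: "real N * infdist \<xi> C > 1" using reals_Archimedean3[OF d] by blast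
    have "cut n \<xi> = 0" if "n \<ge> N" for n
    proof -
      have "real N * infdist \<xi> C \<le> real n * infdist \<xi> C" using that d by (intro mult_right_mono) auto
      then show ?thesis using N by (simp add: cut_def)
    qed
    then show ?thesis using False by (intro tendsto_eventually eventually_sequentiallyI[of N]) simp
  qed
  show ?thesis
  proof (rule I.cl_dominated[where G = "\<lambda>n x. g n (fst x) * (fst x - inverse (fst x)) * shadow_ind v (snd
      x)" and W = "\<lambda>_. 1"])
    have "C \<inter> sphere 0 1 \<in> sets circle_measure"
      unfolding sets_circle using C by (auto simp: sets_restrict_space)
    then have "(\<lambda>\<xi>. indicator (C \<inter> sphere 0 1) \<xi> :: complex) \<in> borel_measurable circle_measure"
      by (rule borel_measurable_indicator)
    then have "(\<lambda>\<xi>. indicator C \<xi> :: complex) \<in> borel_measurable circle_measure"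
      by (rule measurable_cong[THEN iffD1, rotated]) (auto simp: space_circle indicator_def)
    from measurable_compose[OF measurable_fst this] shadow_ind_measurable_target[of v]
    show "(\<lambda>x. indicator C (fst x) * shadow_ind v (snd x)) \<in> borel_measurable target"
        by (rule borel_measurable_times)
    show "(\<lambda>x. g n (fst x) * (fst x - inverse (fst x)) * shadow_ind v (snd x)) \<in> I.cl" for n
      by (rule continuous_shadow_in_closure[OF gc])
    show "(\<lambda>_. 1) \<in> L2 target" by (rule I.const_L2)
    have "AE x in target. fst x \<noteq> inverse (fst x)"
    proof -
      interpret C: finite_measure circle_measure by (rule finite_measure_circle)
      interpret N: finite_measure \<nu> by (rule finite_measure_nu)
      interpret P: pair_sigma_finite circle_measure \<nu> ..
      have "(\<lambda>x. fst x - inverse (fst x)) \<in> borel_measurable target"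
        by (rule measurable_circle_target) (intro continuous_intros, auto)
      from measurable_sets[OF this, of "- {0}"]
      have "{x \<in> space target. fst x \<noteq> inverse (fst x)} \<in> sets target"
        by (simp add: vimage_def Int_def conj_commute)
      then show ?thesis
      proof (rule P.AE_pair_measure)
        show "AE \<xi> in circle_measure. AE \<omega> in \<nu>. fst (\<xi>, \<omega>) \<noteq> inverse (fst (\<xi>, \<omega>))"
          using AE_circle_not_real by eventually_elim simp
      qed
    qed
    then show "AE x in target. (\<lambda>n. g n (fst x) * (fst x - inverse (fst x)) * shadow_ind v (snd x))
        \<longlonglongrightarrow> indicator C (fst x) * shadow_ind v (snd x)"
    proof eventually_elim
      case (elim x)
      have "(\<lambda>n. of_real (r n (fst x) * cut n (fst x)) * shadow_ind v (snd x))
          \<longlonglongrightarrow> of_real (1 * indicator C (fst x)) * shadow_ind v (snd x)"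
        by (intro tendsto_intros rl xl elim)
      then show ?case unfolding gr by (simp add: of_real_indicator)
    qed
    show "AE x in target. cmod (g n (fst x) * (fst x - inverse (fst x)) * shadow_ind v (snd x)) \<le> cmod 1" for n
    proof (rule AE_I2)
      fix x :: "complex \<times> (nat \<Rightarrow> 'v) set"
      have "r n (fst x) * cut n (fst x) \<le> 1 * 1" by (intro mult_mono r01 x01) auto
      moreover have "0 \<le> r n (fst x) * cut n (fst x)" by (intro mult_nonneg_nonneg r01 x01)
      ultimately show "cmod (g n (fst x) * (fst x - inverse (fst x)) * shadow_ind v (snd x)) \<le> cmod 1"
        unfolding gr using r01(1)[of n "fst x"] x01(1)[of n "fst x"] by (simp add: norm_mult)
    qed
  qed
qed

text \<open>
  Indicator functions of products are reached by treating one factor after the other, first the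
  circle, then the boundary; the products generate the \<open>\<sigma>\<close>-algebra of the product space.
\<close>

theorem image_dense:
  assumes "F \<in> L2 target" shows "F \<in> L2_closure target (T_plus_fin ` fin_pairs)"
proof (rule I.cl_eq_L2[OF _ assms])
  have fb: "fst \<in> measurable target borel"
    using measurable_circle_target[of "\<lambda>\<xi>. \<xi>"] by (simp add: continuous_on_id)
  have indeq: "(indicator S x :: complex) = indicator S' x" if "x \<in> S \<longleftrightarrow> x \<in> S'"
      for S S' and x :: "complex \<times> (nat \<Rightarrow> 'v) set"
    using that by (simp add: indicator_def)
  have 1: "(\<lambda>x. indicator (fst -` S \<inter> (snd -` shadow v \<inter> space target)) x) \<in> I.cl" if "S \<in> sets borel" for S v
  proof (rule I.cl_indicator_dynkin[OF fb _ _ _ _ _ _ that, of "Collect closed"])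
    show "sets borel = sigma_sets (space borel) (Collect (closed :: complex set \<Rightarrow> bool))"
      by (simp add: borel_eq_closed)
    show "Int_stable (Collect (closed :: complex set \<Rightarrow> bool))" by (auto simp: Int_stable_def)
    show sv: "snd -` shadow v \<inter> space target \<in> sets target"
      by (rule measurable_sets[OF measurable_snd sets_shadow])
    have basic: "(\<lambda>x. indicator (fst -` C \<inter> (snd -` shadow v \<inter> space target)) x) \<in> I.cl" if "closed C" for C
    proof (cases "C = {}")
      case True
      then show ?thesis using I.cl_incl[OF I.zero] by simp
    next
      case False
      show ?thesis
      proof (rule I.cl_cong[OF closed_shadow_in_closure[OF that False, of v]])
        have "fst -` C \<inter> space target \<in> sets target" using measurable_sets[OF fb, of C] that by simp
        then have "(fst -` C \<inter> space target) \<inter> (snd -` shadow v \<inter> space target) \<in> sets target" using sv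
            by (rule sets.Int)
        also have "(fst -` C \<inter> space target) \<inter> (snd -` shadow v \<inter> space target)
            = fst -` C \<inter> (snd -` shadow v \<inter> space target)" by blast
        finally show "(\<lambda>x. indicator (fst -` C \<inter> (snd -` shadow v \<inter> space target)) x) \<in> borel_measurable target"
          by (rule borel_measurable_indicator)
        show "AE x in target. indicator C (fst x) * shadow_ind v (snd x)
            = indicator (fst -` C \<inter> (snd -` shadow v \<inter> space target)) x"
          by (rule AE_I2) (auto simp: indicator_def)
      qed
    qed
    show "(\<lambda>x. indicator (snd -` shadow v \<inter> space target) x) \<in> I.cl" using basic[of UNIV] by simp
    show "(\<lambda>x. indicator (fst -` S \<inter> (snd -` shadow v \<inter> space target)) x) \<in> I.cl" if "S \<in> Collect closed" for S
      using basic that by simp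
  qed simp
  have 2: "(\<lambda>x. indicator (snd -` A \<inter> (fst -` S \<inter> space target)) x) \<in> I.cl"
      if S: "S \<in> sets borel" and A: "A \<in> sets \<nu>" for S A
  proof (rule I.cl_indicator_dynkin[OF measurable_snd _ Int_stable_shadows _ _ _ _ A])
    show "sets \<nu> = sigma_sets (space \<nu>) (insert {} (range shadow))" by (simp add: sets_nu_shadows space_nu)
    show "insert {} (range shadow) \<subseteq> Pow (space \<nu>)" by (auto simp: space_nu shadow_def)
    show "fst -` S \<inter> space target \<in> sets target" by (rule measurable_sets[OF fb S])
    have basic: "(\<lambda>x. indicator (snd -` shadow v \<inter> (fst -` S \<inter> space target)) x) \<in> I.cl" for v
      using 1[OF S, of v] by (simp only: Int_left_commute)
    have "snd -` shadow x0 \<inter> (fst -` S \<inter> space target) = fst -` S \<inter> space target"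
      by (auto simp: shadow_root space_target)
    then show "(\<lambda>x. indicator (fst -` S \<inter> space target) x) \<in> I.cl" using basic[of x0] by simp
    show "(\<lambda>x. indicator (snd -` B \<inter> (fst -` S \<inter> space target)) x) \<in> I.cl"
        if "B \<in> insert {} (range shadow)" for B
      using that basic I.cl_incl[OF I.zero] by auto
  qed
  fix S assume S: "S \<in> sets target"
  let ?G = "{a \<times> b |a b. a \<in> sets circle_measure \<and> b \<in> sets \<nu>}"
  have basic: "(\<lambda>x. indicator (id -` R \<inter> space target) x) \<in> I.cl" if R: "R \<in> ?G" for R
  proof -
    obtain a b where ab: "R = a \<times> b" "a \<in> sets circle_measure" "b \<in> sets \<nu>" using R by blast
    have "a \<in> sets borel" using ab(2) unfolding sets_circle by (auto simp: sets_restrict_space)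
    from 2[OF this ab(3)] show ?thesis
      by (rule back_subst[of "\<lambda>z. z \<in> I.cl"]) (auto simp: ab(1) indicator_def fun_eq_iff)
  qed
  have "(\<lambda>x. indicator (id -` S \<inter> space target) x) \<in> I.cl"
  proof (rule I.cl_indicator_dynkin[OF _ _ Int_stable_pair_measure_generator _ _ _ _ S])
    show "id \<in> measurable target target" by (rule measurable_ident)
    show "sets target = sigma_sets (space target) ?G" by (simp only: sets_pair_measure space_pair_measure)
    show "?G \<subseteq> Pow (space target)"
      unfolding space_pair_measure by (rule pair_measure_closed)
    show "space target \<in> sets target" by (rule sets.top)
    have "space circle_measure \<times> space \<nu> \<in> ?G" by blast
    from basic[OF this] show "(\<lambda>x. indicator (space target) x) \<in> I.cl" by (simp add: space_pair_measure)
  qed (use basic in blast)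
  moreover have "id -` S \<inter> space target = S" using sets.sets_into_space[OF S] by auto
  ultimately show "(\<lambda>x. indicator S x) \<in> I.cl" by simp
qed

end

section \<open>Extension to the completion\<close>

context regular_tree_measure begin

interpretation N: finite_measure \<nu> by (rule finite_measure_nu)
interpretation C: finite_measure circle_measure by (rule finite_measure_circle)
interpretation P: pair_sigma_finite circle_measure \<nu> ..
interpretation T: finite_measure target by (rule finite_measure_target)

text \<open>
  The factor by which \<open>T\<^sub>+\<close> scales the inner product.
\<close>

definition iso_const :: real where "iso_const = 4 * pi * real q / (real q + 1)"

lemma iso_const_pos: "iso_const > 0"
  using q_ge_2 by (simp add: iso_const_def)

lemma fin_pairs_diff:
  assumes "f \<in> fin_pairs" "g \<in> fin_pairs"
  shows "f - g \<in> fin_pairs" "T_plus_fin (f - g) x = T_plus_fin f x - T_plus_fin g x"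
proof -
  have e: "f - g = (\<lambda>v. 1 * fst f v + (-1) * fst g v, \<lambda>v. 1 * snd f v + (-1) * snd g v)"
    by (rule prod_eqI) (simp_all add: fun_eq_iff)
  show "f - g \<in> fin_pairs" unfolding e by (rule fin_pairs_lin[OF assms])
  show "T_plus_fin (f - g) x = T_plus_fin f x - T_plus_fin g x"
    unfolding e by (cases x) (simp only: T_plus_fin_eq wave_transform_lin[OF assms], simp add: algebra_simps)
qed

lemma energy_eq_L2_inner:
  assumes "f \<in> fin_pairs" "g \<in> fin_pairs"
  shows "energy f g = L2_inner target (T_plus_fin f) (T_plus_fin g) / of_real iso_const"
proof -
  have "complex_of_real iso_const \<noteq> 0" using iso_const_pos by simp
  then show ?thesis using T_plus_fin_isometry[OF assms, folded iso_const_def] by simp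
qed

lemma energy_norm_diff:
  assumes "f \<in> fin_pairs" "g \<in> fin_pairs"
  shows "energy_norm (f - g) = sqrt (l2_dist_sq target (T_plus_fin f) (T_plus_fin g) / iso_const)"
proof -
  have "energy (f - g) (f - g) = of_real (l2sq target (T_plus_fin (f - g)) / iso_const)"
    unfolding energy_eq_L2_inner[OF fin_pairs_diff(1)[OF assms] fin_pairs_diff(1)[OF assms]] L2_inner_self
        by simp
  moreover have "T_plus_fin (f - g) = (\<lambda>x. T_plus_fin f x - T_plus_fin g x)"
    by (rule ext) (rule fin_pairs_diff(2)[OF assms])
  ultimately show ?thesis by (simp add: energy_norm_def)
qed

lemma energy_CauchyD:
  assumes "X \<in> energy_Cauchy"
  shows "X n \<in> fin_pairs" "e > 0 \<Longrightarrow> \<exists>N. \<forall>m\<ge>N. \<forall>n\<ge>N. energy_norm (X m - X n) < e"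
  using assms by (auto simp: energy_Cauchy_def)

lemma energy_norm_tendsto_zero:
  assumes "\<And>n. X n \<in> fin_pairs" "\<And>n. Y n \<in> fin_pairs" "(\<lambda>n. energy_norm (X n - Y n)) \<longlonglongrightarrow> 0"
  shows "(\<lambda>n. l2_dist_sq target (T_plus_fin (X n)) (T_plus_fin (Y n))) \<longlonglongrightarrow> 0"
proof -
  have e: "l2_dist_sq target (T_plus_fin (X n)) (T_plus_fin (Y n))
      = iso_const * (energy_norm (X n - Y n))\<^sup>2" for n
    unfolding energy_norm_diff[OF assms(1,2)] using iso_const_pos by (simp add: l2sq_nonneg)
  have "(\<lambda>n. iso_const * (energy_norm (X n - Y n))\<^sup>2) \<longlonglongrightarrow> iso_const * 0\<^sup>2" by (intro tendsto_intros assms(3))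
  then show ?thesis unfolding e by simp
qed

lemma energy_spaceE:
  assumes "F \<in> energy_space"
  obtains X where "X \<in> F" "X \<in> energy_Cauchy" "F = energy_equiv `` {X}"
proof -
  obtain X where X: "X \<in> energy_Cauchy" "F = energy_equiv `` {X}"
    using assms unfolding energy_space_def by (rule quotientE)
  have "energy_norm (X n - X n) = 0" for n
    unfolding energy_norm_diff[OF energy_CauchyD(1)[OF X(1)] energy_CauchyD(1)[OF X(1)]] by (simp add: l2sq_def)
  then have "(X, X) \<in> energy_equiv" using X(1) by (simp add: energy_equiv_def)
  then show ?thesis using that X by blast
qed

lemma energy_space_member:
  assumes "F \<in> energy_space" "X \<in> F" shows "X \<in> energy_Cauchy" "X n \<in> fin_pairs"
proof -
  obtain Y where "F = energy_equiv `` {Y}" using energy_spaceE[OF assms(1)] by blast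
  with assms(2) have "(Y, X) \<in> energy_equiv" by blast
  then show "X \<in> energy_Cauchy" by (simp add: energy_equiv_def)
  then show "X n \<in> fin_pairs" by (rule energy_CauchyD(1))
qed

text \<open>
  A choice of the limit, which is determined up to null sets.
\<close>

definition T_ext :: "(nat \<Rightarrow> ('v \<Rightarrow> complex) \<times> ('v \<Rightarrow> complex)) set \<Rightarrow> complex \<times> (nat \<Rightarrow> 'v) set \<Rightarrow> complex" where
  "T_ext F = (SOME G. G \<in> L2 target \<and> (\<forall>X\<in>F. (\<lambda>n. l2_dist_sq target (T_plus_fin (X n)) G) \<longlonglongrightarrow> 0))"

text \<open>
  By the isometry, the images of an energy Cauchy sequence form a Cauchy sequence in \<open>L\<^sup>2\<close>, and
  equivalent sequences have the same limit.
\<close>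

lemma T_ext:
  assumes "F \<in> energy_space"
  shows "T_ext F \<in> L2 target"
    "X \<in> F \<Longrightarrow> (\<lambda>n. l2_dist_sq target (T_plus_fin (X n)) (T_ext F)) \<longlonglongrightarrow> 0"
proof -
  obtain X0 where X0: "X0 \<in> energy_Cauchy" "F = energy_equiv `` {X0}" using energy_spaceE[OF assms] by blast
  note fX = energy_CauchyD(1)[OF X0(1)]
  have "\<exists>G\<in>L2 target. (\<lambda>n. l2_dist_sq target (T_plus_fin (X0 n)) G) \<longlonglongrightarrow> 0"
  proof (rule T.L2_complete)
    show "T_plus_fin (X0 n) \<in> L2 target" for n by (rule T_plus_fin_L2[OF fX])
    fix e :: real assume e: "e > 0"
    then have "sqrt (e / iso_const) > 0" using iso_const_pos by simp
    from energy_CauchyD(2)[OF X0(1) this] obtain N where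
      N: "\<And>m n. m \<ge> N \<Longrightarrow> n \<ge> N \<Longrightarrow> energy_norm (X0 m - X0 n) < sqrt (e / iso_const)" by blast
    have "l2_dist_sq target (T_plus_fin (X0 m)) (T_plus_fin (X0 n)) < e" if "m \<ge> N" "n \<ge> N" for m n
    proof -
      have "l2_dist_sq target (T_plus_fin (X0 m)) (T_plus_fin (X0 n)) / iso_const < e / iso_const"
        using N[OF that] unfolding energy_norm_diff[OF fX fX] by simp
      then show ?thesis using iso_const_pos by (simp add: divide_less_cancel)
    qed
    then show "\<exists>N. \<forall>m\<ge>N. \<forall>n\<ge>N. l2_dist_sq target (T_plus_fin (X0 m)) (T_plus_fin (X0 n)) < e" by blast
  qed
  then obtain G where G: "G \<in> L2 target" "(\<lambda>n. l2_dist_sq target (T_plus_fin (X0 n)) G) \<longlonglongrightarrow> 0" by blast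
  have "(\<lambda>n. l2_dist_sq target (T_plus_fin (Y n)) G) \<longlonglongrightarrow> 0" if "Y \<in> F" for Y
  proof -
    have Y: "Y \<in> energy_Cauchy" "(\<lambda>n. energy_norm (X0 n - Y n)) \<longlonglongrightarrow> 0"
      using that X0(2) by (auto simp: energy_equiv_def)
    note fY = energy_CauchyD(1)[OF Y(1)]
    have d: "(\<lambda>n. l2_dist_sq target (T_plus_fin (X0 n)) (T_plus_fin (Y n))) \<longlonglongrightarrow> 0"
      by (rule energy_norm_tendsto_zero[OF fX fY Y(2)])
    have "(\<lambda>n. 2 * l2_dist_sq target (T_plus_fin (Y n)) (T_plus_fin (X0 n)) + 2 * l2_dist_sq target
        (T_plus_fin (X0 n)) G) \<longlonglongrightarrow> 2 * 0 + 2 * 0"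
      unfolding l2sq_minus_commute[of _ "T_plus_fin (Y _)"] by (intro tendsto_intros d G)
    then have lim: "(\<lambda>n. 2 * l2_dist_sq target (T_plus_fin (Y n)) (T_plus_fin (X0 n)) + 2 * l2_dist_sq
        target (T_plus_fin (X0 n)) G) \<longlonglongrightarrow> 0" by simp
    have le: "norm (l2_dist_sq target (T_plus_fin (Y n)) G)
        \<le> 2 * l2_dist_sq target (T_plus_fin (Y n)) (T_plus_fin (X0 n)) + 2 * l2_dist_sq target (T_plus_fin
        (X0 n)) G" for n
      using l2sq_triangle[OF T_plus_fin_L2[OF fY[of n]] T_plus_fin_L2[OF fX[of n]] G(1)]
          by (simp add: l2sq_nonneg)
    show ?thesis by (rule Lim_null_comparison[OF always_eventually[OF allI[OF le]] lim])
  qed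
  with G(1) have "\<exists>G. G \<in> L2 target \<and> (\<forall>X\<in>F. (\<lambda>n. l2_dist_sq target (T_plus_fin (X n)) G) \<longlonglongrightarrow> 0)" by blast
  from someI_ex[OF this, folded T_ext_def]
  show "T_ext F \<in> L2 target" "X \<in> F \<Longrightarrow> (\<lambda>n. l2_dist_sq target (T_plus_fin (X n)) (T_ext F)) \<longlonglongrightarrow> 0" by blast+
qed

lemma l2sq_tendsto:
  assumes "\<And>n. A n \<in> L2 M" "B \<in> L2 M" "(\<lambda>n. l2_dist_sq M (A n) B) \<longlonglongrightarrow> 0"
  shows "(\<lambda>n. l2sq M (A n)) \<longlonglongrightarrow> l2sq M B"
proof -
  have "(\<lambda>n. complex_of_real (l2sq M (A n))) \<longlonglongrightarrow> complex_of_real (l2sq M B)"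
    unfolding L2_inner_self[symmetric] by (rule L2_inner_tendsto) (rule assms)+
  then show ?thesis by (simp only: tendsto_of_real_iff)
qed

lemma energy_dist_eq:
  assumes "F \<in> energy_space" "G \<in> energy_space"
  shows "energy_dist F G = sqrt (l2_dist_sq target (T_ext F) (T_ext G) / iso_const)"
proof -
  let ?r = "sqrt (l2_dist_sq target (T_ext F) (T_ext G) / iso_const)"
  have conv: "(\<lambda>n. energy_norm (X n - Y n)) \<longlonglongrightarrow> ?r" if X: "X \<in> F" and Y: "Y \<in> G" for X Y
  proof -
    note fX = energy_space_member(2)[OF assms(1) X] and fY = energy_space_member(2)[OF assms(2) Y]
    note tX = T_plus_fin_L2[OF fX] and tY = T_plus_fin_L2[OF fY]
    have "(\<lambda>n. l2_dist_sq target (T_plus_fin (X n)) (T_plus_fin (Y n))) \<longlonglongrightarrow> l2_dist_sq target (T_ext F) (T_ext G)"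
    proof (rule l2sq_tendsto)
      have le: "norm (l2sq target (\<lambda>x. (T_plus_fin (X n) x - T_plus_fin (Y n) x) - (T_ext F x - T_ext G x)))
        \<le> 2 * l2_dist_sq target (T_plus_fin (X n)) (T_ext F) + 2 * l2_dist_sq target (T_plus_fin (Y n))
            (T_ext G)" for n
      proof -
        have "l2sq target (\<lambda>x. (T_plus_fin (X n) x - T_plus_fin (Y n) x) - (T_ext F x - T_ext G x))
          = l2sq target (\<lambda>x. (T_plus_fin (X n) x - T_ext F x) + (T_ext G x - T_plus_fin (Y n) x))"
          by (simp add: algebra_simps)
        also have "\<dots> \<le> 2 * l2_dist_sq target (T_plus_fin (X n)) (T_ext F) + 2 * l2_dist_sq target (T_ext
            G) (T_plus_fin (Y n))"
          by (intro L2_add(2) L2_diff tX tY T_ext(1) assms)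
        finally show ?thesis using l2sq_minus_commute[of target "T_ext G"] by (simp add: l2sq_nonneg)
      qed
      have "(\<lambda>n. 2 * l2_dist_sq target (T_plus_fin (X n)) (T_ext F) + 2 * l2_dist_sq target (T_plus_fin (Y
          n)) (T_ext G)) \<longlonglongrightarrow> 2 * 0 + 2 * 0"
        by (intro tendsto_intros T_ext(2) assms X Y)
      then have lim: "(\<lambda>n. 2 * l2_dist_sq target (T_plus_fin (X n)) (T_ext F) + 2 * l2_dist_sq target
          (T_plus_fin (Y n)) (T_ext G)) \<longlonglongrightarrow> 0" by simp
      show "(\<lambda>n. l2sq target (\<lambda>x. (T_plus_fin (X n) x - T_plus_fin (Y n) x) - (T_ext F x - T_ext G x))) \<longlonglongrightarrow> 0"
        by (rule Lim_null_comparison[OF always_eventually[OF allI[OF le]] lim])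
    qed (intro L2_diff tX tY T_ext(1) assms)+
    then show ?thesis unfolding energy_norm_diff[OF fX fY] using iso_const_pos by (intro tendsto_intros) auto
  qed
  obtain X Y where XY: "X \<in> F" "Y \<in> G" using energy_spaceE[OF assms(1)] energy_spaceE[OF assms(2)] by metis
  show ?thesis unfolding energy_dist_def
  proof (rule the_equality)
    show "\<forall>X\<in>F. \<forall>Y\<in>G. (\<lambda>n. energy_norm (X n - Y n)) \<longlonglongrightarrow> ?r" using conv by blast
    fix r assume "\<forall>X\<in>F. \<forall>Y\<in>G. (\<lambda>n. energy_norm (X n - Y n)) \<longlonglongrightarrow> r"
    then have "(\<lambda>n. energy_norm (X n - Y n)) \<longlonglongrightarrow> r" using XY by blast
    then show "r = ?r" using conv[OF XY] by (rule LIMSEQ_unique)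
  qed
qed

lemma energy_inner_eq:
  assumes "F \<in> energy_space" "G \<in> energy_space"
  shows "L2_inner target (T_ext F) (T_ext G) = of_real iso_const * energy_inner F G"
proof -
  let ?c = "L2_inner target (T_ext F) (T_ext G) / of_real iso_const"
  have conv: "(\<lambda>n. energy (X n) (Y n)) \<longlonglongrightarrow> ?c" if X: "X \<in> F" and Y: "Y \<in> G" for X Y
  proof -
    note fX = energy_space_member(2)[OF assms(1) X] and fY = energy_space_member(2)[OF assms(2) Y]
    have "(\<lambda>n. L2_inner target (T_plus_fin (X n)) (T_plus_fin (Y n))) \<longlonglongrightarrow> L2_inner target (T_ext F) (T_ext G)"
      by (rule L2_inner_tendsto) (intro T_plus_fin_L2 fX fY T_ext assms X Y)+
    then show ?thesis unfolding energy_eq_L2_inner[OF fX fY] using iso_const_pos by (intro tendsto_intros) auto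
  qed
  obtain X Y where XY: "X \<in> F" "Y \<in> G" using energy_spaceE[OF assms(1)] energy_spaceE[OF assms(2)] by metis
  have "energy_inner F G = ?c" unfolding energy_inner_def
  proof (rule the_equality)
    show "\<forall>X\<in>F. \<forall>Y\<in>G. (\<lambda>n. energy (X n) (Y n)) \<longlonglongrightarrow> ?c" using conv by blast
    fix r assume "\<forall>X\<in>F. \<forall>Y\<in>G. (\<lambda>n. energy (X n) (Y n)) \<longlonglongrightarrow> r"
    then have "(\<lambda>n. energy (X n) (Y n)) \<longlonglongrightarrow> r" using XY by blast
    then show "r = ?c" using conv[OF XY] by (rule LIMSEQ_unique)
  qed
  then show ?thesis using iso_const_pos by simp
qed

lemma energy_embed:
  assumes "f \<in> fin_pairs"
  shows "energy_embed f \<in> energy_space" "(\<lambda>_. f) \<in> energy_embed f"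
proof -
  have z: "energy_norm (f - f) = 0" unfolding energy_norm_diff[OF assms assms] by (simp add: l2sq_def)
  have c: "(\<lambda>_. f) \<in> energy_Cauchy" using assms z by (simp add: energy_Cauchy_def)
  then show "energy_embed f \<in> energy_space"
    unfolding energy_space_def energy_embed_def by (rule quotientI)
  show "(\<lambda>_. f) \<in> energy_embed f" using c z by (simp add: energy_embed_def energy_equiv_def)
qed

lemma T_ext_embed:
  assumes "f \<in> fin_pairs" shows "AE x in target. T_ext (energy_embed f) x = T_plus_fin f x"
proof (rule L2_limit_unique[where X = "\<lambda>_. T_plus_fin f"])
  show "(\<lambda>n. l2_dist_sq target (T_plus_fin f) (T_ext (energy_embed f))) \<longlonglongrightarrow> 0"
    by (rule T_ext(2)[OF energy_embed[OF assms]])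
  show "(\<lambda>n. l2_dist_sq target (T_plus_fin f) (T_plus_fin f)) \<longlonglongrightarrow> 0" by (simp add: l2sq_def)
qed (intro T_plus_fin_L2 T_ext(1) energy_embed assms)+

lemma energy_embed_dense:
  assumes "F \<in> energy_space" "X \<in> F" shows "(\<lambda>n. energy_dist (energy_embed (X n)) F) \<longlonglongrightarrow> 0"
proof -
  note fX = energy_space_member(2)[OF assms]
  have "l2_dist_sq target (T_ext (energy_embed (X n))) (T_ext F)
      = l2_dist_sq target (T_plus_fin (X n)) (T_ext F)" for n
  proof (rule l2sq_cong_AE)
    show "AE x in target. T_ext (energy_embed (X n)) x - T_ext F x = T_plus_fin (X n) x - T_ext F x"
      using T_ext_embed[OF fX[of n]] by eventually_elim simp
  qed (intro L2_measurable L2_diff T_ext(1) energy_embed T_plus_fin_L2 fX assms)+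
  then have e: "energy_dist (energy_embed (X n)) F = sqrt (l2_dist_sq target (T_plus_fin (X n)) (T_ext F)
      / iso_const)" for n
    unfolding energy_dist_eq[OF energy_embed(1)[OF fX] assms(1)] by simp
  have "(\<lambda>n. sqrt (l2_dist_sq target (T_plus_fin (X n)) (T_ext F) / iso_const)) \<longlonglongrightarrow> sqrt (0 / iso_const)"
    using iso_const_pos by (intro tendsto_intros T_ext(2) assms) auto
  then show ?thesis unfolding e by simp
qed

text \<open>
  A continuous map on the completion is determined by its values on finitely supported pairs. It
  is applied to both \<open>T\<^sub>+\<close> and \<open>R\<^sub>+\<close>.
\<close>

lemma continuous_extension_limit:
  assumes S: "continuous_into_L2 S" and A: "\<And>f. f \<in> fin_pairs \<Longrightarrow> A f \<in> L2 target"
    and SA: "\<And>f. f \<in> fin_pairs \<Longrightarrow> AE x in target. S (energy_embed f) x = A f x"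
    and F: "F \<in> energy_space" "X \<in> F"
  shows "S F \<in> L2 target" "(\<lambda>n. l2_dist_sq target (A (X n)) (S F)) \<longlonglongrightarrow> 0"
proof -
  have SL: "S G \<in> L2 target" if "G \<in> energy_space" for G using S that unfolding continuous_into_L2_def by blast
  show "S F \<in> L2 target" by (rule SL[OF F(1)])
  note fX = energy_space_member(2)[OF F]
  have e: "l2_dist_sq target (A (X n)) (S F) = (L2_dist target (S (energy_embed (X n))) (S F))\<^sup>2" for n
  proof -
    have "l2_dist_sq target (S (energy_embed (X n))) (S F) = l2_dist_sq target (A (X n)) (S F)"
    proof (rule l2sq_cong_AE)
      show "AE x in target. S (energy_embed (X n)) x - S F x = A (X n) x - S F x"
        using SA[OF fX[of n]] by eventually_elim simp
    qed (intro L2_measurable L2_diff SL energy_embed A fX F)+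
    then show ?thesis unfolding L2_dist_l2sq by (simp add: l2sq_nonneg)
  qed
  have "(\<lambda>n. L2_dist target (S (energy_embed (X n))) (S F)) \<longlonglongrightarrow> 0"
  proof (rule LIMSEQ_I)
    fix r :: real assume "r > 0"
    then obtain d where d: "d > 0" "\<And>G. G \<in> energy_space \<Longrightarrow> energy_dist G F < d \<Longrightarrow> L2_dist target (S G) (S F) < r"
      using S F(1) unfolding continuous_into_L2_def by blast
    obtain N where N: "\<And>n. n \<ge> N \<Longrightarrow> energy_dist (energy_embed (X n)) F < d"
      using order_tendstoD(2)[OF energy_embed_dense[OF F] d(1)] unfolding eventually_sequentially by blast
    have "norm (L2_dist target (S (energy_embed (X n))) (S F) - 0) < r" if "n \<ge> N" for n
      using d(2)[OF energy_embed(1)[OF fX[of n]] N[OF that]] by (simp add: L2_dist_l2sq l2sq_nonneg)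
    then show "\<exists>no. \<forall>n\<ge>no. norm (L2_dist target (S (energy_embed (X n))) (S F) - 0) < r" by blast
  qed
  then have "(\<lambda>n. (L2_dist target (S (energy_embed (X n))) (S F))\<^sup>2) \<longlonglongrightarrow> 0\<^sup>2" by (intro tendsto_intros)
  then show "(\<lambda>n. l2_dist_sq target (A (X n)) (S F)) \<longlonglongrightarrow> 0" unfolding e by simp
qed

lemma is_T_plus_T_ext: "is_T_plus T_ext"
  unfolding is_T_plus_def continuous_into_L2_def
proof (intro conjI ballI allI impI)
  show "T_ext f \<in> L2 target" if "f \<in> energy_space" for f by (rule T_ext(1)[OF that])
  show "AE x in target. T_ext (energy_embed f) x = T_plus_fin f x" if "f \<in> fin_pairs" for f
      by (rule T_ext_embed[OF that])
  fix F :: "(nat \<Rightarrow> ('v \<Rightarrow> complex) \<times> ('v \<Rightarrow> complex)) set" and e :: real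
  assume F: "F \<in> energy_space" and e: "e > 0"
  have s: "sqrt iso_const > 0" using iso_const_pos by simp
  have "L2_dist target (T_ext G) (T_ext F) < e" if "G \<in> energy_space" "energy_dist G F
      < e / sqrt iso_const" for G
    using that(2) s unfolding energy_dist_eq[OF that(1) F] L2_dist_l2sq real_sqrt_divide
        by (simp add: divide_less_cancel)
  then show "\<exists>d>0. \<forall>G\<in>energy_space. energy_dist G F < d \<longrightarrow> L2_dist target (T_ext G) (T_ext F) < e"
    using e s by (intro exI[of _ "e / sqrt iso_const"]) auto
qed

lemma is_T_plus_unique:
  assumes "is_T_plus T" "F \<in> energy_space" shows "T F \<in> L2 target" "AE x in target. T F x = T_ext F x"
proof -
  obtain X where X: "X \<in> F" using energy_spaceE[OF assms(2)] by blast
  have c: "continuous_into_L2 T" "\<And>f. f \<in> fin_pairs \<Longrightarrow> AE x in target. T (energy_embed f) x = T_plus_fin f x"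
    using assms(1) by (simp_all add: is_T_plus_def)
  show L: "T F \<in> L2 target"
    by (rule continuous_extension_limit(1)[OF c(1) T_plus_fin_L2 c(2) assms(2) X])
  have lim: "(\<lambda>n. l2_dist_sq target (T_plus_fin (X n)) (T F)) \<longlonglongrightarrow> 0"
    by (rule continuous_extension_limit(2)[OF c(1) T_plus_fin_L2 c(2) assms(2) X])
  show "AE x in target. T F x = T_ext F x"
    by (rule L2_limit_unique[OF _ L T_ext(1)[OF assms(2)] lim T_ext(2)[OF assms(2) X]])
       (intro T_plus_fin_L2 energy_space_member(2)[OF assms(2) X])
qed

definition R_ext :: "(nat \<Rightarrow> ('v \<Rightarrow> complex) \<times> ('v \<Rightarrow> complex)) set \<Rightarrow> complex \<times> (nat \<Rightarrow> 'v) set \<Rightarrow> complex" where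
  "R_ext F = (\<lambda>x. rho (fst x) * T_ext F x)"

lemma rho_bound:
  obtains B where "B > 0" "\<And>F. F \<in> L2 target \<Longrightarrow> l2sq target (\<lambda>x. rho (fst x) * F x) \<le> B\<^sup>2 * l2sq target F"
proof -
  obtain B where B: "\<And>\<xi>. cmod \<xi> = 1 \<Longrightarrow> cmod (rho \<xi>) \<le> B" using circle_bound[OF continuous_rho] by blast
  have "l2sq target (\<lambda>x. rho (fst x) * F x) \<le> (\<bar>B\<bar> + 1)\<^sup>2 * l2sq target F" if "F \<in> L2 target" for F
  proof (rule L2_bounded_mult(2)[OF that measurable_circle_target[OF continuous_rho]])
    fix x assume "x \<in> space target"
    then have "cmod (fst x) = 1" by (auto simp: space_target)
    from B[OF this] show "cmod (rho (fst x)) \<le> \<bar>B\<bar> + 1" by linarith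
  qed
  then show ?thesis using that[of "\<bar>B\<bar> + 1"] by simp
qed

lemma R_ext_L2: "F \<in> energy_space \<Longrightarrow> R_ext F \<in> L2 target"
  unfolding R_ext_def by (rule L2_circle_mult[OF continuous_rho T_ext(1)])

lemma is_R_plus_R_ext: "is_R_plus R_ext"
  unfolding is_R_plus_def continuous_into_L2_def
proof (intro conjI ballI allI impI)
  show "R_ext f \<in> L2 target" if "f \<in> energy_space" for f by (rule R_ext_L2[OF that])
  show "\<exists>G. is_R_plus_fin f G \<and> (AE x in target. R_ext (energy_embed f) x = G x)" if "f \<in> fin_pairs" for f
  proof (intro exI conjI)
    show "is_R_plus_fin f (R_plus_fin f)" by (rule R_plus_fin_correct[OF that])
    show "AE x in target. R_ext (energy_embed f) x = R_plus_fin f x"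
      using T_ext_embed[OF that] by eventually_elim (simp add: R_ext_def R_plus_fin_eq)
  qed
  fix F :: "(nat \<Rightarrow> ('v \<Rightarrow> complex) \<times> ('v \<Rightarrow> complex)) set" and e :: real
  assume F: "F \<in> energy_space" and e: "e > 0"
  obtain B where B: "B > 0" "\<And>F. F \<in> L2 target \<Longrightarrow> l2sq target (\<lambda>x. rho (fst x) * F x) \<le> B\<^sup>2 * l2sq target F"
    using rho_bound by blast
  have cT: "continuous_into_L2 T_ext" using is_T_plus_T_ext unfolding is_T_plus_def by (rule conjunct1)
  have eB: "e / B > 0" using e B(1) by simp
  obtain d where d: "d > 0" "\<And>G. G \<in> energy_space \<Longrightarrow> energy_dist G F < d
      \<Longrightarrow> L2_dist target (T_ext G) (T_ext F) < e / B"
    using cT[unfolded continuous_into_L2_def, THEN conjunct2, rule_format, OF F eB] by blast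
  have "L2_dist target (R_ext G) (R_ext F) < e" if G: "G \<in> energy_space" "energy_dist G F < d" for G
  proof -
    have "l2_dist_sq target (R_ext G) (R_ext F) = l2sq target (\<lambda>x. rho (fst x) * (T_ext G x - T_ext F x))"
      by (simp add: R_ext_def right_diff_distrib)
    also have "\<dots> \<le> B\<^sup>2 * l2_dist_sq target (T_ext G) (T_ext F)"
      by (rule B(2)[OF L2_diff[OF T_ext(1)[OF G(1)] T_ext(1)[OF F]]])
    finally have "L2_dist target (R_ext G) (R_ext F) \<le> sqrt (B\<^sup>2 * l2_dist_sq target (T_ext G) (T_ext F))"
      unfolding L2_dist_l2sq by (rule real_sqrt_le_mono)
    also have "\<dots> = B * L2_dist target (T_ext G) (T_ext F)"
      using B(1) by (simp add: L2_dist_l2sq real_sqrt_mult)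
    also have "\<dots> < B * (e / B)" using d(2)[OF G] B(1) by (rule mult_strict_left_mono)
    also have "\<dots> = e" using B(1) by simp
    finally show ?thesis .
  qed
  then show "\<exists>d>0. \<forall>G\<in>energy_space. energy_dist G F < d \<longrightarrow> L2_dist target (R_ext G) (R_ext F) < e"
    using d(1) by blast
qed

text \<open>
  For every \<open>\<xi>\<close> the density is determined almost everywhere on the boundary. Both functions
  compared here are jointly measurable, so they agree almost everywhere on the product.
\<close>

lemma is_R_plus_fin_AE:
  assumes R: "is_R_plus R" and f: "f \<in> fin_pairs"
  shows "AE x in target. R (energy_embed f) x = R_plus_fin f x"
proof -
  obtain G where G: "is_R_plus_fin f G" "AE x in target. R (energy_embed f) x = G x"
    using R f unfolding is_R_plus_def by blast
  have RL: "R (energy_embed f) \<in> L2 target"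
    using R energy_embed(1)[OF f] unfolding is_R_plus_def continuous_into_L2_def by blast
  have m: "(\<lambda>x. R (energy_embed f) x - R_plus_fin f x) \<in> borel_measurable target"
    by (rule L2_measurable[OF L2_diff[OF RL R_plus_fin_L2[OF f]]])
  show ?thesis
  proof (rule P.AE_pair_measure)
    have "{x \<in> space target. R (energy_embed f) x = R_plus_fin f x}
        = (\<lambda>x. R (energy_embed f) x - R_plus_fin f x) -` {0} \<inter> space target"
      by auto
    then show "{x \<in> space target. R (energy_embed f) x = R_plus_fin f x} \<in> sets target"
      using measurable_sets[OF m, of "{0}"] by simp
    have "AE \<xi> in circle_measure. AE \<omega> in \<nu>. R (energy_embed f) (\<xi>, \<omega>) = G (\<xi>, \<omega>)"
      by (rule P.AE_pair[OF G(2)])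
    moreover have "AE \<xi> in circle_measure. cmod \<xi> = 1" by (rule AE_I2) (simp add: space_circle)
    ultimately show "AE \<xi> in circle_measure. AE \<omega> in \<nu>. R (energy_embed f) (\<xi>, \<omega>) = R_plus_fin f (\<xi>, \<omega>)"
    proof eventually_elim
      case (elim \<xi>)
      from elim(1) is_R_plus_fin_unique[OF f G(1) elim(2)] show ?case by eventually_elim simp
    qed
  qed
qed

lemma is_R_plus_limit:
  assumes R: "is_R_plus R" and F: "F \<in> energy_space" "X \<in> F"
  shows "R F \<in> L2 target" "(\<lambda>n. l2_dist_sq target (R_plus_fin (X n)) (R F)) \<longlonglongrightarrow> 0"
proof -
  have c: "continuous_into_L2 R" using R by (simp add: is_R_plus_def)
  show "R F \<in> L2 target"
    by (rule continuous_extension_limit(1)[OF c R_plus_fin_L2 is_R_plus_fin_AE[OF R] F])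
  show "(\<lambda>n. l2_dist_sq target (R_plus_fin (X n)) (R F)) \<longlonglongrightarrow> 0"
    by (rule continuous_extension_limit(2)[OF c R_plus_fin_L2 is_R_plus_fin_AE[OF R] F])
qed

lemma is_R_plus_unique:
  assumes R: "is_R_plus R" and F: "F \<in> energy_space"
  shows "AE x in target. R F x = R_ext F x"
proof -
  obtain X where X: "X \<in> F" using energy_spaceE[OF F] by blast
  note l1 = is_R_plus_limit[OF R F X] and l2 = is_R_plus_limit[OF is_R_plus_R_ext F X]
  show ?thesis
    by (rule L2_limit_unique[OF _ l1(1) l2(1) l1(2) l2(2)])
       (intro R_plus_fin_L2 energy_space_member(2)[OF F X])
qed

text \<open>
  A sequence in the image that converges in \<open>L\<^sup>2\<close> comes from an energy Cauchy sequence, by the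
  isometry.
\<close>

lemma T_ext_surj:
  assumes "F \<in> L2 target" shows "\<exists>f\<in>energy_space. AE x in target. T_ext f x = F x"
proof -
  have "\<forall>n. \<exists>f. f \<in> fin_pairs \<and> l2_dist_sq target F (T_plus_fin f) < inverse (real (Suc n))"
  proof
    fix n
    have "\<exists>G\<in>T_plus_fin ` fin_pairs. l2_dist_sq target F G < inverse (real (Suc n))"
      using image_dense[OF assms] unfolding L2_closure_def by simp
    then show "\<exists>f. f \<in> fin_pairs \<and> l2_dist_sq target F (T_plus_fin f) < inverse (real (Suc n))" by blast
  qed
  from choice[OF this] obtain X where
    X: "\<And>n. X n \<in> fin_pairs" "\<And>n. l2_dist_sq target F (T_plus_fin (X n)) < inverse (real (Suc n))" by blast
  note tX = T_plus_fin_L2[OF X(1)]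
  have "norm (l2_dist_sq target (T_plus_fin (X n)) F) \<le> inverse (real (Suc n))" for n
    using X(2)[of n] l2sq_minus_commute[of target F] by (simp add: l2sq_nonneg)
  then have lim: "(\<lambda>n. l2_dist_sq target (T_plus_fin (X n)) F) \<longlonglongrightarrow> 0"
    by (intro Lim_null_comparison[OF always_eventually LIMSEQ_inverse_real_of_nat] allI)
  have "X \<in> energy_Cauchy" unfolding energy_Cauchy_def
  proof (intro CollectI conjI allI impI X(1))
    fix e :: real assume e: "e > 0"
    then have "e\<^sup>2 * iso_const / 4 > 0" using iso_const_pos by simp
    from order_tendstoD(2)[OF lim this] obtain N where
      N: "\<And>n. n \<ge> N \<Longrightarrow> l2_dist_sq target (T_plus_fin (X n)) F < e\<^sup>2 * iso_const / 4"
      unfolding eventually_sequentially by blast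
    have "energy_norm (X m - X n) < e" if "m \<ge> N" "n \<ge> N" for m n
    proof -
      have "l2_dist_sq target (T_plus_fin (X m)) (T_plus_fin (X n))
          \<le> 2 * l2_dist_sq target (T_plus_fin (X m)) F + 2 * l2_dist_sq target F (T_plus_fin (X n))"
        by (rule l2sq_triangle[OF tX assms tX])
      also have "\<dots> < e\<^sup>2 * iso_const" using N[OF that(1)] N[OF that(2)] l2sq_minus_commute[of target F] by simp
      finally have "l2_dist_sq target (T_plus_fin (X m)) (T_plus_fin (X n)) / iso_const < e\<^sup>2"
        using iso_const_pos by (simp add: pos_divide_less_eq)
      then have "energy_norm (X m - X n) < sqrt (e\<^sup>2)"
        unfolding energy_norm_diff[OF X(1) X(1)] by (rule real_sqrt_less_mono)
      then show ?thesis using e by simp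
    qed
    then show "\<exists>N. \<forall>m\<ge>N. \<forall>n\<ge>N. energy_norm (X m - X n) < e" by blast
  qed
  then have f: "energy_equiv `` {X} \<in> energy_space" unfolding energy_space_def by (rule quotientI)
  have "energy_norm (X n - X n) = 0" for n unfolding energy_norm_diff[OF X(1) X(1)] by (simp add: l2sq_def)
  then have XX: "X \<in> energy_equiv `` {X}" using \<open>X \<in> energy_Cauchy\<close> by (simp add: energy_equiv_def)
  have "AE x in target. T_ext (energy_equiv `` {X}) x = F x"
    by (rule L2_limit_unique[OF tX T_ext(1)[OF f] assms T_ext(2)[OF f XX] lim])
  then show ?thesis using f by blast
qed

section \<open>The inversion formula\<close>

text \<open>
  Integration of \<open>R\<^sub>+ f\<close> against this kernel takes the Poisson transform at \<open>v\<close> and then the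
  Fourier coefficient at time \<open>t\<close>, and returns \<open>2\<pi>\<close> times the solution.
\<close>

abbreviation inv_kernel :: "'v \<Rightarrow> int \<Rightarrow> complex \<times> (nat \<Rightarrow> 'v) set \<Rightarrow> complex" where
  "inv_kernel v t x \<equiv> fst x powi (- t) * horo (fst x) v (snd x)"

lemma inv_kernel_L2: "inv_kernel v t \<in> L2 target"
  by (rule L2_circle_mult[OF _ horo_L2(1)]) (intro continuous_intros, auto)

lemma wave_fin_inversion:
  assumes "f \<in> fin_pairs"
  shows "(\<integral>x. R_plus_fin f x * inv_kernel v t x \<partial>target) = 2 * pi * wave_fin f v t"
proof -
  have "(\<integral>x. R_plus_fin f x * inv_kernel v t x \<partial>target) = (\<integral>\<xi>. (\<integral>\<omega>. R_plus_fin f (\<xi>, \<omega>) * inv_kernel v t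
      (\<xi>, \<omega>) \<partial>\<nu>) \<partial>circle_measure)"
    by (rule P.integral_fst'[symmetric]) (rule L2_mult_integrable[OF R_plus_fin_L2[OF assms] inv_kernel_L2])
  also have "\<dots> = (\<integral>\<xi>. wave_hat f \<xi> v * \<xi> powi (- t) \<partial>circle_measure)"
  proof (rule Bochner_Integration.integral_cong[OF refl])
    fix \<xi> assume "\<xi> \<in> space circle_measure"
    then have \<xi>: "cmod \<xi> = 1" by (simp add: space_circle)
    have "(\<integral>\<omega>. R_plus_fin f (\<xi>, \<omega>) * inv_kernel v t (\<xi>, \<omega>) \<partial>\<nu>)
        = (\<integral>\<omega>. (horo \<xi> v \<omega> * R_plus_fin f (\<xi>, \<omega>)) * \<xi> powi (- t) \<partial>\<nu>)"
      by (rule Bochner_Integration.integral_cong) (simp_all add: ac_simps)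
    also have "\<dots> = wave_hat f \<xi> v * \<xi> powi (- t)"
      unfolding wave_hat_eq_integral[OF assms \<xi>] by (rule integral_mult_left_zero)
    finally show "(\<integral>\<omega>. R_plus_fin f (\<xi>, \<omega>) * inv_kernel v t (\<xi>, \<omega>) \<partial>\<nu>) = wave_hat f \<xi> v * \<xi> powi (- t)" .
  qed
  finally show ?thesis using wave_hat_fourier[OF assms, of v "- t"] by simp
qed

text \<open>
  The kernel is square integrable, so the right hand side is continuous on the energy space.
\<close>

lemma wave_inversion:
  assumes R: "is_R_plus R" and F: "F \<in> energy_space"
  shows "wave F v t = (\<integral>x. R F x * inv_kernel v t x \<partial>target) / of_real (2 * pi)"
proof -
  have conv: "(\<lambda>n. wave_fin (X n) v t) \<longlonglongrightarrow> (\<integral>x. R F x * inv_kernel v t x \<partial>target) / of_real (2 * pi)"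
      if X: "X \<in> F" for X
  proof -
    note fX = energy_space_member(2)[OF F X]
    note l = is_R_plus_limit[OF R F X]
    have "(\<lambda>n. \<integral>x. R_plus_fin (X n) x * inv_kernel v t x \<partial>target) \<longlonglongrightarrow> (\<integral>x. R F x * inv_kernel v t x \<partial>target)"
      by (rule L2_functional_tendsto[OF R_plus_fin_L2[OF fX] l inv_kernel_L2])
    then have "(\<lambda>n. (\<integral>x. R_plus_fin (X n) x * inv_kernel v t x \<partial>target) / of_real (2 * pi))
        \<longlonglongrightarrow> (\<integral>x. R F x * inv_kernel v t x \<partial>target) / of_real (2 * pi)"
      by (rule tendsto_divide[OF _ tendsto_const]) simp
    then show ?thesis unfolding wave_fin_inversion[OF fX] by simp
  qed
  obtain X where X: "X \<in> F" using energy_spaceE[OF F] by blast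
  show ?thesis unfolding wave_def
  proof (rule the_equality)
    show "\<forall>X\<in>F. (\<lambda>n. wave_fin (X n) v t) \<longlonglongrightarrow> (\<integral>x. R F x * inv_kernel v t x \<partial>target) / of_real (2 * pi)"
        using conv by blast
    fix c assume "\<forall>X\<in>F. (\<lambda>n. wave_fin (X n) v t) \<longlonglongrightarrow> c"
    then have "(\<lambda>n. wave_fin (X n) v t) \<longlonglongrightarrow> c" using X by blast
    then show "c = (\<integral>x. R F x * inv_kernel v t x \<partial>target) / of_real (2 * pi)" using conv[OF X]
        by (rule LIMSEQ_unique)
  qed
qed

text \<open>
  The inversion formula with the integral over the circle carried out first: on the circle,
  \<open>\<xi>\<^sup>-\<^sup>t horo \<xi> v \<omega>\<close> is \<open>\<xi>\<close> to the power \<open>h - t\<close> times \<open>q\<close> to the power \<open>h/2\<close>, where \<open>h\<close> is the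
  value of the Busemann function.
\<close>

lemma wave_k_plus:
  assumes R: "is_R_plus R" and F: "F \<in> energy_space"
  shows "has_bochner_integral \<nu>
    (\<lambda>\<omega>. of_real (real q powr (of_int (busemann \<omega> v) / 2)) * k_plus (R F) (busemann \<omega> v - t) \<omega>) (wave F v t)"
proof -
  obtain X where X: "X \<in> F" using energy_spaceE[OF F] by blast
  have RL: "R F \<in> L2 target" by (rule is_R_plus_limit(1)[OF R F X])
  let ?f = "\<lambda>\<xi> \<omega>. R F (\<xi>, \<omega>) * inv_kernel v t (\<xi>, \<omega>)"
  have i: "integrable target (case_prod ?f)"
    using L2_mult_integrable[OF RL inv_kernel_L2[where v = v and t = t]] by (simp add: case_prod_unfold)
  have k: "of_real (real q powr (of_int (busemann \<omega> v) / 2)) * k_plus (R F) (busemann \<omega> v - t) \<omega>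
      = (\<integral>\<xi>. ?f \<xi> \<omega> \<partial>circle_measure) / of_real (2 * pi)" for \<omega>
  proof -
    let ?c = "of_real (real q powr (of_int (busemann \<omega> v) / 2)) :: complex"
    have "(\<integral>\<xi>. ?f \<xi> \<omega> \<partial>circle_measure) = (\<integral>\<xi>. ?c * (R F (\<xi>, \<omega>) * \<xi> powi (busemann \<omega> v - t)) \<partial>circle_measure)"
    proof (rule Bochner_Integration.integral_cong[OF refl])
      fix \<xi> assume "\<xi> \<in> space circle_measure"
      then have nz: "\<xi> \<noteq> 0" by (auto simp: space_circle)
      show "?f \<xi> \<omega> = ?c * (R F (\<xi>, \<omega>) * \<xi> powi (busemann \<omega> v - t))"
      proof -
        have "\<xi> powi (busemann \<omega> v - t) = \<xi> powi busemann \<omega> v * \<xi> powi (- t)"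
          using power_int_add[of \<xi> "busemann \<omega> v" "- t"] nz by simp
        then show ?thesis unfolding horo_def fst_conv snd_conv by (simp only: ac_simps)
      qed
    qed
    also have "\<dots> = ?c * (\<integral>\<xi>. R F (\<xi>, \<omega>) * \<xi> powi (busemann \<omega> v - t) \<partial>circle_measure)"
        by (rule integral_mult_right_zero)
    finally show ?thesis by (simp add: k_plus_def)
  qed
  have "has_bochner_integral \<nu> (\<lambda>\<omega>. \<integral>\<xi>. ?f \<xi> \<omega> \<partial>circle_measure) (integral\<^sup>L target (case_prod ?f))"
    unfolding has_bochner_integral_iff using P.integrable_snd[OF i] P.integral_snd[OF i] by blast
  then have "has_bochner_integral \<nu> (\<lambda>\<omega>. (\<integral>\<xi>. ?f \<xi> \<omega> \<partial>circle_measure) / of_real (2 * pi)) (integral\<^sup>L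
      target (case_prod ?f) / of_real (2 * pi))"
    by (rule has_bochner_integral_divide_zero)
  then show ?thesis unfolding k wave_inversion[OF R F] by (simp add: case_prod_unfold)
qed

lemma T_plus_eq_R_plus:
  assumes "is_R_plus R" "is_T_plus T" "F \<in> energy_space"
  shows "AE (\<xi>, \<omega>) in target. T F (\<xi>, \<omega>) = (\<xi> - inverse (of_nat q) * inverse \<xi>) / (1 + inverse (of_nat q))
      * R F (\<xi>, \<omega>)"
  using is_T_plus_unique(2)[OF assms(2,3)] is_R_plus_unique[OF assms(1,3)] AE_space
proof eventually_elim
  case (elim x)
  obtain \<xi> \<omega> where x: "x = (\<xi>, \<omega>)" "cmod \<xi> = 1" using elim(3) by (auto simp: space_target)
  have "1 + inverse (of_nat q) \<noteq> (0 :: complex)"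
  proof -
    have "1 + inverse (of_nat q) = (of_nat q + 1) / (of_nat q :: complex)" using q_ne_complex
        by (simp add: field_simps)
    then show ?thesis using q_ne_complex by simp
  qed
  then have "(\<xi> - inverse (of_nat q) * inverse \<xi>) / (1 + inverse (of_nat q)) * rho \<xi> = 1"
    using circle_denominators(1)[OF x(2)] by (simp add: rho_def)
  then show ?case using elim(1,2) unfolding x by (simp add: R_ext_def flip: mult.assoc)
qed

lemma is_T_plus_isometry:
  assumes T: "is_T_plus T" and F: "F \<in> energy_space" and G: "G \<in> energy_space"
  shows "L2_inner target (T F) (T G) = of_real (4 * pi * real q / (real q + 1)) * energy_inner F G"
proof -
  note TF = is_T_plus_unique[OF T F] and TG = is_T_plus_unique[OF T G]
  have "L2_inner target (T F) (T G) = L2_inner target (T_ext F) (T_ext G)"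
    unfolding L2_inner_def
  proof (rule integral_cong_AE)
    show "(\<lambda>x. T F x * cnj (T G x)) \<in> borel_measurable target" "(\<lambda>x. T_ext F x * cnj (T_ext G x)) \<in>
        borel_measurable target"
      by (intro borel_measurable_times L2_measurable L2_cnj TF TG T_ext(1) F G)+
    show "AE x in target. T F x * cnj (T G x) = T_ext F x * cnj (T_ext G x)"
      using TF(2) TG(2) by eventually_elim simp
  qed
  then show ?thesis unfolding energy_inner_eq[OF F G] iso_const_def .
qed

lemma is_T_plus_surj:
  assumes T: "is_T_plus T" and F: "F \<in> L2 target"
  shows "\<exists>f\<in>energy_space. AE x in target. T f x = F x"
proof -
  obtain f where f: "f \<in> energy_space" "AE x in target. T_ext f x = F x" using T_ext_surj[OF F] by blast
  have "AE x in target. T f x = F x"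
    using is_T_plus_unique(2)[OF T f(1)] f(2) by eventually_elim simp
  then show ?thesis using f(1) by blast
qed

end

theorem theorem3p13:
  fixes q :: nat and adj :: "'v \<Rightarrow> 'v \<Rightarrow> bool" and x0 :: 'v
    and \<nu> :: "(nat \<Rightarrow> 'v) set measure"
  assumes "regular_tree_measure q adj x0 \<nu>"
  shows
    "(\<exists>R. regular_tree_measure.is_R_plus q adj x0 \<nu> R)
   \<and> ((\<exists>T. regular_tree_measure.is_T_plus q adj x0 \<nu> T) \<and>
      (\<forall>T. regular_tree_measure.is_T_plus q adj x0 \<nu> T \<longrightarrow>
         (\<forall>f\<in>regular_tree.energy_space q adj. \<forall>g\<in>regular_tree.energy_space q adj.
            L2_inner (circle_measure \<Otimes>\<^sub>M \<nu>) (T f) (T g)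
              = of_real (4 * pi * real q / (real q + 1)) * regular_tree.energy_inner q adj f g) \<and>
         (\<forall>F\<in>L2 (circle_measure \<Otimes>\<^sub>M \<nu>). \<exists>f\<in>regular_tree.energy_space q adj.
            AE x in circle_measure \<Otimes>\<^sub>M \<nu>. T f x = F x)))
   \<and> (\<forall>R. regular_tree_measure.is_R_plus q adj x0 \<nu> R \<longrightarrow>
        (\<forall>f\<in>regular_tree.energy_space q adj. \<forall>v t.
           has_bochner_integral \<nu>
             (\<lambda>\<omega>. of_real (real q powr (of_int (regular_tree.busemann adj x0 \<omega> v) / 2)) *
                   k_plus (R f) (regular_tree.busemann adj x0 \<omega> v - t) \<omega>)
             (regular_tree.wave q adj f v t)))
   \<and> (\<forall>R T. regular_tree_measure.is_R_plus q adj x0 \<nu> R \<longrightarrow>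
              regular_tree_measure.is_T_plus q adj x0 \<nu> T \<longrightarrow>
        (\<forall>f\<in>regular_tree.energy_space q adj.
           AE (\<xi>, \<omega>) in circle_measure \<Otimes>\<^sub>M \<nu>.
             T f (\<xi>, \<omega>) = (\<xi> - inverse (of_nat q) * inverse \<xi>) / (1 + inverse (of_nat q)) * R f (\<xi>, \<omega>)))"
proof -
  interpret regular_tree_measure q adj x0 \<nu> by fact
  show ?thesis
  proof (intro conjI allI impI ballI)
    show "\<exists>R. is_R_plus R" using is_R_plus_R_ext by blast
    show "\<exists>T. is_T_plus T" using is_T_plus_T_ext by blast
  next
    fix T f g assume "is_T_plus T" "f \<in> energy_space" "g \<in> energy_space"
    then show "L2_inner target (T f) (T g) = of_real (4 * pi * real q / (real q + 1)) * energy_inner f g"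
      by (rule is_T_plus_isometry)
  next
    fix T F assume "is_T_plus T" "F \<in> L2 target"
    then show "\<exists>f\<in>energy_space. AE x in target. T f x = F x" by (rule is_T_plus_surj)
  next
    fix R f v t assume "is_R_plus R" "f \<in> energy_space"
    then show "has_bochner_integral \<nu>
        (\<lambda>\<omega>. of_real (real q powr (of_int (busemann \<omega> v) / 2)) * k_plus (R f) (busemann \<omega> v - t) \<omega>) (wave f v t)"
      by (rule wave_k_plus)
  next
    fix R T f assume "is_R_plus R" "is_T_plus T" "f \<in> energy_space"
    then show "AE (\<xi>, \<omega>) in target.
        T f (\<xi>, \<omega>) = (\<xi> - inverse (of_nat q) * inverse \<xi>) / (1 + inverse (of_nat q)) * R f (\<xi>, \<omega>)"
      by (rule T_plus_eq_R_plus)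
  qed
qed

end
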